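(* Let $\mathbb{C}$ be an $\omega\mathbf{CPO}$-enriched stable bi-CCC. The following hold for well-typed terms of the $\lambda_c^{\mathrm{fix}}$-calculus (terms may contain recursion $\mu fx.M$). (a) Let $\mathcal{A}=(\mathbb{C},T,A,a)$ be a $\lambda_c^{\mathrm{fix}}(\Sigma)$-structure, $U$ a strong monad on $\mathbb{C}_0$ and $\alpha\colon T\Rightarrow U$ a strong monad morphism; regard $\alpha(\mathcal{A})=(\mathbb{C},U,A,\alpha(a))$ as a $\lambda_c^{\mathrm{fix}}(\Sigma)$-structure with $\bot^U_0:=\alpha_0\circ\bot^T_0$. Let $\tau^T\colon T\Omega^T\to\Omega^T$, $\tau^U\colon U\Omega^U\to\Omega^U$ be Eilenberg–Moore algebras and $q\colon\Omega^T\to\Omega^U$ an inference query for $\alpha,\tau^T,\tau^U$. Then for every well-typed $\Gamma\vdash M\colon\mathbf{t}$ with all types in $\Gamma$ and $\mathbf{t}$ ground and every $Q\colon[\![\mathbf{t}]\!]\to\Omega^T$: $q\circ\mathrm{wp}^{\mathcal{A}}_{\tau^T}[M](Q)=\mathrm{wp}^{\alpha(\mathcal{A})}_{\tau^U}[M](q\circ Q)$. (b) Let $T$ be a strong monad on $\mathbb{C}_0$, $Y$ an object, $S:=T(-\times Y)^Y$, and suppose $\mathcal{A}_S=(\mathbb{C},S,A,a)$ is a $\lambda_c^{\mathrm{fix}}(\Sigma)$-structure and $\mathcal{A}_T=(\mathbb{C},T,A,\mathrm{SPS}(a))$ is a $\lambda_c^{\mathrm{fix}}(\mathrm{SPS}(\Sigma))$-structure.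 Let $\tau^T\colon T\Omega\to\Omega$ be an Eilenberg–Moore algebra and $\tau^S:=(\tau^T)^Y\circ T(\mathrm{ev}_{\Omega,Y})^Y$. Then for every well-typed $\Gamma\vdash M\colon\mathbf{t}$ over $\Sigma$ and every $Q\colon[\![\mathbf{t}]\!]_S\to\Omega^Y$: $\big(\mathrm{wp}^{\mathcal{A}_S}_{\tau^S}[M](Q)\circ\rho_\Gamma^{-1}\big)^\dagger=\mathrm{wp}^{\mathcal{A}_T}_{\tau^T}[\mathrm{SPS}(M)]\big((Q\circ\rho_{\mathbf{t}}^{-1})^\dagger\big)$; in particular, if all types in $\Gamma,\mathbf{t}$ are ground, $\big(\mathrm{wp}^{\mathcal{A}_S}_{\tau^S}[M](Q)\big)^\dagger=\mathrm{wp}^{\mathcal{A}_T}_{\tau^T}[\mathrm{SPS}(M)](Q^\dagger)$.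
   Context: $\mathbb{C}$ is $\omega\mathbf{CPO}$-enriched bi-CCC: each homset is an $\omega$-cpo and composition, tupling, cotupling and currying are $\omega$-continuous; $\mathbb{C}_0$ is its underlying CCC; stable means binary coproducts are stable under pullback. $\mathrm{ev}$ is evaluation; $(\cdot)^\dagger$ is transposition along $(-\times Y)\dashv(-)^Y$. A pseudo-lifting strong monad $T$ on $\mathbb{C}$ is a strong monad on $\mathbb{C}_0$ with $\bot^T_0\colon1\to T(0)$ such that $\bot^T_X:=T(!_X)\circ\bot^T_0$ is least in $\mathbb{C}(1,TX)$ for all $X$ (for a strong monad morphism $\alpha\colon T\Rightarrow U$, $\alpha\circ\bot^T_0$ likewise induces least elements for $U$). $S=T(-\times Y)^Y$ has unit $(\eta^T_{X\times Y})^\dagger$, multiplication $(\mu^T_{X\times Y}\circ T(\mathrm{ev}))^Y$, strength $(\mathrm{st}^T\circ(X\times\mathrm{ev}))^\dagger$. A strong monad morphism $\alpha\colon T\Rightarrow U$ is a natural transformation commuting with units, multiplications ($\alpha\circ\mu^T=\mu^U\circ U\alpha\circ\alpha_T$) and strengths. Syntax: base types $B$; types $\mathbf{t}::=b\mid\mathbf{1}\mid\mathbf{t}_1\times\mathbf{t}_2\mid\mathbf{0}\mid\mathbf{t}_1+\mathbf{t}_2\mid\mathbf{t}_1\to\mathbf{t}_2$, ground types have no $\to$; signature $\Sigma=(B,K,E,\mathrm{ar},\mathrm{car})$; terms $x\mid c\,M\mid e\,M\mid()\mid(M,N)\mid\pi_iM\mid\delta(M)\mid\iota_iM\mid\delta(M,x_1\colon\mathbf{t}_1.N_1,x_2\colon\mathbf{t}_2.N_2)\mid\lambda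 x\colon\mathbf{t}.M\mid M\,N\mid\mu fx.M$, standard typing plus: from $\Gamma,f\colon\mathbf{t}_1\to\mathbf{t}_2,x\colon\mathbf{t}_1\vdash M\colon\mathbf{t}_2$ infer $\Gamma\vdash\mu fx.M\colon\mathbf{t}_1\to\mathbf{t}_2$. A $\lambda_c^{\mathrm{fix}}(\Sigma)$-structure $(\mathbb{C},T,A,a)$: $T$ pseudo-lifting, $A(b)$ objects, $a(c)\colon[\![\mathrm{ar}(c)]\!]\to[\![\mathrm{car}(c)]\!]$, $a(e)\colon[\![\mathrm{ar}(e)]\!]\to T[\![\mathrm{car}(e)]\!]$. Types via the bi-CCC structure, $[\![\mathbf{t}_1\to\mathbf{t}_2]\!]=T[\![\mathbf{t}_2]\!]^{[\![\mathbf{t}_1]\!]}$; terms $[\![M]\!]\colon[\![\Gamma]\!]\to T[\![\mathbf{t}]\!]$ by Moggi's call-by-value semantics ($[\![x_i]\!]=\eta\pi_i$, $[\![()]\!]=\eta!$, $[\![c\,M]\!]=T(a(c))[\![M]\!]$, $[\![e\,M]\!]=\mu T(a(e))[\![M]\!]$, $[\![(M,N)]\!]=\mu T(\mathrm{st})\mathrm{st}'\langle[\![M]\!],[\![N]\!]\rangle$, $[\![\pi_iM]\!]=T\pi_i[\![M]\!]$, $[\![\iota_iM]\!]=T\iota_i[\![M]\!]$, $[\![\delta(M)]\!]=T![\![M]\!]$, $[\![\delta(M,x_1.N_1,x_2.N_2)]\!]=\mu T([[\![N_1]\!],[\![N_2]\!]]\mathrm{dist})\mathrm{st}\langle\mathrm{id},[\![M]\!]\rangle$,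 $[\![\lambda x.M]\!]=\eta[\![M]\!]^\dagger$, $[\![M\,N]\!]=\mu T\mu T^2(\mathrm{ev})T(\mathrm{st})\mathrm{st}'\langle[\![M]\!],[\![N]\!]\rangle$). Recursion: for $f\colon X\times TZ\to TZ$, $\mathrm{fix}(f):=\pi_2\circ\bigvee_n\langle\pi_1,f\rangle^n\circ\langle\mathrm{id}_X,\bot^T_Z\circ!_X\rangle$; $\mathrm{al}_{X,Z}:=(\mu^T_Z\circ T(\mathrm{ev})\circ\mathrm{st}')^\dagger\colon T(TZ^X)\to TZ^X$; $[\![\mu fx.M]\!]=\eta\circ\mathrm{al}\circ\mathrm{fix}([\![\Gamma,f\vdash\lambda x.M]\!]\circ(\mathrm{id}\times\mathrm{al}))$. $\alpha(\mathcal{A})=(\mathbb{C},U,A,\alpha(a))$ with $\alpha(a)(c)=a(c)$, $\alpha(a)(e)=\alpha\circ a(e)$. Weakest pre-condition: $\mathrm{wp}^{\mathcal{A}}_\tau[M](Q):=\tau\circ T(Q)\circ[\![M]\!]^{\mathcal{A}}$. Inference query: $q\colon\Omega^T\to\Omega^U$ with $q\circ\tau^T=\tau^U\circ U(q)\circ\alpha_{\Omega^T}$. SPS transformation: add base type $b^Y$, $A(b^Y)=Y$. $\mathbf{t}^\circ=\mathbf{t}$ for $b,\mathbf{1},\mathbf{0}$, $(\cdot)^\circ$ commutes with $\times,+$, $(\mathbf{t}_1\to\mathbf{t}_2)^\circ=(\mathbf{t}_1^\circ\times b^Y)\to(\mathbf{t}_2^\circ\times b^Y)$, $\mathrm{SPS}(\mathbf{t})=\mathbf{t}^\circ\times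 b^Y$, $\mathrm{SPS}(x_1\colon\mathbf{t}_1,\dots)=x_1\colon\mathbf{t}_1^\circ,\dots,y\colon b^Y$. Terms ($z$ fresh): $\mathrm{SPS}(x)=(x,y)$; $\mathrm{SPS}(c\,M)=c\,\mathrm{SPS}(M)$; $\mathrm{SPS}(e\,M)=e\,\mathrm{SPS}(M)$; $\mathrm{SPS}(())=((),y)$; $\mathrm{SPS}((M,N))=(\lambda z.((\pi_1z,\pi_1\pi_2z),\pi_2\pi_2z))((\lambda z.(\pi_1z,(\lambda y.\mathrm{SPS}(N))(\pi_2z)))\mathrm{SPS}(M))$; $\mathrm{SPS}(\pi_iM)=(\lambda z.(\pi_i\pi_1z,\pi_2z))\mathrm{SPS}(M)$; $\mathrm{SPS}(\delta(M))=(\lambda z.(\delta(\pi_1z),\pi_2z))\mathrm{SPS}(M)$; $\mathrm{SPS}(\iota_iM)=(\lambda z.(\iota_i\pi_1z,\pi_2z))\mathrm{SPS}(M)$; $\mathrm{SPS}(\delta(M,x_1\colon\mathbf{t}_1.M_1,x_2\colon\mathbf{t}_2.M_2))=\delta(N,z\colon\mathrm{SPS}(\mathbf{t}_1).\mathrm{SPS}(M_1)[\pi_1z/x_1,\pi_2z/y],z\colon\mathrm{SPS}(\mathbf{t}_2).\mathrm{SPS}(M_2)[\pi_1z/x_2,\pi_2z/y])$ with $N=(\lambda z.\delta(\pi_1z,x_1\colon\mathbf{t}_1^\circ.\iota_1(x_1,\pi_2z),x_2\colon\mathbf{t}_2^\circ.\iota_2(x_2,\pi_2z)))\mathrm{SPS}(M)$;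 $\mathrm{SPS}(\lambda x\colon\mathbf{t}_1.M)=(\lambda z\colon\mathrm{SPS}(\mathbf{t}_1).\mathrm{SPS}(M)[\pi_1z/x,\pi_2z/y],y)$; $\mathrm{SPS}(M\,N)=(\lambda z.(\pi_1z)((\lambda y.\mathrm{SPS}(N))(\pi_2z)))\mathrm{SPS}(M)$; $\mathrm{SPS}(\mu fx.M)=(\mu fz.\mathrm{SPS}(M)[\pi_1z/x,\pi_2z/y],y)$. $\mathrm{SPS}(\Sigma)=(B+\{b^Y\},K,E,\mathrm{ar}',\mathrm{car}')$ with $\mathrm{ar}'(k)=\mathrm{ar}(k)\times b^Y$, $\mathrm{car}'(k)=\mathrm{car}(k)\times b^Y$; $\mathrm{SPS}(a)(c)=a(c)\times\mathrm{id}_Y$, $\mathrm{SPS}(a)(e)=a(e)^\dagger$. $[\![\cdot]\!]_S,[\![\cdot]\!]_T$: type interpretations under $\mathcal{A}_S,\mathcal{A}_T$. Isomorphisms $\rho_{\mathbf{t}}\colon[\![\mathbf{t}]\!]_S\to[\![\mathbf{t}^\circ]\!]_T$: identity on $\mathbf{0},\mathbf{1},b$; componentwise on $\times,+$; $\rho_{\mathbf{t}_1\to\mathbf{t}_2}=\cong\circ S(\rho_{\mathbf{t}_2})^{\rho_{\mathbf{t}_1}^{-1}}$ (post-compose $S(\rho_{\mathbf{t}_2})$, pre-compose $\rho_{\mathbf{t}_1}^{-1}$, then currying iso $(T(W\times Y)^Y)^V\cong T(W\times Y)^{V\times Y}$); $\rho_\Gamma=\rho_{\mathbf{t}_1\times\cdots\times\mathbf{t}_m}$.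 Transposes $(\cdot)^\dagger$ turn $X\to\Omega^Y$ into $X\times Y\to\Omega$. *)

theory Defs
  imports Main
begin

section \<open>Omega-cpos and omega-continuous maps, relative to a carrier\<close>

definition omega_chain :: "'a set \<Rightarrow> ('a \<Rightarrow> 'a \<Rightarrow> bool) \<Rightarrow> (nat \<Rightarrow> 'a) \<Rightarrow> bool" where
  "omega_chain A le F \<longleftrightarrow> (\<forall>n. F n \<in> A \<and> le (F n) (F (Suc n)))"

definition is_omega_lub :: "'a set \<Rightarrow> ('a \<Rightarrow> 'a \<Rightarrow> bool) \<Rightarrow> (nat \<Rightarrow> 'a) \<Rightarrow> 'a \<Rightarrow> bool" where
  "is_omega_lub A le F x \<longleftrightarrow>
     x \<in> A \<and> (\<forall>n. le (F n) x) \<and> (\<forall>y\<in>A. (\<forall>n. le (F n) y) \<longrightarrow> le x y)"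

definition omega_lub :: "'a set \<Rightarrow> ('a \<Rightarrow> 'a \<Rightarrow> bool) \<Rightarrow> (nat \<Rightarrow> 'a) \<Rightarrow> 'a" where
  "omega_lub A le F = (THE x. is_omega_lub A le F x)"

text \<open>No least element is required.\<close>

definition omega_cpo :: "'a set \<Rightarrow> ('a \<Rightarrow> 'a \<Rightarrow> bool) \<Rightarrow> bool" where
  "omega_cpo A le \<longleftrightarrow>
     reflp_on A le \<and> transp_on A le \<and> antisymp_on A le \<and>
     (\<forall>F. omega_chain A le F \<longrightarrow> (\<exists>x. is_omega_lub A le F x))"

definition omega_continuous ::
  "'a set \<Rightarrow> ('a \<Rightarrow> 'a \<Rightarrow> bool) \<Rightarrow> 'b set \<Rightarrow> ('b \<Rightarrow> 'b \<Rightarrow> bool) \<Rightarrow> ('a \<Rightarrow> 'b) \<Rightarrow> bool" where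
  "omega_continuous A leA B leB f \<longleftrightarrow>
     f ` A \<subseteq> B \<and> monotone_on A leA leB f \<and>
     (\<forall>F x. omega_chain A leA F \<and> is_omega_lub A leA F x \<longrightarrow>
            is_omega_lub B leB (f \<circ> F) (f x))"


section \<open>Omega-cpo-enriched bicartesian closed categories\<close>

text \<open>
  Objects are all elements of \<open>'o\<close>; arrows are the elements of \<open>arrs\<close>, each with its own source
  and target. \<open>Y \<leadsto> Z\<close> is the exponential of \<open>Z\<close> by \<open>Y\<close>, and \<open>curry X Y f\<close> transposes
  \<open>f\<close> from \<open>X \<otimes> Y\<close> to \<open>Z\<close>.  The factors \<open>X\<close>, \<open>Y\<close> are arguments because \<open>\<otimes>\<close> need not be
  injective on objects.
\<close>

record ('o, 'm) bicc =
  arrs :: "'m set"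
  src :: "'m \<Rightarrow> 'o"
  tgt :: "'m \<Rightarrow> 'o"
  idn :: "'o \<Rightarrow> 'm"
  cmp :: "'m \<Rightarrow> 'm \<Rightarrow> 'm" (infixr "\<cdot>\<index>" 55)
  le :: "'m \<Rightarrow> 'm \<Rightarrow> bool" (infix "\<sqsubseteq>\<index>" 50)
  one :: "'o" ("\<one>\<index>")
  bang :: "'o \<Rightarrow> 'm"
  times :: "'o \<Rightarrow> 'o \<Rightarrow> 'o" (infixr "\<otimes>\<index>" 70)
  pr1 :: "'o \<Rightarrow> 'o \<Rightarrow> 'm"
  pr2 :: "'o \<Rightarrow> 'o \<Rightarrow> 'm"
  tup :: "'m \<Rightarrow> 'm \<Rightarrow> 'm" ("\<langle>_, _\<rangle>\<index>")
  zero :: "'o" ("\<zero>\<index>")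
  cobang :: "'o \<Rightarrow> 'm"
  plus :: "'o \<Rightarrow> 'o \<Rightarrow> 'o" (infixr "\<oplus>\<index>" 65)
  in1 :: "'o \<Rightarrow> 'o \<Rightarrow> 'm"
  in2 :: "'o \<Rightarrow> 'o \<Rightarrow> 'm"
  cotup :: "'m \<Rightarrow> 'm \<Rightarrow> 'm"
  expo :: "'o \<Rightarrow> 'o \<Rightarrow> 'o" (infixr "\<leadsto>\<index>" 60)
  ev :: "'o \<Rightarrow> 'o \<Rightarrow> 'm"
  curry :: "'o \<Rightarrow> 'o \<Rightarrow> 'm \<Rightarrow> 'm"

definition hom :: "('o, 'm) bicc \<Rightarrow> 'o \<Rightarrow> 'o \<Rightarrow> 'm set" where
  "hom C X Y = {f \<in> arrs C. src C f = X \<and> tgt C f = Y}"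

definition times_arr :: "('o, 'm) bicc \<Rightarrow> 'm \<Rightarrow> 'm \<Rightarrow> 'm" (infixr "\<otimes>\<^sub>a\<index>" 70) where
  "times_arr C f g =
     \<langle>f \<cdot>\<^bsub>C\<^esub> pr1 C (src C f) (src C g), g \<cdot>\<^bsub>C\<^esub> pr2 C (src C f) (src C g)\<rangle>\<^bsub>C\<^esub>"

definition plus_arr :: "('o, 'm) bicc \<Rightarrow> 'm \<Rightarrow> 'm \<Rightarrow> 'm" (infixr "\<oplus>\<^sub>a\<index>" 65) where
  "plus_arr C f g =
     cotup C (in1 C (tgt C f) (tgt C g) \<cdot>\<^bsub>C\<^esub> f) (in2 C (tgt C f) (tgt C g) \<cdot>\<^bsub>C\<^esub> g)"

locale category =
  fixes C :: "('o, 'm) bicc" (structure)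
  assumes idn_hom: "idn C X \<in> hom C X X"
    and cmp_hom: "\<lbrakk>f \<in> hom C X Y; g \<in> hom C Y Z\<rbrakk> \<Longrightarrow> g \<cdot> f \<in> hom C X Z"
    and cmp_idn_left: "f \<in> hom C X Y \<Longrightarrow> idn C Y \<cdot> f = f"
    and cmp_idn_right: "f \<in> hom C X Y \<Longrightarrow> f \<cdot> idn C X = f"
    and cmp_assoc: "\<lbrakk>f \<in> hom C W X; g \<in> hom C X Y; h \<in> hom C Y Z\<rbrakk>
          \<Longrightarrow> (h \<cdot> g) \<cdot> f = h \<cdot> (g \<cdot> f)"

locale bicartesian_closed = category +
  assumes bang_hom: "bang C X \<in> hom C X \<one>"
    and bang_unique: "f \<in> hom C X \<one> \<Longrightarrow> f = bang C X"
    and pr1_hom: "pr1 C X Y \<in> hom C (X \<otimes> Y) X"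
    and pr2_hom: "pr2 C X Y \<in> hom C (X \<otimes> Y) Y"
    and tup_hom: "\<lbrakk>f \<in> hom C Z X; g \<in> hom C Z Y\<rbrakk> \<Longrightarrow> \<langle>f, g\<rangle> \<in> hom C Z (X \<otimes> Y)"
    and pr1_tup: "\<lbrakk>f \<in> hom C Z X; g \<in> hom C Z Y\<rbrakk> \<Longrightarrow> pr1 C X Y \<cdot> \<langle>f, g\<rangle> = f"
    and pr2_tup: "\<lbrakk>f \<in> hom C Z X; g \<in> hom C Z Y\<rbrakk> \<Longrightarrow> pr2 C X Y \<cdot> \<langle>f, g\<rangle> = g"
    and tup_unique: "h \<in> hom C Z (X \<otimes> Y) \<Longrightarrow> \<langle>pr1 C X Y \<cdot> h, pr2 C X Y \<cdot> h\<rangle> = h"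
    and cobang_hom: "cobang C X \<in> hom C \<zero> X"
    and cobang_unique: "f \<in> hom C \<zero> X \<Longrightarrow> f = cobang C X"
    and in1_hom: "in1 C X Y \<in> hom C X (X \<oplus> Y)"
    and in2_hom: "in2 C X Y \<in> hom C Y (X \<oplus> Y)"
    and cotup_hom: "\<lbrakk>f \<in> hom C X Z; g \<in> hom C Y Z\<rbrakk> \<Longrightarrow> cotup C f g \<in> hom C (X \<oplus> Y) Z"
    and cotup_in1: "\<lbrakk>f \<in> hom C X Z; g \<in> hom C Y Z\<rbrakk> \<Longrightarrow> cotup C f g \<cdot> in1 C X Y = f"
    and cotup_in2: "\<lbrakk>f \<in> hom C X Z; g \<in> hom C Y Z\<rbrakk> \<Longrightarrow> cotup C f g \<cdot> in2 C X Y = g"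
    and cotup_unique: "h \<in> hom C (X \<oplus> Y) Z \<Longrightarrow> cotup C (h \<cdot> in1 C X Y) (h \<cdot> in2 C X Y) = h"
    and ev_hom: "ev C Y Z \<in> hom C ((Y \<leadsto> Z) \<otimes> Y) Z"
    and curry_hom: "f \<in> hom C (X \<otimes> Y) Z \<Longrightarrow> curry C X Y f \<in> hom C X (Y \<leadsto> Z)"
    and ev_curry: "f \<in> hom C (X \<otimes> Y) Z \<Longrightarrow> ev C Y Z \<cdot> (curry C X Y f \<otimes>\<^sub>a idn C Y) = f"
    and curry_unique: "g \<in> hom C X (Y \<leadsto> Z) \<Longrightarrow> curry C X Y (ev C Y Z \<cdot> (g \<otimes>\<^sub>a idn C Y)) = g"

text \<open>A binary operation is continuous for the componentwise order, which is \<open>rel_prod le le\<close>.\<close>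

locale omega_cpo_bicc = bicartesian_closed +
  assumes hom_omega_cpo: "omega_cpo (hom C X Y) (le C)"
    and cmp_continuous: "omega_continuous (hom C Y Z \<times> hom C X Y) (rel_prod (le C) (le C))
          (hom C X Z) (le C) (\<lambda>(g, f). g \<cdot> f)"
    and tup_continuous: "omega_continuous (hom C Z X \<times> hom C Z Y) (rel_prod (le C) (le C))
          (hom C Z (X \<otimes> Y)) (le C) (\<lambda>(f, g). \<langle>f, g\<rangle>)"
    and cotup_continuous: "omega_continuous (hom C X Z \<times> hom C Y Z) (rel_prod (le C) (le C))
          (hom C (X \<oplus> Y) Z) (le C) (\<lambda>(f, g). cotup C f g)"
    and curry_continuous: "omega_continuous (hom C (X \<otimes> Y) Z) (le C)
          (hom C X (Y \<leadsto> Z)) (le C) (curry C X Y)"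

definition is_pullback ::
  "('o, 'm) bicc \<Rightarrow> 'o \<Rightarrow> 'o \<Rightarrow> 'o \<Rightarrow> 'o \<Rightarrow> 'm \<Rightarrow> 'm \<Rightarrow> 'm \<Rightarrow> 'm \<Rightarrow> bool" where
  "is_pullback C P X Y Z p q f g \<longleftrightarrow>
     p \<in> hom C P X \<and> q \<in> hom C P Y \<and> f \<in> hom C X Z \<and> g \<in> hom C Y Z \<and>
     f \<cdot>\<^bsub>C\<^esub> p = g \<cdot>\<^bsub>C\<^esub> q \<and>
     (\<forall>W. \<forall>u \<in> hom C W X. \<forall>v \<in> hom C W Y. f \<cdot>\<^bsub>C\<^esub> u = g \<cdot>\<^bsub>C\<^esub> v \<longrightarrow>
        (\<exists>!h. h \<in> hom C W P \<and> p \<cdot>\<^bsub>C\<^esub> h = u \<and> q \<cdot>\<^bsub>C\<^esub> h = v))"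

definition is_coproduct :: "('o, 'm) bicc \<Rightarrow> 'o \<Rightarrow> 'o \<Rightarrow> 'o \<Rightarrow> 'm \<Rightarrow> 'm \<Rightarrow> bool" where
  "is_coproduct C X Y Z i j \<longleftrightarrow>
     i \<in> hom C X Z \<and> j \<in> hom C Y Z \<and>
     (\<forall>W. \<forall>u \<in> hom C X W. \<forall>v \<in> hom C Y W.
        \<exists>!h. h \<in> hom C Z W \<and> h \<cdot>\<^bsub>C\<^esub> i = u \<and> h \<cdot>\<^bsub>C\<^esub> j = v)"

text \<open>
  For a pullback, \<open>p\<close>, \<open>q\<close> are the projections to the sources \<open>X\<close>, \<open>Y\<close> of \<open>f\<close>, \<open>g\<close>.  Stability
  here does not require pullbacks of the coproduct injections to exist; the variant that
  does implies this one.
\<close>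

locale stable_omega_cpo_bicc = omega_cpo_bicc +
  assumes coproducts_stable:
    "\<lbrakk>is_pullback C P\<^sub>1 Z X (X \<oplus> Y) p\<^sub>1 q\<^sub>1 h (in1 C X Y);
      is_pullback C P\<^sub>2 Z Y (X \<oplus> Y) p\<^sub>2 q\<^sub>2 h (in2 C X Y)\<rbrakk>
     \<Longrightarrow> is_coproduct C P\<^sub>1 P\<^sub>2 Z p\<^sub>1 p\<^sub>2"

context
  fixes C :: "('o, 'm) bicc" (structure)
begin

definition inv_arr :: "'m \<Rightarrow> 'm" where
  "inv_arr f = (THE g. g \<in> hom C (tgt C f) (src C f) \<and>
     g \<cdot> f = idn C (src C f) \<and> f \<cdot> g = idn C (tgt C f))"

definition uncurry :: "'o \<Rightarrow> 'o \<Rightarrow> 'm \<Rightarrow> 'm" where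
  "uncurry Y Z f = ev C Y Z \<cdot> (f \<otimes>\<^sub>a idn C Y)"

text \<open>For \<open>h\<close> from \<open>V'\<close> to \<open>V\<close> and \<open>f\<close> from \<open>Z\<close> to \<open>Z'\<close>, an arrow from \<open>V \<leadsto> Z\<close> to \<open>V' \<leadsto> Z'\<close>.\<close>

definition expo_arr :: "'m \<Rightarrow> 'm \<Rightarrow> 'm" where
  "expo_arr h f =
     (let V' = src C h; V = tgt C h; Z = src C f
      in curry C (V \<leadsto> Z) V' (f \<cdot> ev C V Z \<cdot> (idn C (V \<leadsto> Z) \<otimes>\<^sub>a h)))"

definition swap :: "'o \<Rightarrow> 'o \<Rightarrow> 'm" where
  "swap X Y = \<langle>pr2 C X Y, pr1 C X Y\<rangle>"

definition assoc :: "'o \<Rightarrow> 'o \<Rightarrow> 'o \<Rightarrow> 'm" where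
  "assoc X Y Z =
     \<langle>pr1 C X Y \<cdot> pr1 C (X \<otimes> Y) Z, \<langle>pr2 C X Y \<cdot> pr1 C (X \<otimes> Y) Z, pr2 C (X \<otimes> Y) Z\<rangle>\<rangle>"

definition unassoc :: "'o \<Rightarrow> 'o \<Rightarrow> 'o \<Rightarrow> 'm" where
  "unassoc X Y Z =
     \<langle>\<langle>pr1 C X (Y \<otimes> Z), pr1 C Y Z \<cdot> pr2 C X (Y \<otimes> Z)\<rangle>, pr2 C Y Z \<cdot> pr2 C X (Y \<otimes> Z)\<rangle>"

definition dist :: "'o \<Rightarrow> 'o \<Rightarrow> 'o \<Rightarrow> 'm" where
  "dist X Y Z = inv_arr (cotup C (idn C X \<otimes>\<^sub>a in1 C Y Z) (idn C X \<otimes>\<^sub>a in2 C Y Z))"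

text \<open>The currying isomorphism from \<open>V \<leadsto> (Y \<leadsto> Z)\<close> to \<open>(V \<otimes> Y) \<leadsto> Z\<close>.\<close>

definition curry_iso :: "'o \<Rightarrow> 'o \<Rightarrow> 'o \<Rightarrow> 'm" where
  "curry_iso V Y Z =
     (let F = V \<leadsto> Y \<leadsto> Z
      in curry C F (V \<otimes> Y) (ev C Y Z \<cdot> (ev C V (Y \<leadsto> Z) \<otimes>\<^sub>a idn C Y) \<cdot> unassoc F V Y))"

end


section \<open>Strong monads\<close>

record ('o, 'm) smonad =
  fob :: "'o \<Rightarrow> 'o"
  far :: "'m \<Rightarrow> 'm"
  ret :: "'o \<Rightarrow> 'm"
  mul :: "'o \<Rightarrow> 'm"
  str :: "'o \<Rightarrow> 'o \<Rightarrow> 'm"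

locale strong_monad = bicartesian_closed C
  for C :: "('o, 'm) bicc" (structure) and T :: "('o, 'm) smonad" +
  assumes far_hom: "f \<in> hom C X Y \<Longrightarrow> far T f \<in> hom C (fob T X) (fob T Y)"
    and far_idn: "far T (idn C X) = idn C (fob T X)"
    and far_cmp: "\<lbrakk>f \<in> hom C X Y; g \<in> hom C Y Z\<rbrakk> \<Longrightarrow> far T (g \<cdot> f) = far T g \<cdot> far T f"
    and ret_hom: "ret T X \<in> hom C X (fob T X)"
    and ret_natural: "f \<in> hom C X Y \<Longrightarrow> ret T Y \<cdot> f = far T f \<cdot> ret T X"
    and mul_hom: "mul T X \<in> hom C (fob T (fob T X)) (fob T X)"
    and mul_natural: "f \<in> hom C X Y \<Longrightarrow> mul T Y \<cdot> far T (far T f) = far T f \<cdot> mul T X"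
    and mul_ret: "mul T X \<cdot> ret T (fob T X) = idn C (fob T X)"
    and mul_far_ret: "mul T X \<cdot> far T (ret T X) = idn C (fob T X)"
    and mul_mul: "mul T X \<cdot> mul T (fob T X) = mul T X \<cdot> far T (mul T X)"
    and str_hom: "str T X Y \<in> hom C (X \<otimes> fob T Y) (fob T (X \<otimes> Y))"
    and str_natural: "\<lbrakk>f \<in> hom C X X'; g \<in> hom C Y Y'\<rbrakk>
          \<Longrightarrow> str T X' Y' \<cdot> (f \<otimes>\<^sub>a far T g) = far T (f \<otimes>\<^sub>a g) \<cdot> str T X Y"
    and str_one: "far T (pr2 C \<one> X) \<cdot> str T \<one> X = pr2 C \<one> (fob T X)"
    and str_assoc: "far T (assoc C X Y Z) \<cdot> str T (X \<otimes> Y) Z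
          = str T X (Y \<otimes> Z) \<cdot> (idn C X \<otimes>\<^sub>a str T Y Z) \<cdot> assoc C X Y (fob T Z)"
    and str_ret: "str T X Y \<cdot> (idn C X \<otimes>\<^sub>a ret T Y) = ret T (X \<otimes> Y)"
    and str_mul: "str T X Y \<cdot> (idn C X \<otimes>\<^sub>a mul T Y)
          = mul T (X \<otimes> Y) \<cdot> far T (str T X Y) \<cdot> str T X (fob T Y)"

definition bottom :: "('o, 'm) bicc \<Rightarrow> ('o, 'm) smonad \<Rightarrow> 'm \<Rightarrow> 'o \<Rightarrow> 'm" where
  "bottom C T bot0 X = far T (cobang C X) \<cdot>\<^bsub>C\<^esub> bot0"

locale pseudo_lifting_monad = strong_monad +
  fixes bot0 :: 'm
  assumes bot0_hom: "bot0 \<in> hom C \<one> (fob T \<zero>)"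
    and bottom_least: "g \<in> hom C \<one> (fob T X) \<Longrightarrow> bottom C T bot0 X \<sqsubseteq> g"

locale strong_monad_morphism = T: strong_monad C T + U: strong_monad C U
  for C :: "('o, 'm) bicc" (structure) and T U :: "('o, 'm) smonad" +
  fixes \<alpha> :: "'o \<Rightarrow> 'm"
  assumes mor_hom: "\<alpha> X \<in> hom C (fob T X) (fob U X)"
    and mor_natural: "f \<in> hom C X Y \<Longrightarrow> \<alpha> Y \<cdot> far T f = far U f \<cdot> \<alpha> X"
    and mor_ret: "\<alpha> X \<cdot> ret T X = ret U X"
    and mor_mul: "\<alpha> X \<cdot> mul T X = mul U X \<cdot> far U (\<alpha> X) \<cdot> \<alpha> (fob T X)"
    and mor_str: "\<alpha> (X \<otimes> Y) \<cdot> str T X Y = str U X Y \<cdot> (idn C X \<otimes>\<^sub>a \<alpha> Y)"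

definition em_algebra :: "('o, 'm) bicc \<Rightarrow> ('o, 'm) smonad \<Rightarrow> 'o \<Rightarrow> 'm \<Rightarrow> bool" where
  "em_algebra C T \<Omega> \<tau> \<longleftrightarrow>
     \<tau> \<in> hom C (fob T \<Omega>) \<Omega> \<and> \<tau> \<cdot>\<^bsub>C\<^esub> ret T \<Omega> = idn C \<Omega> \<and>
     \<tau> \<cdot>\<^bsub>C\<^esub> mul T \<Omega> = \<tau> \<cdot>\<^bsub>C\<^esub> far T \<tau>"

definition inference_query ::
  "('o, 'm) bicc \<Rightarrow> ('o, 'm) smonad \<Rightarrow> ('o \<Rightarrow> 'm) \<Rightarrow> 'o \<Rightarrow> 'm \<Rightarrow> 'o \<Rightarrow> 'm \<Rightarrow> 'm \<Rightarrow> bool" where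
  "inference_query C U \<alpha> \<Omega>T \<tau>T \<Omega>U \<tau>U q \<longleftrightarrow>
     q \<in> hom C \<Omega>T \<Omega>U \<and> q \<cdot>\<^bsub>C\<^esub> \<tau>T = \<tau>U \<cdot>\<^bsub>C\<^esub> far U q \<cdot>\<^bsub>C\<^esub> \<alpha> \<Omega>T"

context
  fixes C :: "('o, 'm) bicc" (structure) and T :: "('o, 'm) smonad"
begin

definition costr :: "'o \<Rightarrow> 'o \<Rightarrow> 'm" where
  "costr X Y = far T (swap C Y X) \<cdot> str T Y X \<cdot> swap C (fob T X) Y"

definition al :: "'o \<Rightarrow> 'o \<Rightarrow> 'm" where
  "al X Z = curry C (fob T (X \<leadsto> fob T Z)) X
     (mul T Z \<cdot> far T (ev C X (fob T Z)) \<cdot> costr (X \<leadsto> fob T Z) X)"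

text \<open>The supremum is that of the chain of composites of the \<open>n\<close>-th iterate with the start arrow.\<close>

definition fixp :: "'m \<Rightarrow> 'o \<Rightarrow> 'o \<Rightarrow> 'm \<Rightarrow> 'm" where
  "fixp bot0 X Z f =
     pr2 C X (fob T Z) \<cdot>
     omega_lub (hom C X (X \<otimes> fob T Z)) (le C)
       (\<lambda>n. ((\<lambda>g. \<langle>pr1 C X (fob T Z), f\<rangle> \<cdot> g) ^^ n) \<langle>idn C X, bottom C T bot0 Z \<cdot> bang C X\<rangle>)"

text \<open>The associators implicit in the strength are made explicit.\<close>

definition state_monad :: "'o \<Rightarrow> ('o, 'm) smonad" where
  "state_monad Y =
     \<lparr>fob = (\<lambda>X. Y \<leadsto> fob T (X \<otimes> Y)),
      far = (\<lambda>f. expo_arr C (idn C Y) (far T (f \<otimes>\<^sub>a idn C Y))),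
      ret = (\<lambda>X. curry C X Y (ret T (X \<otimes> Y))),
      mul = (\<lambda>X. expo_arr C (idn C Y) (mul T (X \<otimes> Y) \<cdot> far T (ev C Y (fob T (X \<otimes> Y))))),
      str = (\<lambda>X Z. curry C (X \<otimes> (Y \<leadsto> fob T (Z \<otimes> Y))) Y
        (far T (unassoc C X Z Y) \<cdot> str T X (Z \<otimes> Y) \<cdot>
         (idn C X \<otimes>\<^sub>a ev C Y (fob T (Z \<otimes> Y))) \<cdot> assoc C X (Y \<leadsto> fob T (Z \<otimes> Y)) Y))\<rparr>"

definition state_algebra :: "'o \<Rightarrow> 'o \<Rightarrow> 'm \<Rightarrow> 'm" where
  "state_algebra Y \<Omega> \<tau> =
     expo_arr C (idn C Y) \<tau> \<cdot> expo_arr C (idn C Y) (far T (ev C Y \<Omega>))"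

end


section \<open>Syntax\<close>

datatype 'b ty =
    TBase 'b
  | TUnit
  | TProd "'b ty" "'b ty"
  | TZero
  | TSum "'b ty" "'b ty"
  | TFun "'b ty" "'b ty"

primrec ground :: "'b ty \<Rightarrow> bool" where
  "ground (TBase b) = True"
| "ground TUnit = True"
| "ground (TProd s t) = (ground s \<and> ground t)"
| "ground TZero = True"
| "ground (TSum s t) = (ground s \<and> ground t)"
| "ground (TFun s t) = False"

text \<open>Symbols are \<open>Inl c\<close> for a constant \<open>c\<close> and \<open>Inr e\<close> for an effect \<open>e\<close>.\<close>

record ('b, 'k, 'e) signature =
  bases :: "'b set"
  const_syms :: "'k set"
  eff_syms :: "'e set"
  ar :: "'k + 'e \<Rightarrow> 'b ty"
  car :: "'k + 'e \<Rightarrow> 'b ty"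

definition wf_signature :: "('b, 'k, 'e) signature \<Rightarrow> bool" where
  "wf_signature \<Sigma> \<longleftrightarrow> (\<forall>k \<in> const_syms \<Sigma> <+> eff_syms \<Sigma>.
     ground (ar \<Sigma> k) \<and> set_ty (ar \<Sigma> k) \<subseteq> bases \<Sigma> \<and>
     ground (car \<Sigma> k) \<and> set_ty (car \<Sigma> k) \<subseteq> bases \<Sigma>)"

text \<open>
  Terms up to renaming of bound variables, with de Bruijn indices: \<open>Lam\<close> and each branch of
  \<open>Case\<close> bind index 0; in \<open>Mu t\<^sub>1 t\<^sub>2 M\<close> the argument \<open>x\<close>, of type \<open>t\<^sub>1\<close>, is index 0 of \<open>M\<close> and the
  function \<open>f\<close>, of type \<open>TFun t\<^sub>1 t\<^sub>2\<close>, is index 1.  The type arguments of \<open>Abort\<close> (the result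
  type), \<open>Inj1\<close>, \<open>Inj2\<close> (the other summand) and \<open>Mu\<close> record the choices made in a typing
  derivation, so that a term together with its context determines its derivation, on which its
  interpretation and its translation depend.
\<close>

datatype ('b, 'k, 'e) trm =
    Var nat
  | Cst 'k "('b, 'k, 'e) trm"
  | Eff 'e "('b, 'k, 'e) trm"
  | Star
  | Tup "('b, 'k, 'e) trm" "('b, 'k, 'e) trm"
  | Prj1 "('b, 'k, 'e) trm"
  | Prj2 "('b, 'k, 'e) trm"
  | Abort "'b ty" "('b, 'k, 'e) trm"
  | Inj1 "'b ty" "('b, 'k, 'e) trm"
  | Inj2 "'b ty" "('b, 'k, 'e) trm"
  | Case "('b, 'k, 'e) trm" "'b ty" "('b, 'k, 'e) trm" "'b ty" "('b, 'k, 'e) trm"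
  | Lam "'b ty" "('b, 'k, 'e) trm"
  | App "('b, 'k, 'e) trm" "('b, 'k, 'e) trm"
  | Mu "'b ty" "'b ty" "('b, 'k, 'e) trm"

text \<open>The head of a context is its most recent variable, that is, the rightmost one on paper.\<close>

type_synonym 'b ctx = "'b ty list"

definition wf_ctx :: "('b, 'k, 'e) signature \<Rightarrow> 'b ctx \<Rightarrow> bool" where
  "wf_ctx \<Sigma> \<Gamma> \<longleftrightarrow> (\<forall>t \<in> set \<Gamma>. set_ty t \<subseteq> bases \<Sigma>)"

inductive typing :: "('b, 'k, 'e) signature \<Rightarrow> 'b ctx \<Rightarrow> ('b, 'k, 'e) trm \<Rightarrow> 'b ty \<Rightarrow> bool"
  for \<Sigma> where
  Var: "\<lbrakk>wf_ctx \<Sigma> \<Gamma>; i < length \<Gamma>\<rbrakk> \<Longrightarrow> typing \<Sigma> \<Gamma> (Var i) (\<Gamma> ! i)"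
| Cst: "\<lbrakk>c \<in> const_syms \<Sigma>; typing \<Sigma> \<Gamma> M (ar \<Sigma> (Inl c))\<rbrakk>
    \<Longrightarrow> typing \<Sigma> \<Gamma> (Cst c M) (car \<Sigma> (Inl c))"
| Eff: "\<lbrakk>e \<in> eff_syms \<Sigma>; typing \<Sigma> \<Gamma> M (ar \<Sigma> (Inr e))\<rbrakk>
    \<Longrightarrow> typing \<Sigma> \<Gamma> (Eff e M) (car \<Sigma> (Inr e))"
| Star: "wf_ctx \<Sigma> \<Gamma> \<Longrightarrow> typing \<Sigma> \<Gamma> Star TUnit"
| Tup: "\<lbrakk>typing \<Sigma> \<Gamma> M s; typing \<Sigma> \<Gamma> N t\<rbrakk> \<Longrightarrow> typing \<Sigma> \<Gamma> (Tup M N) (TProd s t)"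
| Prj1: "typing \<Sigma> \<Gamma> M (TProd s t) \<Longrightarrow> typing \<Sigma> \<Gamma> (Prj1 M) s"
| Prj2: "typing \<Sigma> \<Gamma> M (TProd s t) \<Longrightarrow> typing \<Sigma> \<Gamma> (Prj2 M) t"
| Abort: "\<lbrakk>typing \<Sigma> \<Gamma> M TZero; set_ty t \<subseteq> bases \<Sigma>\<rbrakk> \<Longrightarrow> typing \<Sigma> \<Gamma> (Abort t M) t"
| Inj1: "\<lbrakk>typing \<Sigma> \<Gamma> M s; set_ty t \<subseteq> bases \<Sigma>\<rbrakk> \<Longrightarrow> typing \<Sigma> \<Gamma> (Inj1 t M) (TSum s t)"
| Inj2: "\<lbrakk>typing \<Sigma> \<Gamma> M t; set_ty s \<subseteq> bases \<Sigma>\<rbrakk> \<Longrightarrow> typing \<Sigma> \<Gamma> (Inj2 s M) (TSum s t)"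
| Case: "\<lbrakk>typing \<Sigma> \<Gamma> M (TSum t\<^sub>1 t\<^sub>2); typing \<Sigma> (t\<^sub>1 # \<Gamma>) N\<^sub>1 t; typing \<Sigma> (t\<^sub>2 # \<Gamma>) N\<^sub>2 t\<rbrakk>
    \<Longrightarrow> typing \<Sigma> \<Gamma> (Case M t\<^sub>1 N\<^sub>1 t\<^sub>2 N\<^sub>2) t"
| Lam: "typing \<Sigma> (s # \<Gamma>) M t \<Longrightarrow> typing \<Sigma> \<Gamma> (Lam s M) (TFun s t)"
| App: "\<lbrakk>typing \<Sigma> \<Gamma> M (TFun s t); typing \<Sigma> \<Gamma> N s\<rbrakk> \<Longrightarrow> typing \<Sigma> \<Gamma> (App M N) t"
| Mu: "typing \<Sigma> (s # TFun s t # \<Gamma>) M t \<Longrightarrow> typing \<Sigma> \<Gamma> (Mu s t M) (TFun s t)"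

text \<open>The type of a well-typed term is unique; for other terms the value is irrelevant.\<close>

definition tyof :: "('b, 'k, 'e) signature \<Rightarrow> 'b ctx \<Rightarrow> ('b, 'k, 'e) trm \<Rightarrow> 'b ty" where
  "tyof \<Sigma> \<Gamma> M = (THE t. typing \<Sigma> \<Gamma> M t)"

definition lift_ren :: "(nat \<Rightarrow> nat) \<Rightarrow> nat \<Rightarrow> nat" where
  "lift_ren r = case_nat 0 (\<lambda>n. Suc (r n))"

primrec ren :: "(nat \<Rightarrow> nat) \<Rightarrow> ('b, 'k, 'e) trm \<Rightarrow> ('b, 'k, 'e) trm" where
  "ren r (Var i) = Var (r i)"
| "ren r (Cst c M) = Cst c (ren r M)"
| "ren r (Eff e M) = Eff e (ren r M)"
| "ren r Star = Star"
| "ren r (Tup M N) = Tup (ren r M) (ren r N)"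
| "ren r (Prj1 M) = Prj1 (ren r M)"
| "ren r (Prj2 M) = Prj2 (ren r M)"
| "ren r (Abort t M) = Abort t (ren r M)"
| "ren r (Inj1 t M) = Inj1 t (ren r M)"
| "ren r (Inj2 t M) = Inj2 t (ren r M)"
| "ren r (Case M t\<^sub>1 N\<^sub>1 t\<^sub>2 N\<^sub>2) = Case (ren r M) t\<^sub>1 (ren (lift_ren r) N\<^sub>1) t\<^sub>2 (ren (lift_ren r) N\<^sub>2)"
| "ren r (Lam t M) = Lam t (ren (lift_ren r) M)"
| "ren r (App M N) = App (ren r M) (ren r N)"
| "ren r (Mu s t M) = Mu s t (ren (lift_ren (lift_ren r)) M)"

definition lift_sub :: "(nat \<Rightarrow> ('b, 'k, 'e) trm) \<Rightarrow> nat \<Rightarrow> ('b, 'k, 'e) trm" where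
  "lift_sub \<sigma> = case_nat (Var 0) (\<lambda>n. ren Suc (\<sigma> n))"

text \<open>Simultaneous capture-avoiding substitution.\<close>

primrec sub :: "(nat \<Rightarrow> ('b, 'k, 'e) trm) \<Rightarrow> ('b, 'k, 'e) trm \<Rightarrow> ('b, 'k, 'e) trm" where
  "sub \<sigma> (Var i) = \<sigma> i"
| "sub \<sigma> (Cst c M) = Cst c (sub \<sigma> M)"
| "sub \<sigma> (Eff e M) = Eff e (sub \<sigma> M)"
| "sub \<sigma> Star = Star"
| "sub \<sigma> (Tup M N) = Tup (sub \<sigma> M) (sub \<sigma> N)"
| "sub \<sigma> (Prj1 M) = Prj1 (sub \<sigma> M)"
| "sub \<sigma> (Prj2 M) = Prj2 (sub \<sigma> M)"
| "sub \<sigma> (Abort t M) = Abort t (sub \<sigma> M)"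
| "sub \<sigma> (Inj1 t M) = Inj1 t (sub \<sigma> M)"
| "sub \<sigma> (Inj2 t M) = Inj2 t (sub \<sigma> M)"
| "sub \<sigma> (Case M t\<^sub>1 N\<^sub>1 t\<^sub>2 N\<^sub>2) = Case (sub \<sigma> M) t\<^sub>1 (sub (lift_sub \<sigma>) N\<^sub>1) t\<^sub>2 (sub (lift_sub \<sigma>) N\<^sub>2)"
| "sub \<sigma> (Lam t M) = Lam t (sub (lift_sub \<sigma>) M)"
| "sub \<sigma> (App M N) = App (sub \<sigma> M) (sub \<sigma> N)"
| "sub \<sigma> (Mu s t M) = Mu s t (sub (lift_sub (lift_sub \<sigma>)) M)"


section \<open>Call-by-value semantics\<close>

primrec ctx_ty :: "'b ctx \<Rightarrow> 'b ty" where
  "ctx_ty [] = TUnit"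
| "ctx_ty (t # \<Gamma>) = TProd (ctx_ty \<Gamma>) t"

primrec sem_ty :: "('o, 'm) bicc \<Rightarrow> ('o, 'm) smonad \<Rightarrow> ('b \<Rightarrow> 'o) \<Rightarrow> 'b ty \<Rightarrow> 'o" where
  "sem_ty C T A (TBase b) = A b"
| "sem_ty C T A TUnit = \<one>\<^bsub>C\<^esub>"
| "sem_ty C T A (TProd s t) = sem_ty C T A s \<otimes>\<^bsub>C\<^esub> sem_ty C T A t"
| "sem_ty C T A TZero = \<zero>\<^bsub>C\<^esub>"
| "sem_ty C T A (TSum s t) = sem_ty C T A s \<oplus>\<^bsub>C\<^esub> sem_ty C T A t"
| "sem_ty C T A (TFun s t) = (sem_ty C T A s \<leadsto>\<^bsub>C\<^esub> fob T (sem_ty C T A t))"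

definition sem_ctx :: "('o, 'm) bicc \<Rightarrow> ('o, 'm) smonad \<Rightarrow> ('b \<Rightarrow> 'o) \<Rightarrow> 'b ctx \<Rightarrow> 'o" where
  "sem_ctx C T A \<Gamma> = sem_ty C T A (ctx_ty \<Gamma>)"

text \<open>
  A structure has the components \<open>C\<close>, \<open>T\<close>, \<open>bot0\<close>, \<open>A\<close>, \<open>a\<close>, where \<open>bot0\<close> is the arrow that is
  part of the pseudo-lifting structure of \<open>T\<close>.
\<close>

definition lcfix_structure ::
  "('b, 'k, 'e) signature \<Rightarrow> ('o, 'm) bicc \<Rightarrow> ('o, 'm) smonad \<Rightarrow> 'm \<Rightarrow> ('b \<Rightarrow> 'o)
    \<Rightarrow> ('k + 'e \<Rightarrow> 'm) \<Rightarrow> bool" where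
  "lcfix_structure \<Sigma> C T bot0 A a \<longleftrightarrow>
     omega_cpo_bicc C \<and> pseudo_lifting_monad C T bot0 \<and>
     (\<forall>c \<in> const_syms \<Sigma>.
        a (Inl c) \<in> hom C (sem_ty C T A (ar \<Sigma> (Inl c))) (sem_ty C T A (car \<Sigma> (Inl c)))) \<and>
     (\<forall>e \<in> eff_syms \<Sigma>.
        a (Inr e) \<in> hom C (sem_ty C T A (ar \<Sigma> (Inr e))) (fob T (sem_ty C T A (car \<Sigma> (Inr e)))))"

context
  fixes \<Sigma> :: "('b, 'k, 'e) signature"
    and C :: "('o, 'm) bicc" (structure)
    and T :: "('o, 'm) smonad"
    and bot0 :: 'm
    and A :: "'b \<Rightarrow> 'o"
    and a :: "'k + 'e \<Rightarrow> 'm"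
begin

fun var_proj :: "'b ctx \<Rightarrow> nat \<Rightarrow> 'm" where
  "var_proj [] i = undefined"
| "var_proj (t # \<Gamma>) 0 = pr2 C (sem_ctx C T A \<Gamma>) (sem_ty C T A t)"
| "var_proj (t # \<Gamma>) (Suc i) = var_proj \<Gamma> i \<cdot> pr1 C (sem_ctx C T A \<Gamma>) (sem_ty C T A t)"

fun sem :: "'b ctx \<Rightarrow> ('b, 'k, 'e) trm \<Rightarrow> 'm" where
  "sem \<Gamma> (Var i) = ret T (sem_ty C T A (\<Gamma> ! i)) \<cdot> var_proj \<Gamma> i"
| "sem \<Gamma> (Cst c M) = far T (a (Inl c)) \<cdot> sem \<Gamma> M"
| "sem \<Gamma> (Eff e M) = mul T (sem_ty C T A (car \<Sigma> (Inr e))) \<cdot> far T (a (Inr e)) \<cdot> sem \<Gamma> M"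
| "sem \<Gamma> Star = ret T \<one> \<cdot> bang C (sem_ctx C T A \<Gamma>)"
| "sem \<Gamma> (Tup M N) =
     (let X = sem_ty C T A (tyof \<Sigma> \<Gamma> M); Z = sem_ty C T A (tyof \<Sigma> \<Gamma> N)
      in mul T (X \<otimes> Z) \<cdot> far T (str T X Z) \<cdot> costr C T X (fob T Z) \<cdot> \<langle>sem \<Gamma> M, sem \<Gamma> N\<rangle>)"
| "sem \<Gamma> (Prj1 M) =
     (case tyof \<Sigma> \<Gamma> M of TProd s t \<Rightarrow>
        far T (pr1 C (sem_ty C T A s) (sem_ty C T A t)) \<cdot> sem \<Gamma> M)"
| "sem \<Gamma> (Prj2 M) =
     (case tyof \<Sigma> \<Gamma> M of TProd s t \<Rightarrow>
        far T (pr2 C (sem_ty C T A s) (sem_ty C T A t)) \<cdot> sem \<Gamma> M)"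
| "sem \<Gamma> (Abort t M) = far T (cobang C (sem_ty C T A t)) \<cdot> sem \<Gamma> M"
| "sem \<Gamma> (Inj1 t M) =
     far T (in1 C (sem_ty C T A (tyof \<Sigma> \<Gamma> M)) (sem_ty C T A t)) \<cdot> sem \<Gamma> M"
| "sem \<Gamma> (Inj2 t M) =
     far T (in2 C (sem_ty C T A t) (sem_ty C T A (tyof \<Sigma> \<Gamma> M))) \<cdot> sem \<Gamma> M"
| "sem \<Gamma> (Case M t\<^sub>1 N\<^sub>1 t\<^sub>2 N\<^sub>2) =
     (let G = sem_ctx C T A \<Gamma>; X\<^sub>1 = sem_ty C T A t\<^sub>1; X\<^sub>2 = sem_ty C T A t\<^sub>2;
          Z = sem_ty C T A (tyof \<Sigma> (t\<^sub>1 # \<Gamma>) N\<^sub>1)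
      in mul T Z \<cdot>
         far T (cotup C (sem (t\<^sub>1 # \<Gamma>) N\<^sub>1) (sem (t\<^sub>2 # \<Gamma>) N\<^sub>2) \<cdot> dist C G X\<^sub>1 X\<^sub>2) \<cdot>
         str T G (X\<^sub>1 \<oplus> X\<^sub>2) \<cdot> \<langle>idn C G, sem \<Gamma> M\<rangle>)"
| "sem \<Gamma> (Lam t M) =
     ret T (sem_ty C T A (TFun t (tyof \<Sigma> (t # \<Gamma>) M))) \<cdot>
     curry C (sem_ctx C T A \<Gamma>) (sem_ty C T A t) (sem (t # \<Gamma>) M)"
| "sem \<Gamma> (App M N) =
     (case tyof \<Sigma> \<Gamma> M of TFun s t \<Rightarrow>
       (let X = sem_ty C T A s; Z = sem_ty C T A t; F = (X \<leadsto> fob T Z)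
        in mul T Z \<cdot> far T (mul T Z) \<cdot> far T (far T (ev C X (fob T Z))) \<cdot>
           far T (str T F X) \<cdot> costr C T F (fob T X) \<cdot> \<langle>sem \<Gamma> M, sem \<Gamma> N\<rangle>))"
| "sem \<Gamma> (Mu s t M) =
     (let G = sem_ctx C T A \<Gamma>; X = sem_ty C T A s; Z = sem_ty C T A t; F = (X \<leadsto> fob T Z);
          lam = ret T F \<cdot> curry C (G \<otimes> F) X (sem (s # TFun s t # \<Gamma>) M)
      in ret T F \<cdot> al C T X Z \<cdot> fixp C T bot0 G F (lam \<cdot> (idn C G \<otimes>\<^sub>a al C T X Z)))"

definition wp :: "'m \<Rightarrow> 'b ctx \<Rightarrow> ('b, 'k, 'e) trm \<Rightarrow> 'm \<Rightarrow> 'm" where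
  "wp \<tau> \<Gamma> M Q = \<tau> \<cdot> far T Q \<cdot> sem \<Gamma> M"

end

definition mor_op ::
  "('b, 'k, 'e) signature \<Rightarrow> ('o, 'm) bicc \<Rightarrow> ('o, 'm) smonad \<Rightarrow> ('o \<Rightarrow> 'm) \<Rightarrow> ('b \<Rightarrow> 'o)
    \<Rightarrow> ('k + 'e \<Rightarrow> 'm) \<Rightarrow> 'k + 'e \<Rightarrow> 'm" where
  "mor_op \<Sigma> C T \<alpha> A a =
     case_sum (\<lambda>c. a (Inl c)) (\<lambda>e. \<alpha> (sem_ty C T A (car \<Sigma> (Inr e))) \<cdot>\<^bsub>C\<^esub> a (Inr e))"


section \<open>State-passing style\<close>

text \<open>
  The extended set of base types is \<open>'b option\<close>, with \<open>None\<close> the added base type and \<open>Some b\<close>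
  the old ones.
\<close>

abbreviation bY :: "'b option ty" where
  "bY \<equiv> TBase None"

primrec circ :: "'b ty \<Rightarrow> 'b option ty" where
  "circ (TBase b) = TBase (Some b)"
| "circ TUnit = TUnit"
| "circ (TProd s t) = TProd (circ s) (circ t)"
| "circ TZero = TZero"
| "circ (TSum s t) = TSum (circ s) (circ t)"
| "circ (TFun s t) = TFun (TProd (circ s) bY) (TProd (circ t) bY)"

definition sps_ty :: "'b ty \<Rightarrow> 'b option ty" where
  "sps_ty t = TProd (circ t) bY"

definition sps_ctx :: "'b ctx \<Rightarrow> 'b option ctx" where
  "sps_ctx \<Gamma> = bY # map circ \<Gamma>"

definition sps_sig :: "('b, 'k, 'e) signature \<Rightarrow> ('b option, 'k, 'e) signature" where
  "sps_sig \<Sigma> =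
     \<lparr>bases = insert None (Some ` bases \<Sigma>), const_syms = const_syms \<Sigma>, eff_syms = eff_syms \<Sigma>,
      ar = (\<lambda>k. TProd (map_ty Some (ar \<Sigma> k)) bY),
      car = (\<lambda>k. TProd (map_ty Some (car \<Sigma> k)) bY)\<rparr>"

text \<open>
  In \<open>SPS(M)\<close> the variable \<open>y\<close> is index 0.  \<open>sps_ren\<close> turns \<open>SPS(N)\<close> into the body of
  \<open>\<lambda>y. SPS(N)\<close> under the additional binder \<open>z\<close>: the context changes from \<open>\<Gamma>, y\<close> to
  \<open>\<Gamma>, y, z, y\<close>, the inner \<open>y\<close> shadowing the outer one.  \<open>sps_sub\<close> is the substitution of
  \<open>\<pi>\<^sub>1 z\<close> for \<open>x\<close> and \<open>\<pi>\<^sub>2 z\<close> for \<open>y\<close> from \<open>\<Gamma>, x, y\<close> to \<open>\<Gamma>, y, z\<close>, and \<open>sps_sub_mu\<close> the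
  same from \<open>\<Gamma>, f, x, y\<close> to \<open>\<Gamma>, y, f, z\<close>.
\<close>

definition sps_ren :: "nat \<Rightarrow> nat" where
  "sps_ren = case_nat 0 (\<lambda>n. n + 3)"

definition sps_sub :: "nat \<Rightarrow> ('b, 'k, 'e) trm" where
  "sps_sub i = (if i = 0 then Prj2 (Var 0) else if i = 1 then Prj1 (Var 0) else Var i)"

definition sps_sub_mu :: "nat \<Rightarrow> ('b, 'k, 'e) trm" where
  "sps_sub_mu i =
     (if i = 0 then Prj2 (Var 0) else if i = 1 then Prj1 (Var 0) else if i = 2 then Var 1 else Var i)"

fun sps :: "('b, 'k, 'e) signature \<Rightarrow> 'b ctx \<Rightarrow> ('b, 'k, 'e) trm \<Rightarrow> ('b option, 'k, 'e) trm" where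
  "sps \<Sigma> \<Gamma> (Var i) = Tup (Var (Suc i)) (Var 0)"
| "sps \<Sigma> \<Gamma> (Cst c M) = Cst c (sps \<Sigma> \<Gamma> M)"
| "sps \<Sigma> \<Gamma> (Eff e M) = Eff e (sps \<Sigma> \<Gamma> M)"
| "sps \<Sigma> \<Gamma> Star = Tup Star (Var 0)"
| "sps \<Sigma> \<Gamma> (Tup M N) =
     (let s = tyof \<Sigma> \<Gamma> M; t = tyof \<Sigma> \<Gamma> N; z = Var 0
      in App (Lam (TProd (circ s) (sps_ty t))
                (Tup (Tup (Prj1 z) (Prj1 (Prj2 z))) (Prj2 (Prj2 z))))
             (App (Lam (sps_ty s)
                     (Tup (Prj1 z) (App (Lam bY (ren sps_ren (sps \<Sigma> \<Gamma> N))) (Prj2 z))))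
                  (sps \<Sigma> \<Gamma> M)))"
| "sps \<Sigma> \<Gamma> (Prj1 M) =
     (let z = Var 0
      in App (Lam (sps_ty (tyof \<Sigma> \<Gamma> M)) (Tup (Prj1 (Prj1 z)) (Prj2 z))) (sps \<Sigma> \<Gamma> M))"
| "sps \<Sigma> \<Gamma> (Prj2 M) =
     (let z = Var 0
      in App (Lam (sps_ty (tyof \<Sigma> \<Gamma> M)) (Tup (Prj2 (Prj1 z)) (Prj2 z))) (sps \<Sigma> \<Gamma> M))"
| "sps \<Sigma> \<Gamma> (Abort t M) =
     (let z = Var 0
      in App (Lam (sps_ty (tyof \<Sigma> \<Gamma> M)) (Tup (Abort (circ t) (Prj1 z)) (Prj2 z))) (sps \<Sigma> \<Gamma> M))"
| "sps \<Sigma> \<Gamma> (Inj1 t M) =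
     (let z = Var 0
      in App (Lam (sps_ty (tyof \<Sigma> \<Gamma> M)) (Tup (Inj1 (circ t) (Prj1 z)) (Prj2 z))) (sps \<Sigma> \<Gamma> M))"
| "sps \<Sigma> \<Gamma> (Inj2 t M) =
     (let z = Var 0
      in App (Lam (sps_ty (tyof \<Sigma> \<Gamma> M)) (Tup (Inj2 (circ t) (Prj1 z)) (Prj2 z))) (sps \<Sigma> \<Gamma> M))"
| "sps \<Sigma> \<Gamma> (Case M t\<^sub>1 N\<^sub>1 t\<^sub>2 N\<^sub>2) =
     (let N = App (Lam (sps_ty (TSum t\<^sub>1 t\<^sub>2))
                    (Case (Prj1 (Var 0))
                      (circ t\<^sub>1) (Inj1 (sps_ty t\<^sub>2) (Tup (Var 0) (Prj2 (Var 1))))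
                      (circ t\<^sub>2) (Inj2 (sps_ty t\<^sub>1) (Tup (Var 0) (Prj2 (Var 1))))))
                  (sps \<Sigma> \<Gamma> M)
      in Case N (sps_ty t\<^sub>1) (sub sps_sub (sps \<Sigma> (t\<^sub>1 # \<Gamma>) N\<^sub>1))
                (sps_ty t\<^sub>2) (sub sps_sub (sps \<Sigma> (t\<^sub>2 # \<Gamma>) N\<^sub>2)))"
| "sps \<Sigma> \<Gamma> (Lam t M) = Tup (Lam (sps_ty t) (sub sps_sub (sps \<Sigma> (t # \<Gamma>) M))) (Var 0)"
| "sps \<Sigma> \<Gamma> (App M N) =
     (let z = Var 0
      in App (Lam (sps_ty (tyof \<Sigma> \<Gamma> M))
                (App (Prj1 z) (App (Lam bY (ren sps_ren (sps \<Sigma> \<Gamma> N))) (Prj2 z))))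
             (sps \<Sigma> \<Gamma> M))"
| "sps \<Sigma> \<Gamma> (Mu s t M) =
     Tup (Mu (sps_ty s) (sps_ty t) (sub sps_sub_mu (sps \<Sigma> (s # TFun s t # \<Gamma>) M))) (Var 0)"

definition sps_base :: "'o \<Rightarrow> ('b \<Rightarrow> 'o) \<Rightarrow> 'b option \<Rightarrow> 'o" where
  "sps_base Y A = case_option Y A"

definition sps_op ::
  "('b, 'k, 'e) signature \<Rightarrow> ('o, 'm) bicc \<Rightarrow> ('o, 'm) smonad \<Rightarrow> 'o \<Rightarrow> ('b \<Rightarrow> 'o)
    \<Rightarrow> ('k + 'e \<Rightarrow> 'm) \<Rightarrow> 'k + 'e \<Rightarrow> 'm" where
  "sps_op \<Sigma> C T Y A a =
     case_sum
       (\<lambda>c. a (Inl c) \<otimes>\<^sub>a\<^bsub>C\<^esub> idn C Y)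
       (\<lambda>e. uncurry C Y
              (fob T (sem_ty C (state_monad C T Y) A (car \<Sigma> (Inr e)) \<otimes>\<^bsub>C\<^esub> Y)) (a (Inr e)))"

text \<open>
  The isomorphism from the interpretation of \<open>t\<close> under the state monad to that of \<open>circ t\<close>
  under \<open>T\<close>.
\<close>

primrec rho :: "('o, 'm) bicc \<Rightarrow> ('o, 'm) smonad \<Rightarrow> 'o \<Rightarrow> ('b \<Rightarrow> 'o) \<Rightarrow> 'b ty \<Rightarrow> 'm" where
  "rho C T Y A (TBase b) = idn C (A b)"
| "rho C T Y A TUnit = idn C \<one>\<^bsub>C\<^esub>"
| "rho C T Y A (TProd s t) = rho C T Y A s \<otimes>\<^sub>a\<^bsub>C\<^esub> rho C T Y A t"
| "rho C T Y A TZero = idn C \<zero>\<^bsub>C\<^esub>"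
| "rho C T Y A (TSum s t) = rho C T Y A s \<oplus>\<^sub>a\<^bsub>C\<^esub> rho C T Y A t"
| "rho C T Y A (TFun s t) =
     curry_iso C (sem_ty C T (sps_base Y A) (circ s)) Y
       (fob T (sem_ty C T (sps_base Y A) (circ t) \<otimes>\<^bsub>C\<^esub> Y)) \<cdot>\<^bsub>C\<^esub>
     expo_arr C (inv_arr C (rho C T Y A s)) (far (state_monad C T Y) (rho C T Y A t))"

definition rho_ctx :: "('o, 'm) bicc \<Rightarrow> ('o, 'm) smonad \<Rightarrow> 'o \<Rightarrow> ('b \<Rightarrow> 'o) \<Rightarrow> 'b ctx \<Rightarrow> 'm" where
  "rho_ctx C T Y A \<Gamma> = rho C T Y A (ctx_ty \<Gamma>)"

end

theory Submission
  imports Defs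
begin

text \<open>
  For (a), the interpretations in \<open>T\<close> and \<open>U\<close> are compared by a Kripke logical relation between
  generalized elements \<open>W \<rightarrow> \<lbrakk>t\<rbrakk>\<close>. It is equality at ground types, and a pair of computations is
  related if, after applying \<open>\<alpha>\<close> to the first one, both agree under every pair of related
  continuations into \<open>U \<Omega>\<close>. The continuation \<open>ret\<close> then shows that \<open>\<alpha>\<close> maps one interpretation of a
  term of ground type to the other. Lifted relations contain the bottoms and are closed under suprema
  of chains, hence under the approximations of a recursive function.

  For (b), \<open>\<rho>\<close> is an isomorphism at every type, so that
  \<open>\<lbrakk>SPS(M)\<rbrakk> \<langle>\<rho> \<gamma>, y\<rangle> = T(\<rho> \<times> Y) (ev \<langle>\<lbrakk>M\<rbrakk> \<gamma>, y\<rangle>)\<close> can be proved by induction on the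
  typing of \<open>M\<close>: a Kleisli extension in \<open>S\<close>, evaluated at a state, is one in \<open>T\<close>. For recursion, the
  approximations on the two sides correspond, because the bottom of \<open>S\<close> is the transpose of that of \<open>T\<close>.
\<close>

section \<open>Bicartesian closed categories\<close>

text \<open>The monads are given on the underlying category, so \<open>far T\<close> is not known to
  be monotone or continuous; suprema pass only through composition, tupling, cotupling and currying.
  Hence the Kleisli extension \<open>bnd\<close> is shown continuous in the computation, which
  enters as a tuple component before a fixed arrow, and not in the continuation. Relating
  computations by tests needs only this much.

  In (a) there is in general no arrow between the two interpretations of a higher type:
  \<open>\<alpha>\<close> goes from \<open>T\<close> to \<open>U\<close> only, and exponentials are
  contravariant in the argument. This forces a relation instead of a map.

  The formulas of the semantics are rewritten into nested \<open>bnd\<close>s, whose unit,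
  associativity and naturality laws are rewrite rules; most equations between interpretations are
  then settled by simplification. Recursion is defined by iteration in
  \<open>fob T (X \<leadsto> fob T Z)\<close>, whereas relations and isomorphisms are at hand for
  function values; \<open>mu_fix\<close> therefore moves the iteration to
  \<open>X \<leadsto> fob T Z\<close>.\<close>

lemma hom_iff: "f \<in> hom C X Y \<longleftrightarrow> f \<in> arrs C \<and> src C f = X \<and> tgt C f = Y"
  by (auto simp: hom_def)

text \<open>The product of \<open>h\<close> with the identity of \<open>X\<close>, in the tuple form
  to which \<open>times_arr_simps\<close> reduces all product arrows. As an abbreviation it stays
  visible to the rewrite rules for tuples.\<close>

abbreviation under :: "('o, 'm) bicc \<Rightarrow> 'm \<Rightarrow> 'o \<Rightarrow> 'o \<Rightarrow> 'm" where
  "under C h W X \<equiv> \<langle>h \<cdot>\<^bsub>C\<^esub> pr1 C W X, pr2 C W X\<rangle>\<^bsub>C\<^esub>"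

context category
begin

lemma idn_simps [simp]:
  "idn C X \<in> arrs C" "src C (idn C X) = X" "tgt C (idn C X) = X"
  using idn_hom[of X] by (auto simp: hom_iff)

lemma cmp_simps [simp]:
  assumes "f \<in> arrs C" "g \<in> arrs C" "src C g = tgt C f"
  shows "g \<cdot> f \<in> arrs C" "src C (g \<cdot> f) = src C f" "tgt C (g \<cdot> f) = tgt C g"
  using cmp_hom[of f "src C f" "tgt C f" g "tgt C g"] assms by (auto simp: hom_iff)

lemma idn_cmp [simp]: "f \<in> arrs C \<Longrightarrow> tgt C f = Y \<Longrightarrow> idn C Y \<cdot> f = f"
  using cmp_idn_left by (auto simp: hom_iff)

lemma cmp_idn [simp]: "f \<in> arrs C \<Longrightarrow> src C f = X \<Longrightarrow> f \<cdot> idn C X = f"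
  using cmp_idn_right by (auto simp: hom_iff)

lemma cmp_cmp [simp]:
  assumes "f \<in> arrs C" "g \<in> arrs C" "h \<in> arrs C" "src C h = tgt C g" "src C g = tgt C f"
  shows "(h \<cdot> g) \<cdot> f = h \<cdot> (g \<cdot> f)"
  using cmp_assoc[of f "src C f" "tgt C f" g "tgt C g" h "tgt C h"] assms by (auto simp: hom_iff)

lemma inv_arr_eqI:
  assumes "f \<in> hom C X Y" "g \<in> hom C Y X" "g \<cdot> f = idn C X" "f \<cdot> g = idn C Y"
  shows "inv_arr C f = g"
  unfolding inv_arr_def
proof (rule the_equality)
  show "g \<in> hom C (tgt C f) (src C f) \<and> g \<cdot> f = idn C (src C f) \<and> f \<cdot> g = idn C (tgt C f)"
    using assms by (auto simp: hom_iff)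
next
  fix g'
  assume g': "g' \<in> hom C (tgt C f) (src C f) \<and> g' \<cdot> f = idn C (src C f) \<and> f \<cdot> g' = idn C (tgt C f)"
  have "g' = (g \<cdot> f) \<cdot> g'"
    using g' assms by (auto simp: hom_iff)
  also have "\<dots> = g \<cdot> (f \<cdot> g')"
    using g' assms(1,2) by (intro cmp_cmp) (auto simp: hom_iff)
  also have "\<dots> = g"
    using g' assms by (auto simp: hom_iff)
  finally show "g' = g" .
qed

lemma inv_arr_iso:
  assumes "f \<in> hom C X Y" "g \<in> hom C Y X" "g \<cdot> f = idn C X" "f \<cdot> g = idn C Y"
  shows "f \<in> hom C X Y \<and> inv_arr C f \<in> hom C Y X \<and> inv_arr C f \<cdot> f = idn C X \<and> f \<cdot> inv_arr C f = idn C Y"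
  using inv_arr_eqI[OF assms] assms by simp

lemma inv_arr_idn [simp]: "inv_arr C (idn C X) = idn C X"
  by (rule inv_arr_eqI) (auto simp: idn_hom)

end

context bicartesian_closed
begin

lemma bang_simps [simp]: "bang C X \<in> arrs C" "src C (bang C X) = X" "tgt C (bang C X) = \<one>"
  using bang_hom[of X] by (auto simp: hom_iff)

lemma bang_cmp [simp]:
  assumes "h \<in> arrs C" "tgt C h = X"
  shows "bang C X \<cdot> h = bang C (src C h)"
  by (rule bang_unique) (use assms in \<open>auto simp: hom_iff\<close>)

lemma pr_simps [simp]:
  "pr1 C X Y \<in> arrs C" "src C (pr1 C X Y) = X \<otimes> Y" "tgt C (pr1 C X Y) = X"
  "pr2 C X Y \<in> arrs C" "src C (pr2 C X Y) = X \<otimes> Y" "tgt C (pr2 C X Y) = Y"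
  using pr1_hom[of X Y] pr2_hom[of X Y] by (auto simp: hom_iff)

lemma tup_simps [simp]:
  assumes "f \<in> arrs C" "g \<in> arrs C" "src C f = src C g"
  shows "\<langle>f, g\<rangle> \<in> arrs C" "src C \<langle>f, g\<rangle> = src C g" "tgt C \<langle>f, g\<rangle> = tgt C f \<otimes> tgt C g"
  using tup_hom[of f "src C f" "tgt C f" g "tgt C g"] assms by (auto simp: hom_iff)

lemma pr_tup [simp]:
  assumes "f \<in> arrs C" "g \<in> arrs C" "src C f = src C g" "tgt C f = X" "tgt C g = Y"
  shows "pr1 C X Y \<cdot> \<langle>f, g\<rangle> = f" "pr2 C X Y \<cdot> \<langle>f, g\<rangle> = g"
  using pr1_tup[of f "src C f" X g Y] pr2_tup[of f "src C f" X g Y] assms by (auto simp: hom_iff)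

lemma tup_eta [simp]:
  assumes "h \<in> arrs C" "tgt C h = X \<otimes> Y"
  shows "\<langle>pr1 C X Y \<cdot> h, pr2 C X Y \<cdot> h\<rangle> = h"
  using tup_unique[of h "src C h" X Y] assms by (auto simp: hom_iff)

lemma tup_pr [simp]: "\<langle>pr1 C X Y, pr2 C X Y\<rangle> = idn C (X \<otimes> Y)"
  using tup_eta[of "idn C (X \<otimes> Y)" X Y] by simp

lemma prod_eqI:
  assumes "f \<in> arrs C" "g \<in> arrs C" "tgt C f = X \<otimes> Y" "tgt C g = X \<otimes> Y"
    "pr1 C X Y \<cdot> f = pr1 C X Y \<cdot> g" "pr2 C X Y \<cdot> f = pr2 C X Y \<cdot> g"
  shows "f = g"
  using tup_eta[of f X Y] tup_eta[of g X Y] assms by metis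

lemma tup_cmp [simp]:
  assumes "f \<in> arrs C" "g \<in> arrs C" "h \<in> arrs C" "src C f = tgt C h" "src C g = tgt C h"
  shows "\<langle>f, g\<rangle> \<cdot> h = \<langle>f \<cdot> h, g \<cdot> h\<rangle>"
  by (rule prod_eqI[of _ _ "tgt C f" "tgt C g"])
    (use assms in \<open>simp_all flip: cmp_cmp\<close>)

lemma times_arr_simps [simp]:
  assumes "f \<in> arrs C" "g \<in> arrs C"
  shows "f \<otimes>\<^sub>a g = \<langle>f \<cdot> pr1 C (src C f) (src C g), g \<cdot> pr2 C (src C f) (src C g)\<rangle>"
  by (simp add: times_arr_def)

lemma ev_simps [simp]:
  "ev C Y Z \<in> arrs C" "src C (ev C Y Z) = (Y \<leadsto> Z) \<otimes> Y" "tgt C (ev C Y Z) = Z"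
  using ev_hom[of Y Z] by (auto simp: hom_iff)

lemma curry_simps [simp]:
  assumes "f \<in> arrs C" "src C f = X \<otimes> Y"
  shows "curry C X Y f \<in> arrs C" "src C (curry C X Y f) = X" "tgt C (curry C X Y f) = (Y \<leadsto> tgt C f)"
  using curry_hom[of f X Y "tgt C f"] assms by (auto simp: hom_iff)

text \<open>The beta law at an arbitrary argument \<open>b\<close>. The form in
  \<open>ev_curry\<close> matches only product arrows, which the simplifier has already turned into
  tuples.\<close>

lemma ev_tup_curry [simp]:
  assumes "f \<in> arrs C" "b \<in> arrs C" "src C f = X \<otimes> Y" "tgt C f = Z" "src C b = X" "tgt C b = Y"
  shows "ev C Y Z \<cdot> \<langle>curry C X Y f, b\<rangle> = f \<cdot> \<langle>idn C X, b\<rangle>"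
proof -
  have "f \<cdot> \<langle>idn C X, b\<rangle> = (ev C Y Z \<cdot> (curry C X Y f \<otimes>\<^sub>a idn C Y)) \<cdot> \<langle>idn C X, b\<rangle>"
    using ev_curry[of f X Y Z] assms by (simp add: hom_iff)
  also have "\<dots> = ev C Y Z \<cdot> \<langle>curry C X Y f, b\<rangle>"
    using assms by simp
  finally show ?thesis ..
qed

lemma curry_eta [simp]:
  assumes "g \<in> arrs C" "src C g = X" "tgt C g = (Y \<leadsto> Z)"
  shows "curry C X Y (ev C Y Z \<cdot> under C g X Y) = g"
  using curry_unique[of g X Y Z] assms by (simp add: hom_iff)

lemma curry_ev [simp]: "curry C (Y \<leadsto> Z) Y (ev C Y Z) = idn C (Y \<leadsto> Z)"
  using curry_eta[of "idn C (Y \<leadsto> Z)" "Y \<leadsto> Z" Y Z] by simp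

lemma expo_eqI:
  assumes "f \<in> hom C X (Y \<leadsto> Z)" "g \<in> hom C X (Y \<leadsto> Z)"
    "ev C Y Z \<cdot> under C f X Y = ev C Y Z \<cdot> under C g X Y"
  shows "f = g"
proof -
  have "f = curry C X Y (ev C Y Z \<cdot> under C f X Y)"
    using assms(1) by (simp add: hom_iff)
  also have "\<dots> = g"
    unfolding assms(3) using assms(2) by (simp add: hom_iff)
  finally show ?thesis .
qed

text \<open>Naturality of transposition: both sides have the same evaluation, and
  \<open>curry_eta\<close> recovers an arrow from its evaluation.\<close>

lemma curry_cmp [simp]:
  assumes "f \<in> arrs C" "src C f = X \<otimes> Y" "h \<in> arrs C" "tgt C h = X"
  shows "curry C X Y f \<cdot> h
    = curry C (src C h) Y (f \<cdot> under C h (src C h) Y)"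
proof -
  have "ev C Y (tgt C f) \<cdot> under C (curry C X Y f \<cdot> h) (src C h) Y
     = (ev C Y (tgt C f) \<cdot> under C (curry C X Y f) X Y)
         \<cdot> under C h (src C h) Y"
    using assms by simp
  also have "\<dots> = f \<cdot> under C h (src C h) Y"
    using ev_curry[of f X Y "tgt C f"] assms by (simp add: hom_iff)
  finally show ?thesis
    using assms curry_eta[of "curry C X Y f \<cdot> h" "src C h" Y "tgt C f"] by simp
qed

section \<open>Coproducts\<close>

lemma in_simps [simp]:
  "in1 C X Y \<in> arrs C" "src C (in1 C X Y) = X" "tgt C (in1 C X Y) = X \<oplus> Y"
  "in2 C X Y \<in> arrs C" "src C (in2 C X Y) = Y" "tgt C (in2 C X Y) = X \<oplus> Y"
  using in1_hom[of X Y] in2_hom[of Y X] in2_hom[of X Y] by (auto simp: hom_iff)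

lemma cotup_simps [simp]:
  assumes "f \<in> arrs C" "g \<in> arrs C" "tgt C f = tgt C g"
  shows "cotup C f g \<in> arrs C" "src C (cotup C f g) = src C f \<oplus> src C g" "tgt C (cotup C f g) = tgt C g"
  using cotup_hom[of f "src C f" "tgt C f" g "src C g"] assms by (auto simp: hom_iff)

lemma cotup_in [simp]:
  assumes "f \<in> arrs C" "g \<in> arrs C" "tgt C f = tgt C g" "src C f = X" "src C g = Y"
  shows "cotup C f g \<cdot> in1 C X Y = f" "cotup C f g \<cdot> in2 C X Y = g"
  using cotup_in1[of f X "tgt C f" g Y] cotup_in2[of f X "tgt C f" g Y] assms by (auto simp: hom_iff)

lemma cotup_in_cmp [simp]:
  assumes "f \<in> arrs C" "g \<in> arrs C" "tgt C f = tgt C g" "src C f = X" "src C g = Y" "h \<in> arrs C"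
  shows "tgt C h = X \<Longrightarrow> cotup C f g \<cdot> (in1 C X Y \<cdot> h) = f \<cdot> h"
    "tgt C h = Y \<Longrightarrow> cotup C f g \<cdot> (in2 C X Y \<cdot> h) = g \<cdot> h"
  using assms by (simp_all flip: cmp_cmp)

lemma sum_eqI:
  assumes "f \<in> hom C (X \<oplus> Y) Z" "g \<in> hom C (X \<oplus> Y) Z"
    "f \<cdot> in1 C X Y = g \<cdot> in1 C X Y" "f \<cdot> in2 C X Y = g \<cdot> in2 C X Y"
  shows "f = g"
proof -
  have "f = cotup C (f \<cdot> in1 C X Y) (f \<cdot> in2 C X Y)"
    by (rule cotup_unique[OF assms(1), symmetric])
  also have "\<dots> = g"
    unfolding assms(3,4) by (rule cotup_unique[OF assms(2)])
  finally show ?thesis .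
qed

section \<open>The initial object and objects over it\<close>

lemma cobang_simps [simp]:
  "cobang C X \<in> arrs C" "src C (cobang C X) = \<zero>" "tgt C (cobang C X) = X"
  using cobang_hom[of X] by (auto simp: hom_iff)

lemma cmp_cobang [simp]:
  assumes "h \<in> arrs C" "src C h = X"
  shows "h \<cdot> cobang C X = cobang C (tgt C h)"
  by (rule cobang_unique) (use assms in \<open>auto simp: hom_iff\<close>)

text \<open>\<open>W \<otimes> \<zero>\<close> is initial because \<open>(\<otimes>)\<close> with \<open>W\<close> has a right adjoint; the projection to \<open>\<zero>\<close> then
  forces any object over \<open>\<zero>\<close> to be initial.\<close>

lemma zero_times_eq:
  assumes "f \<in> hom C (\<zero> \<otimes> W) Z" "g \<in> hom C (\<zero> \<otimes> W) Z"
  shows "f = g"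
proof -
  have eq: "curry C \<zero> W f = curry C \<zero> W g"
    unfolding cobang_unique[OF curry_hom[OF assms(1)]] cobang_unique[OF curry_hom[OF assms(2)]] ..
  have "f = ev C W Z \<cdot> (curry C \<zero> W f \<otimes>\<^sub>a idn C W)"
    by (rule ev_curry[OF assms(1), symmetric])
  also have "\<dots> = g"
    unfolding eq by (rule ev_curry[OF assms(2)])
  finally show ?thesis .
qed

lemma over_zero_eq:
  assumes h: "h \<in> hom C W \<zero>" and f: "f \<in> hom C W Z" and g: "g \<in> hom C W Z"
  shows "f = g"
proof -
  have "f \<cdot> pr2 C \<zero> W = g \<cdot> pr2 C \<zero> W"
    by (rule zero_times_eq[of _ W Z]) (use f g in \<open>auto simp: hom_iff\<close>)
  then have "(f \<cdot> pr2 C \<zero> W) \<cdot> \<langle>h, idn C W\<rangle> = (g \<cdot> pr2 C \<zero> W) \<cdot> \<langle>h, idn C W\<rangle>"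
    by simp
  then show ?thesis
    using f g h by (simp add: hom_iff)
qed

section \<open>Distributivity and case distinction in a context\<close>

definition cse :: "'a \<Rightarrow> 'a \<Rightarrow> 'a \<Rightarrow> 'b \<Rightarrow> 'b \<Rightarrow> 'b" where
  "cse G X Y f g = cotup C f g \<cdot> dist C G X Y"

text \<open>Swapping the factors and transposing turns an arrow out of
  \<open>G \<otimes> (X \<oplus> Y)\<close> into one out of \<open>X \<oplus> Y\<close>, where the
  injections decide equality.\<close>

lemma distrib_eqI:
  assumes "f \<in> hom C (G \<otimes> (X \<oplus> Y)) Z" "g \<in> hom C (G \<otimes> (X \<oplus> Y)) Z"
    "f \<cdot> \<langle>pr1 C G X, in1 C X Y \<cdot> pr2 C G X\<rangle> = g \<cdot> \<langle>pr1 C G X, in1 C X Y \<cdot> pr2 C G X\<rangle>"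
    "f \<cdot> \<langle>pr1 C G Y, in2 C X Y \<cdot> pr2 C G Y\<rangle> = g \<cdot> \<langle>pr1 C G Y, in2 C X Y \<cdot> pr2 C G Y\<rangle>"
  shows "f = g"
proof -
  let ?s = "swap C (X \<oplus> Y) G"
  \<comment> \<open>Naturality of the swap moves each injection to the first factor, where
    \<open>curry_cmp\<close> can absorb it.\<close>
  have c: "(h \<cdot> ?s) \<cdot> under C (in1 C X Y) X G
      = (h \<cdot> \<langle>pr1 C G X, in1 C X Y \<cdot> pr2 C G X\<rangle>) \<cdot> swap C X G"
    "(h \<cdot> ?s) \<cdot> under C (in2 C X Y) Y G
      = (h \<cdot> \<langle>pr1 C G Y, in2 C X Y \<cdot> pr2 C G Y\<rangle>) \<cdot> swap C Y G"
    if "h \<in> hom C (G \<otimes> (X \<oplus> Y)) Z" for h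
    using that by (simp_all add: swap_def hom_iff)
  have "curry C (X \<oplus> Y) G (f \<cdot> ?s) = curry C (X \<oplus> Y) G (g \<cdot> ?s)"
  proof (rule sum_eqI)
    show "curry C (X \<oplus> Y) G (f \<cdot> ?s) \<cdot> in1 C X Y = curry C (X \<oplus> Y) G (g \<cdot> ?s) \<cdot> in1 C X Y"
      using assms(1,2) c(1)[OF assms(1)] c(1)[OF assms(2)] assms(3)
      by (subst (1 2) curry_cmp) (simp_all only: hom_iff in_simps swap_def cmp_simps tup_simps pr_simps)
    show "curry C (X \<oplus> Y) G (f \<cdot> ?s) \<cdot> in2 C X Y = curry C (X \<oplus> Y) G (g \<cdot> ?s) \<cdot> in2 C X Y"
      using assms(1,2) c(2)[OF assms(1)] c(2)[OF assms(2)] assms(4)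
      by (subst (1 2) curry_cmp) (simp_all only: hom_iff in_simps swap_def cmp_simps tup_simps pr_simps)
  qed (use assms(1,2) in \<open>auto simp: hom_iff swap_def\<close>)
  then have "(ev C G Z \<cdot> \<langle>curry C (X \<oplus> Y) G (f \<cdot> ?s) \<cdot> pr2 C G (X \<oplus> Y), pr1 C G (X \<oplus> Y)\<rangle>)
    = (ev C G Z \<cdot> \<langle>curry C (X \<oplus> Y) G (g \<cdot> ?s) \<cdot> pr2 C G (X \<oplus> Y), pr1 C G (X \<oplus> Y)\<rangle>)"
    by simp
  then show ?thesis
    using assms(1,2) by (simp add: hom_iff swap_def)
qed

text \<open>\<open>dist\<close> is a definite description, so an actual inverse has to be exhibited
  before anything can be said about it. Cartesian closure supplies one.\<close>

lemma dist_inverse: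
  shows "dist C G X Y \<in> hom C (G \<otimes> (X \<oplus> Y)) ((G \<otimes> X) \<oplus> (G \<otimes> Y))"
    and "dist C G X Y \<cdot> cotup C (idn C G \<otimes>\<^sub>a in1 C X Y) (idn C G \<otimes>\<^sub>a in2 C X Y) = idn C ((G \<otimes> X) \<oplus> (G \<otimes> Y))"
proof -
  let ?d = "cotup C (idn C G \<otimes>\<^sub>a in1 C X Y) (idn C G \<otimes>\<^sub>a in2 C X Y)"
  let ?i1 = "in1 C (G \<otimes> X) (G \<otimes> Y)" and ?i2 = "in2 C (G \<otimes> X) (G \<otimes> Y)"
  \<comment> \<open>Transposing in \<open>G\<close> leaves an arrow out of
    \<open>X \<oplus> Y\<close> alone, which copairing can define; \<open>e\<close> moves the tag of
    the second component to the outside of the pair.\<close>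
  define e where "e = ev C G ((G \<otimes> X) \<oplus> (G \<otimes> Y)) \<cdot> \<langle>cotup C (curry C X G (?i1 \<cdot> swap C X G))
      (curry C Y G (?i2 \<cdot> swap C Y G)) \<cdot> pr2 C G (X \<oplus> Y), pr1 C G (X \<oplus> Y)\<rangle>"
  have d: "?d \<in> hom C ((G \<otimes> X) \<oplus> (G \<otimes> Y)) (G \<otimes> (X \<oplus> Y))"
    by (auto simp: hom_iff)
  have e: "e \<in> hom C (G \<otimes> (X \<oplus> Y)) ((G \<otimes> X) \<oplus> (G \<otimes> Y))"
    by (auto simp: hom_iff e_def swap_def)
  have ei: "e \<cdot> (idn C G \<otimes>\<^sub>a in1 C X Y) = ?i1" "e \<cdot> (idn C G \<otimes>\<^sub>a in2 C X Y) = ?i2"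
    by (simp_all add: e_def swap_def)
  have ed: "e \<cdot> ?d = idn C ((G \<otimes> X) \<oplus> (G \<otimes> Y))"
  proof (rule sum_eqI)
    show "(e \<cdot> ?d) \<cdot> ?i1 = idn C ((G \<otimes> X) \<oplus> (G \<otimes> Y)) \<cdot> ?i1"
        using d e ei by (simp add: hom_iff)
    show "(e \<cdot> ?d) \<cdot> ?i2 = idn C ((G \<otimes> X) \<oplus> (G \<otimes> Y)) \<cdot> ?i2"
        using d e ei by (simp add: hom_iff)
  qed (use d e in \<open>auto simp: hom_iff\<close>)
  have de: "?d \<cdot> e = idn C (G \<otimes> (X \<oplus> Y))"
  proof (rule distrib_eqI)
    show "(?d \<cdot> e) \<cdot> \<langle>pr1 C G X, in1 C X Y \<cdot> pr2 C G X\<rangle>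
      = idn C (G \<otimes> (X \<oplus> Y)) \<cdot> \<langle>pr1 C G X, in1 C X Y \<cdot> pr2 C G X\<rangle>"
      using d e ei(1) by (simp add: hom_iff)
    show "(?d \<cdot> e) \<cdot> \<langle>pr1 C G Y, in2 C X Y \<cdot> pr2 C G Y\<rangle>
      = idn C (G \<otimes> (X \<oplus> Y)) \<cdot> \<langle>pr1 C G Y, in2 C X Y \<cdot> pr2 C G Y\<rangle>"
      using d e ei(2) by (simp add: hom_iff)
  qed (use d e in \<open>auto simp: hom_iff\<close>)
  have "dist C G X Y = e"
    unfolding dist_def using d e ed de by (rule inv_arr_eqI)
  with e ed show "dist C G X Y \<in> hom C (G \<otimes> (X \<oplus> Y)) ((G \<otimes> X) \<oplus> (G \<otimes> Y))"
    "dist C G X Y \<cdot> ?d = idn C ((G \<otimes> X) \<oplus> (G \<otimes> Y))"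
    by simp_all
qed

lemma dist_simps [simp]:
  "dist C G X Y \<in> arrs C" "src C (dist C G X Y) = G \<otimes> (X \<oplus> Y)"
  "tgt C (dist C G X Y) = (G \<otimes> X) \<oplus> (G \<otimes> Y)"
  using dist_inverse(1)[of G X Y] by (auto simp: hom_iff)

lemma cse_simps [simp]:
  assumes "f \<in> arrs C" "g \<in> arrs C" "src C f = G \<otimes> X" "src C g = G \<otimes> Y" "tgt C f = tgt C g"
  shows "cse G X Y f g \<in> arrs C" "src C (cse G X Y f g) = G \<otimes> (X \<oplus> Y)"
    "tgt C (cse G X Y f g) = tgt C g"
  using assms by (simp_all add: cse_def)

lemma dist_in:
  "dist C G X Y \<cdot> \<langle>pr1 C G X, in1 C X Y \<cdot> pr2 C G X\<rangle> = in1 C (G \<otimes> X) (G \<otimes> Y)"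
  "dist C G X Y \<cdot> \<langle>pr1 C G Y, in2 C X Y \<cdot> pr2 C G Y\<rangle> = in2 C (G \<otimes> X) (G \<otimes> Y)"
proof -
  let ?d = "cotup C (idn C G \<otimes>\<^sub>a in1 C X Y) (idn C G \<otimes>\<^sub>a in2 C X Y)"
  have "(dist C G X Y \<cdot> ?d) \<cdot> in1 C (G \<otimes> X) (G \<otimes> Y) = in1 C (G \<otimes> X) (G \<otimes> Y)"
    "(dist C G X Y \<cdot> ?d) \<cdot> in2 C (G \<otimes> X) (G \<otimes> Y) = in2 C (G \<otimes> X) (G \<otimes> Y)"
    by (simp_all only: dist_inverse(2)) simp_all
  then show "dist C G X Y \<cdot> \<langle>pr1 C G X, in1 C X Y \<cdot> pr2 C G X\<rangle> = in1 C (G \<otimes> X) (G \<otimes> Y)"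
    "dist C G X Y \<cdot> \<langle>pr1 C G Y, in2 C X Y \<cdot> pr2 C G Y\<rangle> = in2 C (G \<otimes> X) (G \<otimes> Y)"
    by simp_all
qed

lemma cse_in [simp]:
  assumes "f \<in> arrs C" "g \<in> arrs C" "src C f = G \<otimes> X" "src C g = G \<otimes> Y" "tgt C f = tgt C g"
    "a \<in> arrs C" "b \<in> arrs C" "src C a = src C b" "tgt C a = G"
  shows "tgt C b = X \<Longrightarrow> cse G X Y f g \<cdot> \<langle>a, in1 C X Y \<cdot> b\<rangle> = f \<cdot> \<langle>a, b\<rangle>"
    and "tgt C b = Y \<Longrightarrow> cse G X Y f g \<cdot> \<langle>a, in2 C X Y \<cdot> b\<rangle> = g \<cdot> \<langle>a, b\<rangle>"
proof -
  assume b: "tgt C b = X"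
  have "cse G X Y f g \<cdot> \<langle>a, in1 C X Y \<cdot> b\<rangle>
    = cotup C f g \<cdot> ((dist C G X Y \<cdot> \<langle>pr1 C G X, in1 C X Y \<cdot> pr2 C G X\<rangle>) \<cdot> \<langle>a, b\<rangle>)"
    using assms b by (simp add: cse_def)
  also have "\<dots> = f \<cdot> \<langle>a, b\<rangle>"
    using assms b by (simp only: dist_in) simp
  finally show "cse G X Y f g \<cdot> \<langle>a, in1 C X Y \<cdot> b\<rangle> = f \<cdot> \<langle>a, b\<rangle>" .
next
  assume b: "tgt C b = Y"
  have "cse G X Y f g \<cdot> \<langle>a, in2 C X Y \<cdot> b\<rangle>
    = cotup C f g \<cdot> ((dist C G X Y \<cdot> \<langle>pr1 C G Y, in2 C X Y \<cdot> pr2 C G Y\<rangle>) \<cdot> \<langle>a, b\<rangle>)"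
    using assms b by (simp add: cse_def)
  also have "\<dots> = g \<cdot> \<langle>a, b\<rangle>"
    using assms b by (simp only: dist_in) simp
  finally show "cse G X Y f g \<cdot> \<langle>a, in2 C X Y \<cdot> b\<rangle> = g \<cdot> \<langle>a, b\<rangle>" .
qed

lemma cse_times:
  assumes "f \<in> arrs C" "g \<in> arrs C" "src C f = G \<otimes> X" "src C g = G \<otimes> Y" "tgt C f = tgt C g"
    "h \<in> hom C W G"
  shows "cse G X Y f g \<cdot> under C h W (X \<oplus> Y)
    = cse W X Y (f \<cdot> under C h W X) (g \<cdot> under C h W Y)"
  by (rule distrib_eqI[of _ W X Y "tgt C g"]) (use assms in \<open>auto simp: hom_iff\<close>)

lemma cse_tup:
  assumes "f \<in> arrs C" "g \<in> arrs C" "src C f = G \<otimes> X" "src C g = G \<otimes> Y" "tgt C f = tgt C g"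
    "h \<in> hom C W G" "u \<in> hom C W (X \<oplus> Y)"
  shows "cse G X Y f g \<cdot> \<langle>h, u\<rangle>
    = cse W X Y (f \<cdot> under C h W X) (g \<cdot> under C h W Y) \<cdot> \<langle>idn C W, u\<rangle>"
  by (subst cse_times[symmetric]) (use assms in \<open>auto simp: hom_iff\<close>)

text \<open>In the translation a sum value is paired with a state, so the sum sits in the middle of
  a product. Permuting it to the last position reduces this to \<open>distrib_eqI\<close>.\<close>

lemma distrib_middle_eqI:
  assumes "f \<in> hom C (W \<otimes> ((X1 \<oplus> X2) \<otimes> Y)) Z" "g \<in> hom C (W \<otimes> ((X1 \<oplus> X2) \<otimes> Y)) Z"
    "f \<cdot> \<langle>pr1 C W Y \<cdot> pr1 C (W \<otimes> Y) X1, \<langle>in1 C X1 X2 \<cdot> pr2 C (W \<otimes> Y) X1, pr2 C W Y \<cdot> pr1 C (W \<otimes> Y) X1\<rangle>\<rangle>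
      = g \<cdot> \<langle>pr1 C W Y \<cdot> pr1 C (W \<otimes> Y) X1, \<langle>in1 C X1 X2 \<cdot> pr2 C (W \<otimes> Y) X1, pr2 C W Y \<cdot> pr1 C (W \<otimes> Y) X1\<rangle>\<rangle>"
    "f \<cdot> \<langle>pr1 C W Y \<cdot> pr1 C (W \<otimes> Y) X2, \<langle>in2 C X1 X2 \<cdot> pr2 C (W \<otimes> Y) X2, pr2 C W Y \<cdot> pr1 C (W \<otimes> Y) X2\<rangle>\<rangle>
      = g \<cdot> \<langle>pr1 C W Y \<cdot> pr1 C (W \<otimes> Y) X2, \<langle>in2 C X1 X2 \<cdot> pr2 C (W \<otimes> Y) X2, pr2 C W Y \<cdot> pr1 C (W \<otimes> Y) X2\<rangle>\<rangle>"
  shows "f = g"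
proof -
  let ?S = "X1 \<oplus> X2"
  let ?i = "\<langle>pr1 C W Y \<cdot> pr1 C (W \<otimes> Y) ?S, \<langle>pr2 C (W \<otimes> Y) ?S, pr2 C W Y \<cdot> pr1 C (W \<otimes> Y) ?S\<rangle>\<rangle>"
  let ?j = "\<langle>\<langle>pr1 C W (?S \<otimes> Y), pr2 C ?S Y \<cdot> pr2 C W (?S \<otimes> Y)\<rangle>, pr1 C ?S Y \<cdot> pr2 C W (?S \<otimes> Y)\<rangle>"
  have "f \<cdot> ?i = g \<cdot> ?i"
    by (rule distrib_eqI[of _ "W \<otimes> Y" X1 X2 Z]) (use assms in \<open>simp_all add: hom_iff\<close>)
  then have "(f \<cdot> ?i) \<cdot> ?j = (g \<cdot> ?i) \<cdot> ?j"
    by simp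
  then show ?thesis
    using assms(1,2) by (simp add: hom_iff)
qed

end

section \<open>Suprema of chains of arrows\<close>

context omega_cpo_bicc
begin

lemma le_refl [simp]: "f \<in> arrs C \<Longrightarrow> f \<sqsubseteq> f"
  using hom_omega_cpo[of "src C f" "tgt C f"] by (auto simp: omega_cpo_def reflp_on_def hom_iff)

lemma le_antisym:
  assumes "f \<sqsubseteq> g" "g \<sqsubseteq> f" "f \<in> hom C X Y" "g \<in> hom C X Y"
  shows "f = g"
  using hom_omega_cpo[of X Y] assms unfolding omega_cpo_def antisymp_on_def by blast

abbreviation lub_of :: "'a \<Rightarrow> 'a \<Rightarrow> (nat \<Rightarrow> 'b) \<Rightarrow> 'b \<Rightarrow> bool" where
  "lub_of X Y \<equiv> is_omega_lub (hom C X Y) (le C)"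

abbreviation chain_in :: "'a \<Rightarrow> 'a \<Rightarrow> (nat \<Rightarrow> 'b) \<Rightarrow> bool" where
  "chain_in X Y \<equiv> omega_chain (hom C X Y) (le C)"

lemma lub_unique:
  assumes "lub_of X Y F f" "lub_of X Y F g"
  shows "f = g"
  using assms le_antisym[of f g X Y] unfolding is_omega_lub_def by blast

lemma lub_exists: "chain_in X Y F \<Longrightarrow> \<exists>f. lub_of X Y F f"
  using hom_omega_cpo unfolding omega_cpo_def by blast

lemma omega_lub_eqI: "lub_of X Y F f \<Longrightarrow> omega_lub (hom C X Y) (le C) F = f"
  unfolding omega_lub_def using lub_unique by blast

lemma lub_const: "f \<in> hom C X Y \<Longrightarrow> lub_of X Y (\<lambda>_. f) f"
  by (auto simp: is_omega_lub_def hom_iff)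

text \<open>Enrichment makes composition continuous in both arguments jointly; the one-sided
  versions below come from pairing with a constant chain.\<close>

lemma cmp_pair_lub:
  assumes "chain_in Y Z G" "lub_of Y Z G g" "chain_in X Y F" "lub_of X Y F f"
  shows "chain_in X Z (\<lambda>n. G n \<cdot> F n)" "lub_of X Z (\<lambda>n. G n \<cdot> F n) (g \<cdot> f)"
proof -
  note c = cmp_continuous[of Y Z X, unfolded omega_continuous_def]
  have F: "omega_chain (hom C Y Z \<times> hom C X Y) (rel_prod (le C) (le C)) (\<lambda>n. (G n, F n))"
    using assms by (auto simp: omega_chain_def)
  have f: "is_omega_lub (hom C Y Z \<times> hom C X Y) (rel_prod (le C) (le C)) (\<lambda>n. (G n, F n)) (g, f)"
    using assms by (auto simp: is_omega_lub_def)
  show "lub_of X Z (\<lambda>n. G n \<cdot> F n) (g \<cdot> f)"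
    using c F f by (fastforce simp: comp_def)
  show "chain_in X Z (\<lambda>n. G n \<cdot> F n)"
    using F c cmp_hom unfolding omega_chain_def monotone_on_def by fastforce
qed

lemma const_chain: "f \<in> hom C X Y \<Longrightarrow> chain_in X Y (\<lambda>_. f)"
  by (auto simp: omega_chain_def hom_iff)

lemma cmp_chain:
  assumes "chain_in X Y F" "g \<in> hom C Y Z"
  shows "chain_in X Z (\<lambda>n. g \<cdot> F n)"
  using cmp_pair_lub(1)[OF const_chain lub_const] lub_exists assms by blast

lemma cmp_lub:
  assumes "chain_in X Y F" "lub_of X Y F f" "g \<in> hom C Y Z"
  shows "lub_of X Z (\<lambda>n. g \<cdot> F n) (g \<cdot> f)"
  using cmp_pair_lub(2)[OF const_chain lub_const] assms by blast

lemma precmp_chain: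
  assumes "chain_in X Y F" "h \<in> hom C W X"
  shows "chain_in W Y (\<lambda>n. F n \<cdot> h)"
  using cmp_pair_lub(1)[OF _ _ const_chain lub_const] lub_exists assms by blast

lemma precmp_lub:
  assumes "chain_in X Y F" "lub_of X Y F f" "h \<in> hom C W X"
  shows "lub_of W Y (\<lambda>n. F n \<cdot> h) (f \<cdot> h)"
  using cmp_pair_lub(2)[OF _ _ const_chain lub_const] assms by blast

lemma cmp_mono:
  assumes "g \<sqsubseteq> g'" "f \<sqsubseteq> f'" "f \<in> hom C X Y" "f' \<in> hom C X Y" "g \<in> hom C Y Z" "g' \<in> hom C Y Z"
  shows "g \<cdot> f \<sqsubseteq> g' \<cdot> f'"
proof -
  have "monotone_on (hom C Y Z \<times> hom C X Y) (rel_prod (le C) (le C)) (le C) (\<lambda>(g, f). g \<cdot> f)"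
    using cmp_continuous[of Y Z X] by (simp add: omega_continuous_def)
  from monotone_onD[OF this, of "(g, f)" "(g', f')"] show ?thesis
    using assms by simp
qed

lemma tup_mono:
  assumes "f \<sqsubseteq> f'" "g \<sqsubseteq> g'" "f \<in> hom C Z X" "f' \<in> hom C Z X" "g \<in> hom C Z Y" "g' \<in> hom C Z Y"
  shows "\<langle>f, g\<rangle> \<sqsubseteq> \<langle>f', g'\<rangle>"
proof -
  have "monotone_on (hom C Z X \<times> hom C Z Y) (rel_prod (le C) (le C)) (le C) (\<lambda>(f, g). \<langle>f, g\<rangle>)"
    using tup_continuous[of Z X Y] by (simp add: omega_continuous_def)
  from monotone_onD[OF this, of "(f, g)" "(f', g')"] show ?thesis
    using assms by simp
qed

lemma tup_lub:
  assumes "chain_in Z X F" "lub_of Z X F f" "chain_in Z Y G" "lub_of Z Y G g"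
  shows "chain_in Z (X \<otimes> Y) (\<lambda>n. \<langle>F n, G n\<rangle>)" "lub_of Z (X \<otimes> Y) (\<lambda>n. \<langle>F n, G n\<rangle>) \<langle>f, g\<rangle>"
proof -
  note c = tup_continuous[of Z X Y, unfolded omega_continuous_def]
  have F: "omega_chain (hom C Z X \<times> hom C Z Y) (rel_prod (le C) (le C)) (\<lambda>n. (F n, G n))"
    using assms by (auto simp: omega_chain_def)
  have f: "is_omega_lub (hom C Z X \<times> hom C Z Y) (rel_prod (le C) (le C)) (\<lambda>n. (F n, G n)) (f, g)"
    using assms by (auto simp: is_omega_lub_def)
  show "lub_of Z (X \<otimes> Y) (\<lambda>n. \<langle>F n, G n\<rangle>) \<langle>f, g\<rangle>"
    using c F f by (fastforce simp: comp_def)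
  show "chain_in Z (X \<otimes> Y) (\<lambda>n. \<langle>F n, G n\<rangle>)"
    using F by (auto simp: omega_chain_def intro: tup_hom tup_mono)
qed

lemma curry_mono:
  assumes "f \<sqsubseteq> f'" "f \<in> hom C (X \<otimes> Y) Z" "f' \<in> hom C (X \<otimes> Y) Z"
  shows "curry C X Y f \<sqsubseteq> curry C X Y f'"
  using curry_continuous[of X Y Z] monotone_onD[of "hom C (X \<otimes> Y) Z" "le C" "le C" "curry C X Y" f f']
    assms by (simp add: omega_continuous_def)

end


section \<open>Kleisli extension of a strong monad\<close>

context strong_monad
begin

lemma far_simps [simp]:
  assumes "f \<in> arrs C"
  shows "far T f \<in> arrs C" "src C (far T f) = fob T (src C f)" "tgt C (far T f) = fob T (tgt C f)"
  using far_hom[of f "src C f" "tgt C f"] assms by (auto simp: hom_iff)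

declare far_idn [simp]

lemma far_cmp_eq [simp]:
  assumes "f \<in> arrs C" "g \<in> arrs C" "src C g = tgt C f"
  shows "far T (g \<cdot> f) = far T g \<cdot> far T f"
  using far_cmp[of f "src C f" "tgt C f" g "tgt C g"] assms by (auto simp: hom_iff)

lemma ret_simps [simp]:
  "ret T X \<in> arrs C" "src C (ret T X) = X" "tgt C (ret T X) = fob T X"
  using ret_hom[of X] by (auto simp: hom_iff)

lemma mul_simps [simp]:
  "mul T X \<in> arrs C" "src C (mul T X) = fob T (fob T X)" "tgt C (mul T X) = fob T X"
  using mul_hom[of X] by (auto simp: hom_iff)

lemma str_simps [simp]:
  "str T X Y \<in> arrs C" "src C (str T X Y) = X \<otimes> fob T Y" "tgt C (str T X Y) = fob T (X \<otimes> Y)"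
  using str_hom[of X Y] by (auto simp: hom_iff)

lemma far_ret [simp]:
  assumes "f \<in> arrs C" "src C f = X"
  shows "far T f \<cdot> ret T X = ret T (tgt C f) \<cdot> f"
  using ret_natural[of f X "tgt C f"] assms by (simp add: hom_iff)

lemma far_ret_cmp [simp]:
  assumes "f \<in> arrs C" "src C f = X" "a \<in> arrs C" "tgt C a = X"
  shows "far T f \<cdot> (ret T X \<cdot> a) = ret T (tgt C f) \<cdot> (f \<cdot> a)"
  using assms cmp_cmp[of a "ret T X" "far T f"] by (simp del: cmp_cmp) simp

text \<open>Kleisli extension in a context: for \<open>m\<close> from \<open>W\<close> to
  \<open>fob T X\<close> and \<open>k\<close> from \<open>W \<otimes> X\<close> to
  \<open>fob T Z\<close> it is \<open>let x = m in k\<close>. The context \<open>W\<close> is read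
  off as the source of \<open>m\<close>; \<open>X\<close> and \<open>Z\<close> are arguments because
  \<open>fob T\<close> need not be injective.\<close>

definition bnd :: "'o \<Rightarrow> 'o \<Rightarrow> 'm \<Rightarrow> 'm \<Rightarrow> 'm" where
  "bnd X Z m k = mul T Z \<cdot> far T k \<cdot> str T (src C m) X \<cdot> \<langle>idn C (src C m), m\<rangle>"

lemma bnd_simps [simp]:
  assumes "m \<in> arrs C" "k \<in> arrs C" "tgt C m = fob T X" "src C k = src C m \<otimes> X" "tgt C k = fob T Z"
  shows "bnd X Z m k \<in> arrs C" "src C (bnd X Z m k) = src C m" "tgt C (bnd X Z m k) = fob T Z"
  using assms by (simp_all add: bnd_def)

text \<open>Naturality of the strength in its first factor. It reduces an arbitrary context arrow
  \<open>a\<close> to the identity, which is the form that \<open>bnd\<close> uses.\<close>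

lemma str_tup:
  assumes "a \<in> hom C W X" "m \<in> hom C W (fob T Y)"
  shows "str T X Y \<cdot> \<langle>a, m\<rangle> = far T (under C a W Y) \<cdot> str T W Y \<cdot> \<langle>idn C W, m\<rangle>"
proof -
  have "str T X Y \<cdot> \<langle>a, m\<rangle> = (str T X Y \<cdot> (a \<otimes>\<^sub>a far T (idn C Y))) \<cdot> \<langle>idn C W, m\<rangle>"
    using assms by (simp add: hom_iff)
  also have "\<dots> = (far T (a \<otimes>\<^sub>a idn C Y) \<cdot> str T W Y) \<cdot> \<langle>idn C W, m\<rangle>"
    using str_natural[of a W X "idn C Y" Y Y] assms by (simp only: idn_hom)
  finally show ?thesis
    using assms by (simp add: hom_iff)
qed

lemma str_cmp:
  assumes "h \<in> hom C V W" "m \<in> hom C W (fob T Y)"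
  shows "str T W Y \<cdot> \<langle>h, m \<cdot> h\<rangle> = far T (under C h V Y) \<cdot> str T V Y \<cdot> \<langle>idn C V, m \<cdot> h\<rangle>"
  using str_tup[OF assms(1) cmp_hom[OF assms]] .

lemma bnd_cmp [simp]:
  assumes "m \<in> arrs C" "k \<in> arrs C" "tgt C m = fob T X" "src C k = src C m \<otimes> X" "tgt C k = fob T Z"
    "h \<in> arrs C" "tgt C h = src C m"
  shows "bnd X Z m k \<cdot> h = bnd X Z (m \<cdot> h) (k \<cdot> under C h (src C h) X)"
  using assms str_cmp[of h "src C h" "src C m" m X] by (simp add: bnd_def hom_iff)

lemma bnd_ret_cmp [simp]:
  assumes "a \<in> arrs C" "k \<in> arrs C" "tgt C a = X" "src C k = src C a \<otimes> X" "tgt C k = fob T Z"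
  shows "bnd X Z (ret T X \<cdot> a) k = k \<cdot> \<langle>idn C (src C a), a\<rangle>"
proof -
  let ?W = "src C a"
  have "str T ?W X \<cdot> \<langle>idn C ?W, ret T X \<cdot> a\<rangle> = (str T ?W X \<cdot> (idn C ?W \<otimes>\<^sub>a ret T X)) \<cdot> \<langle>idn C ?W, a\<rangle>"
    using assms by simp
  also have "\<dots> = ret T (?W \<otimes> X) \<cdot> \<langle>idn C ?W, a\<rangle>"
    by (simp only: str_ret)
  finally have "bnd X Z (ret T X \<cdot> a) k = mul T Z \<cdot> ret T (fob T Z) \<cdot> k \<cdot> \<langle>idn C ?W, a\<rangle>"
    using assms by (simp add: bnd_def)
  also have "\<dots> = (mul T Z \<cdot> ret T (fob T Z)) \<cdot> (k \<cdot> \<langle>idn C ?W, a\<rangle>)"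
    using assms by simp
  also have "\<dots> = k \<cdot> \<langle>idn C ?W, a\<rangle>"
    using assms by (simp only: mul_ret) simp
  finally show ?thesis .
qed

lemma far_bnd [simp]:
  assumes "m \<in> arrs C" "k \<in> arrs C" "tgt C m = fob T X" "src C k = src C m \<otimes> X" "tgt C k = fob T Z"
    "f \<in> arrs C" "src C f = Z"
  shows "far T f \<cdot> bnd X Z m k = bnd X (tgt C f) m (far T f \<cdot> k)"
proof -
  have "far T f \<cdot> bnd X Z m k = (far T f \<cdot> mul T Z) \<cdot> far T k \<cdot> str T (src C m) X \<cdot> \<langle>idn C (src C m), m\<rangle>"
    using assms by (simp add: bnd_def)
  also have "\<dots> = (mul T (tgt C f) \<cdot> far T (far T f)) \<cdot> far T k \<cdot> str T (src C m) X \<cdot> \<langle>idn C (src C m), m\<rangle>"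
    using mul_natural[of f Z "tgt C f"] assms by (simp only: hom_iff)
  also have "\<dots> = bnd X (tgt C f) m (far T f \<cdot> k)"
    using assms by (simp add: bnd_def)
  finally show ?thesis .
qed

lemma bnd_far [simp]:
  assumes "m \<in> arrs C" "k \<in> arrs C" "tgt C m = fob T (src C f)" "src C k = src C m \<otimes> X" "tgt C k = fob T Z"
    "f \<in> arrs C" "tgt C f = X"
  shows "bnd X Z (far T f \<cdot> m) k
    = bnd (src C f) Z m (k \<cdot> \<langle>pr1 C (src C m) (src C f), f \<cdot> pr2 C (src C m) (src C f)\<rangle>)"
proof -
  let ?W = "src C m"
  have "str T ?W X \<cdot> \<langle>idn C ?W, far T f \<cdot> m\<rangle> = (str T ?W X \<cdot> (idn C ?W \<otimes>\<^sub>a far T f)) \<cdot> \<langle>idn C ?W, m\<rangle>"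
    using assms by simp
  also have "\<dots> = (far T (idn C ?W \<otimes>\<^sub>a f) \<cdot> str T ?W (src C f)) \<cdot> \<langle>idn C ?W, m\<rangle>"
    using str_natural[of "idn C ?W" ?W ?W f "src C f" X] assms by (simp only: hom_iff idn_simps)
  finally show ?thesis
    using assms by (simp add: bnd_def)
qed

text \<open>Naturality along \<open>bang C W\<close> reduces this to the unit law
  \<open>str_one\<close> of the strength.\<close>

lemma far_pr2_str: "far T (pr2 C W X) \<cdot> str T W X = pr2 C W (fob T X)"
proof -
  have "far T (pr2 C W X) \<cdot> str T W X = far T (pr2 C \<one> X) \<cdot> (far T (bang C W \<otimes>\<^sub>a idn C X) \<cdot> str T W X)"
    by (simp flip: cmp_cmp far_cmp_eq)
  also have "\<dots> = far T (pr2 C \<one> X) \<cdot> (str T \<one> X \<cdot> (bang C W \<otimes>\<^sub>a far T (idn C X)))"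
    using str_natural[of "bang C W" W \<one> "idn C X" X X] by (simp only: bang_hom idn_hom)
  also have "\<dots> = (far T (pr2 C \<one> X) \<cdot> str T \<one> X) \<cdot> (bang C W \<otimes>\<^sub>a far T (idn C X))"
    by (rule cmp_cmp[symmetric]) simp_all
  also have "\<dots> = pr2 C W (fob T X)"
    unfolding str_one by simp
  finally show ?thesis .
qed

text \<open>The functor action is a Kleisli extension with a pure continuation, so facts about
  \<open>far\<close> can be obtained from facts about \<open>bnd\<close>.\<close>

lemma far_eq_bnd:
  assumes "m \<in> arrs C" "f \<in> arrs C" "tgt C m = fob T (src C f)"
  shows "far T f \<cdot> m = bnd (src C f) (tgt C f) m (ret T (tgt C f) \<cdot> f \<cdot> pr2 C (src C m) (src C f))"
proof -
  let ?W = "src C m" and ?X = "src C f" and ?Z = "tgt C f"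
  have "bnd ?X ?Z m (ret T ?Z \<cdot> f \<cdot> pr2 C ?W ?X)
    = (mul T ?Z \<cdot> far T (ret T ?Z)) \<cdot> far T f \<cdot> (far T (pr2 C ?W ?X) \<cdot> str T ?W ?X) \<cdot> \<langle>idn C ?W, m\<rangle>"
    using assms by (simp add: bnd_def)
  also have "\<dots> = far T f \<cdot> m"
    using assms by (simp only: mul_far_ret far_pr2_str) simp
  finally show ?thesis ..
qed

lemma bnd_ret_right [simp]:
  assumes "m \<in> arrs C" "tgt C m = fob T X"
  shows "bnd X X m (ret T X \<cdot> pr2 C (src C m) X) = m"
  using far_eq_bnd[of m "idn C X"] assms by simp

lemma mul_eq_bnd:
  assumes "m \<in> arrs C" "tgt C m = fob T (fob T X)"
  shows "mul T X \<cdot> m = bnd (fob T X) X m (pr2 C (src C m) (fob T X))"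
proof -
  have "bnd (fob T X) X m (pr2 C (src C m) (fob T X))
     = mul T X \<cdot> (far T (pr2 C (src C m) (fob T X)) \<cdot> str T (src C m) (fob T X)) \<cdot> \<langle>idn C (src C m), m\<rangle>"
    using assms by (simp add: bnd_def)
  then show ?thesis
    using assms by (simp add: far_pr2_str)
qed

text \<open>Using the context twice amounts to the diagonal
  \<open>\<langle>idn C W, idn C W\<rangle>\<close>; \<open>str_assoc\<close> and naturality then
  merge the two strengths into one.\<close>

lemma str_str:
  assumes "m \<in> hom C W (fob T X)"
  shows "str T W (W \<otimes> X) \<cdot> \<langle>idn C W, str T W X \<cdot> \<langle>idn C W, m\<rangle>\<rangle>
    = far T \<langle>pr1 C W X, idn C (W \<otimes> X)\<rangle> \<cdot> str T W X \<cdot> \<langle>idn C W, m\<rangle>"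
proof -
  have "str T W (W \<otimes> X) \<cdot> \<langle>idn C W, str T W X \<cdot> \<langle>idn C W, m\<rangle>\<rangle>
    = (str T W (W \<otimes> X) \<cdot> (idn C W \<otimes>\<^sub>a str T W X) \<cdot> assoc C W W (fob T X)) \<cdot> \<langle>\<langle>idn C W, idn C W\<rangle>, m\<rangle>"
    using assms by (simp add: hom_iff assoc_def)
  also have "\<dots> = (far T (assoc C W W X) \<cdot> str T (W \<otimes> W) X) \<cdot> \<langle>\<langle>idn C W, idn C W\<rangle>, m\<rangle>"
    by (simp only: str_assoc)
  also have "\<dots> = far T (assoc C W W X) \<cdot> (str T (W \<otimes> W) X \<cdot> \<langle>\<langle>idn C W, idn C W\<rangle>, m\<rangle>)"
    using assms by (intro cmp_cmp) (auto simp: hom_iff assoc_def)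
  also have "\<dots> = far T (assoc C W W X) \<cdot> (far T (under C \<langle>idn C W, idn C W\<rangle> W X) \<cdot> str T W X \<cdot> \<langle>idn C W, m\<rangle>)"
    by (subst str_tup[of _ W _ m]) (use assms in \<open>simp_all add: hom_iff\<close>)
  also have "\<dots> = far T (assoc C W W X \<cdot> under C \<langle>idn C W, idn C W\<rangle> W X) \<cdot> str T W X \<cdot> \<langle>idn C W, m\<rangle>"
    by (subst far_cmp_eq[of "under C \<langle>idn C W, idn C W\<rangle> W X"])
      (use assms in \<open>simp_all add: hom_iff assoc_def\<close>)
  finally show ?thesis
    using assms by (simp add: hom_iff assoc_def del: far_cmp_eq)
qed

text \<open>Associativity, directed so that bindings nest to the right. The strength passes the
  inner multiplication by \<open>str_mul\<close>, the two multiplications are exchanged by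
  \<open>mul_mul\<close>, and the two uses of the context are merged by
  \<open>str_str\<close>.\<close>

lemma bnd_bnd [simp]:
  assumes "m \<in> arrs C" "k \<in> arrs C" "k' \<in> arrs C" "tgt C m = fob T X'"
    "src C k = src C m \<otimes> X'" "tgt C k = fob T X" "src C k' = src C m \<otimes> X" "tgt C k' = fob T Z"
  shows "bnd X Z (bnd X' X m k) k' = bnd X' Z m (bnd X Z k
    (k' \<cdot> under C (pr1 C (src C m) X') (src C m \<otimes> X') X))"
proof -
  let ?W = "src C m"
  let ?sm = "str T ?W X' \<cdot> \<langle>idn C ?W, m\<rangle>"
  let ?k'' = "k' \<cdot> under C (pr1 C ?W X') (?W \<otimes> X') X"
  have sk: "str T ?W X \<cdot> \<langle>pr1 C ?W X', k\<rangle>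
    = far T (under C (pr1 C ?W X') (?W \<otimes> X') X) \<cdot> str T (?W \<otimes> X') X \<cdot> \<langle>idn C (?W \<otimes> X'), k\<rangle>"
    by (rule str_tup) (use assms in \<open>auto simp: hom_iff\<close>)
  have "bnd X Z (bnd X' X m k) k'
    = mul T Z \<cdot> far T k' \<cdot> (str T ?W X \<cdot> (idn C ?W \<otimes>\<^sub>a mul T X)) \<cdot> \<langle>idn C ?W, far T k \<cdot> ?sm\<rangle>"
    using assms by (simp add: bnd_def)
  also have "\<dots> = mul T Z \<cdot> far T k' \<cdot> (mul T (?W \<otimes> X) \<cdot> far T (str T ?W X) \<cdot> str T ?W (fob T X))
      \<cdot> \<langle>idn C ?W, far T k \<cdot> ?sm\<rangle>"
    by (simp only: str_mul)
  also have "\<dots> = mul T Z \<cdot> (far T k' \<cdot> mul T (?W \<otimes> X)) \<cdot> far T (str T ?W X)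
      \<cdot> (str T ?W (fob T X) \<cdot> (idn C ?W \<otimes>\<^sub>a far T k)) \<cdot> \<langle>idn C ?W, ?sm\<rangle>"
    using assms by simp
  also have "\<dots> = mul T Z \<cdot> (mul T (fob T Z) \<cdot> far T (far T k')) \<cdot> far T (str T ?W X)
      \<cdot> (far T (idn C ?W \<otimes>\<^sub>a k) \<cdot> str T ?W (?W \<otimes> X')) \<cdot> \<langle>idn C ?W, ?sm\<rangle>"
    using mul_natural[of k' "?W \<otimes> X" "fob T Z"]
      str_natural[of "idn C ?W" ?W ?W k "?W \<otimes> X'" "fob T X"] assms
    by (simp only: hom_iff idn_simps)
  also have "\<dots> = (mul T Z \<cdot> mul T (fob T Z)) \<cdot> far T (far T k') \<cdot> far T (str T ?W X)
      \<cdot> far T (idn C ?W \<otimes>\<^sub>a k) \<cdot> (str T ?W (?W \<otimes> X') \<cdot> \<langle>idn C ?W, ?sm\<rangle>)"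
    using assms by simp
  also have "\<dots> = (mul T Z \<cdot> far T (mul T Z)) \<cdot> far T (far T k') \<cdot> far T (str T ?W X)
      \<cdot> far T (idn C ?W \<otimes>\<^sub>a k) \<cdot> (far T \<langle>pr1 C ?W X', idn C (?W \<otimes> X')\<rangle> \<cdot> ?sm)"
    using str_str[of m ?W X'] assms by (simp only: mul_mul hom_iff)
  also have "\<dots> = mul T Z \<cdot> far T (mul T Z \<cdot> far T k' \<cdot> (str T ?W X \<cdot> (\<langle>pr1 C ?W X', k\<rangle>))) \<cdot> ?sm"
  proof -
    have "far T (idn C ?W \<otimes>\<^sub>a k) \<cdot> (far T \<langle>pr1 C ?W X', idn C (?W \<otimes> X')\<rangle> \<cdot> ?sm)
      = far T ((idn C ?W \<otimes>\<^sub>a k) \<cdot> \<langle>pr1 C ?W X', idn C (?W \<otimes> X')\<rangle>) \<cdot> ?sm"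
      by (subst far_cmp_eq) (use assms in simp_all)
    then show ?thesis
      using assms by simp
  qed
  also have "\<dots> = bnd X' Z m (bnd X Z k ?k'')"
    using assms unfolding sk by (simp add: bnd_def)
  finally show ?thesis .
qed

text \<open>The two sides agree on both injections, so a continuation can be pushed into the
  branches of a case on a value.\<close>

lemma bnd_cse:
  assumes "f \<in> hom C (W \<otimes> X) (fob T Z)" "g \<in> hom C (W \<otimes> Y) (fob T Z)"
    "k \<in> hom C (W \<otimes> Z) (fob T Z')" "u \<in> hom C W (X \<oplus> Y)"
  shows "bnd Z Z' (cse W X Y f g \<cdot> \<langle>idn C W, u\<rangle>) k
    = cse W X Y (bnd Z Z' f (k \<cdot> under C (pr1 C W X) (W \<otimes> X) Z))
        (bnd Z Z' g (k \<cdot> under C (pr1 C W Y) (W \<otimes> Y) Z)) \<cdot> \<langle>idn C W, u\<rangle>"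
    (is "_ = cse W X Y ?f ?g \<cdot> _")
proof -
  let ?S = "X \<oplus> Y"
  have "bnd Z Z' (cse W X Y f g) (k \<cdot> under C (pr1 C W ?S) (W \<otimes> ?S) Z)
    = cse W X Y ?f ?g"
    by (rule distrib_eqI[of _ W X Y "fob T Z'"]) (use assms in \<open>auto simp: hom_iff\<close>)
  moreover have "bnd Z Z' (cse W X Y f g) (k \<cdot> under C (pr1 C W ?S) (W \<otimes> ?S) Z)
      \<cdot> \<langle>idn C W, u\<rangle> = bnd Z Z' (cse W X Y f g \<cdot> \<langle>idn C W, u\<rangle>) k"
    using assms by (simp add: hom_iff)
  ultimately show ?thesis
    by simp
qed

section \<open>The formulas of the semantics as nested Kleisli extensions\<close>

lemma costr_tup:
  assumes "m \<in> hom C W (fob T X)" "a \<in> hom C W Y"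
  shows "costr C T X Y \<cdot> \<langle>m, a\<rangle> = bnd X (X \<otimes> Y) m (ret T (X \<otimes> Y) \<cdot> \<langle>pr2 C W X, a \<cdot> pr1 C W X\<rangle>)"
proof -
  have "costr C T X Y \<cdot> \<langle>m, a\<rangle> = far T (swap C Y X) \<cdot> (str T Y X \<cdot> \<langle>a, m\<rangle>)"
    using assms by (simp add: costr_def swap_def hom_iff)
  also have "\<dots> = far T \<langle>pr2 C W X, a \<cdot> pr1 C W X\<rangle> \<cdot> (str T W X \<cdot> \<langle>idn C W, m\<rangle>)"
  proof -
    have "far T (swap C Y X) \<cdot> (far T (under C a W X) \<cdot> str T W X \<cdot> \<langle>idn C W, m\<rangle>)
      = far T (swap C Y X \<cdot> under C a W X) \<cdot> (str T W X \<cdot> \<langle>idn C W, m\<rangle>)"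
      by (subst far_cmp_eq) (use assms in \<open>simp_all add: hom_iff swap_def\<close>)
    then show ?thesis
      using assms str_tup[OF assms(2,1)] by (simp add: swap_def hom_iff)
  qed
  also have "\<dots> = bnd X (X \<otimes> Y) m (ret T (X \<otimes> Y) \<cdot> \<langle>pr2 C W X, a \<cdot> pr1 C W X\<rangle>)"
  proof -
    have "bnd X (X \<otimes> Y) m (ret T (X \<otimes> Y) \<cdot> \<langle>pr2 C W X, a \<cdot> pr1 C W X\<rangle>)
      = (mul T (X \<otimes> Y) \<cdot> far T (ret T (X \<otimes> Y))) \<cdot> far T \<langle>pr2 C W X, a \<cdot> pr1 C W X\<rangle> \<cdot> (str T W X \<cdot> \<langle>idn C W, m\<rangle>)"
      using assms by (simp add: bnd_def hom_iff)
    then show ?thesis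
      using assms by (simp add: mul_far_ret hom_iff)
  qed
  finally show ?thesis .
qed

lemma str_eq_bnd:
  assumes "m \<in> hom C W (fob T X)" "a \<in> hom C W Y"
  shows "str T Y X \<cdot> \<langle>a, m\<rangle> = bnd X (Y \<otimes> X) m (ret T (Y \<otimes> X) \<cdot> under C a W X)"
proof -
  have "bnd X (Y \<otimes> X) m (ret T (Y \<otimes> X) \<cdot> under C a W X)
    = (mul T (Y \<otimes> X) \<cdot> far T (ret T (Y \<otimes> X))) \<cdot> far T (under C a W X) \<cdot> str T W X \<cdot> \<langle>idn C W, m\<rangle>"
    using assms by (simp add: bnd_def hom_iff)
  then show ?thesis
    using assms str_tup[OF assms(2,1)] by (simp add: mul_far_ret hom_iff)
qed

lemma costr_simps [simp]:
  "costr C T X Y \<in> arrs C" "src C (costr C T X Y) = fob T X \<otimes> Y" "tgt C (costr C T X Y) = fob T (X \<otimes> Y)"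
  by (simp_all add: costr_def swap_def)

lemma al_simps [simp]:
  "al C T X Z \<in> arrs C" "src C (al C T X Z) = fob T (X \<leadsto> fob T Z)" "tgt C (al C T X Z) = (X \<leadsto> fob T Z)"
  by (simp_all add: al_def)

text \<open>\<open>al\<close> is the pointwise algebra structure on the exponential: a computed
  function is applied by binding it and then evaluating it at \<open>a\<close>.\<close>

lemma ev_al:
  assumes "m \<in> hom C W (fob T (X \<leadsto> fob T Z))" "a \<in> hom C W X"
  shows "ev C X (fob T Z) \<cdot> \<langle>al C T X Z \<cdot> m, a\<rangle>
    = bnd (X \<leadsto> fob T Z) Z m
        (ev C X (fob T Z) \<cdot> \<langle>pr2 C W (X \<leadsto> fob T Z), a \<cdot> pr1 C W (X \<leadsto> fob T Z)\<rangle>)"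
proof -
  let ?F = "X \<leadsto> fob T Z"
  have "ev C X (fob T Z) \<cdot> \<langle>al C T X Z \<cdot> m, a\<rangle>
    = mul T Z \<cdot> far T (ev C X (fob T Z)) \<cdot> (costr C T ?F X \<cdot> \<langle>m, a\<rangle>)"
    using assms by (simp add: al_def hom_iff)
  also have "\<dots> = bnd ?F Z m (ev C X (fob T Z) \<cdot> \<langle>pr2 C W ?F, a \<cdot> pr1 C W ?F\<rangle>)"
    using assms by (simp add: costr_tup hom_iff mul_eq_bnd)
  finally show ?thesis .
qed

text \<open>The unit law of that algebra, checked by evaluation at a generic argument.\<close>

lemma al_ret:
  assumes "f \<in> hom C W (X \<leadsto> fob T Z)"
  shows "al C T X Z \<cdot> (ret T (X \<leadsto> fob T Z) \<cdot> f) = f"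
proof (rule expo_eqI)
  show "ev C X (fob T Z) \<cdot> under C (al C T X Z \<cdot> (ret T (X \<leadsto> fob T Z) \<cdot> f)) W X
    = ev C X (fob T Z) \<cdot> under C f W X"
    using assms by (simp add: hom_iff ev_al)
qed (use assms in \<open>auto simp: hom_iff\<close>)

lemma mul_ret_cmp [simp]:
  assumes "k \<in> arrs C" "tgt C k = fob T Z"
  shows "mul T Z \<cdot> (ret T (fob T Z) \<cdot> k) = k"
proof -
  have "mul T Z \<cdot> (ret T (fob T Z) \<cdot> k) = (mul T Z \<cdot> ret T (fob T Z)) \<cdot> k"
    using assms by simp
  then show ?thesis
    using assms by (simp only: mul_ret) simp
qed

lemma mul_bnd [simp]:
  assumes "m \<in> arrs C" "k \<in> arrs C" "tgt C m = fob T X" "src C k = src C m \<otimes> X"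
    "tgt C k = fob T (fob T Z)"
  shows "mul T Z \<cdot> bnd X (fob T Z) m k = bnd X Z m (mul T Z \<cdot> k)"
proof -
  have "mul T Z \<cdot> bnd X (fob T Z) m k = bnd X Z m (bnd (fob T Z) Z k (pr2 C (src C m \<otimes> X) (fob T Z)))"
    using assms by (simp add: mul_eq_bnd)
  then show ?thesis
    using assms by (simp add: mul_eq_bnd)
qed

lemma mul_far_eq_bnd:
  assumes "m \<in> arrs C" "f \<in> arrs C" "src C f = X" "tgt C m = fob T X" "tgt C f = fob T Z"
  shows "mul T Z \<cdot> (far T f \<cdot> m) = bnd X Z m (f \<cdot> pr2 C (src C m) X)"
  using assms by (simp add: mul_eq_bnd)

text \<open>Evaluation is from left to right: \<open>m\<close> is bound outside \<open>n\<close>,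
  and \<open>n\<close> is weakened along the projection that forgets the value of
  \<open>m\<close>.\<close>

lemma pairing_eq_bnd:
  assumes "m \<in> hom C W (fob T X)" "n \<in> hom C W (fob T Z)"
  shows "mul T (X \<otimes> Z) \<cdot> far T (str T X Z) \<cdot> costr C T X (fob T Z) \<cdot> \<langle>m, n\<rangle>
    = bnd X (X \<otimes> Z) m (bnd Z (X \<otimes> Z) (n \<cdot> pr1 C W X)
        (ret T (X \<otimes> Z) \<cdot> under C (pr2 C W X) (W \<otimes> X) Z))"
proof -
  have "str T X Z \<cdot> \<langle>pr2 C W X, n \<cdot> pr1 C W X\<rangle> = bnd Z (X \<otimes> Z) (n \<cdot> pr1 C W X)
    (ret T (X \<otimes> Z) \<cdot> under C (pr2 C W X) (W \<otimes> X) Z)"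
    using str_eq_bnd[of "n \<cdot> pr1 C W X" "W \<otimes> X" Z "pr2 C W X" X] assms by (simp add: hom_iff)
  then show ?thesis
    using assms by (simp add: costr_tup hom_iff)
qed

lemma application_eq_bnd:
  assumes "m \<in> hom C W (fob T (X \<leadsto> fob T Z))" "n \<in> hom C W (fob T X)" "F = (X \<leadsto> fob T Z)"
  shows "mul T Z \<cdot> far T (mul T Z) \<cdot> far T (far T (ev C X (fob T Z))) \<cdot>
      far T (str T F X) \<cdot> costr C T F (fob T X) \<cdot> \<langle>m, n\<rangle>
    = bnd F Z m (bnd X Z (n \<cdot> pr1 C W F)
        (ev C X (fob T Z) \<cdot> under C (pr2 C W F) (W \<otimes> F) X))"
proof -
  have s: "str T F X \<cdot> \<langle>pr2 C W F, n \<cdot> pr1 C W F\<rangle> = bnd X (F \<otimes> X) (n \<cdot> pr1 C W F)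
    (ret T (F \<otimes> X) \<cdot> under C (pr2 C W F) (W \<otimes> F) X)"
    using str_eq_bnd[of "n \<cdot> pr1 C W F" "W \<otimes> F" X "pr2 C W F" F] assms by (simp add: hom_iff)
  have "mul T Z \<cdot> far T (mul T Z) \<cdot> far T (far T (ev C X (fob T Z))) \<cdot>
      far T (str T F X) \<cdot> costr C T F (fob T X) \<cdot> \<langle>m, n\<rangle>
    = bnd F Z m (mul T Z \<cdot> far T (ev C X (fob T Z)) \<cdot> (str T F X \<cdot> \<langle>pr2 C W F, n \<cdot> pr1 C W F\<rangle>))"
    using assms by (simp add: costr_tup hom_iff)
  also have "\<dots> = bnd F Z m (bnd X Z (n \<cdot> pr1 C W F)
        (ev C X (fob T Z) \<cdot> under C (pr2 C W F) (W \<otimes> F) X))"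
    unfolding s using assms by (simp add: hom_iff)
  finally show ?thesis .
qed

end


section \<open>Typing\<close>

inductive_cases typing_VarE: "typing \<Sigma> \<Gamma> (Var i) t"
inductive_cases typing_Prj1E: "typing \<Sigma> \<Gamma> (Prj1 M) t"
inductive_cases typing_Prj2E: "typing \<Sigma> \<Gamma> (Prj2 M) t"

text \<open>Each term constructor belongs to one rule and carries the type annotations that this
  rule leaves free, so inverting the second derivation meets the induction hypotheses.\<close>

lemma typing_unique: "typing \<Sigma> \<Gamma> M t \<Longrightarrow> typing \<Sigma> \<Gamma> M t' \<Longrightarrow> t' = t"
proof (induction arbitrary: t' rule: typing.induct)
  case (Case \<Gamma> M t\<^sub>1 t\<^sub>2 N\<^sub>1 t N\<^sub>2)
  from Case.prems show ?case by cases (use Case.IH in blast)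
next
  case (Lam s \<Gamma> M t)
  from Lam.prems show ?case by cases (use Lam.IH in blast)
next
  case (App \<Gamma> M s t N)
  from App.prems show ?case by cases (use App.IH in blast)
next
  case (Tup \<Gamma> M s N t)
  from Tup.prems show ?case by cases (use Tup.IH in blast)
next
  case (Prj1 \<Gamma> M s t)
  from Prj1.prems show ?case by cases (use Prj1.IH in blast)
next
  case (Prj2 \<Gamma> M s t)
  from Prj2.prems show ?case by cases (use Prj2.IH in blast)
next
  case (Inj1 \<Gamma> M s t)
  from Inj1.prems show ?case by cases (use Inj1.IH in blast)
next
  case (Inj2 \<Gamma> M t s)
  from Inj2.prems show ?case by cases (use Inj2.IH in blast)
qed (auto elim: typing.cases)

lemma tyof_eq: "typing \<Sigma> \<Gamma> M t \<Longrightarrow> tyof \<Sigma> \<Gamma> M = t"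
  unfolding tyof_def using typing_unique by blast

lemma wf_ctx_Cons [simp]: "wf_ctx \<Sigma> (t # \<Gamma>) \<longleftrightarrow> set_ty t \<subseteq> bases \<Sigma> \<and> wf_ctx \<Sigma> \<Gamma>"
  by (auto simp: wf_ctx_def)

lemma typing_wf_ctx: "typing \<Sigma> \<Gamma> M t \<Longrightarrow> wf_ctx \<Sigma> \<Gamma>"
  by (induction rule: typing.induct) auto

lemma typing_wf_ty:
  assumes "wf_signature \<Sigma>"
  shows "typing \<Sigma> \<Gamma> M t \<Longrightarrow> set_ty t \<subseteq> bases \<Sigma>"
proof (induction rule: typing.induct)
  case (Var \<Gamma> i)
  then show ?case by (auto simp: wf_ctx_def)
next
  case (Lam s \<Gamma> M t)
  then show ?case using typing_wf_ctx[OF Lam.hyps] by auto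
next
  case (Mu s t \<Gamma> M)
  then show ?case using typing_wf_ctx[OF Mu.hyps] by auto
next
  case (Cst c \<Gamma> M)
  then show ?case using assms unfolding wf_signature_def by blast
next
  case (Eff e \<Gamma> M)
  then show ?case using assms unfolding wf_signature_def by blast
qed auto


section \<open>Semantics of the fixed-point calculus\<close>

lemma sem_ctx_simps [simp]:
  "sem_ctx C T A [] = \<one>\<^bsub>C\<^esub>"
  "sem_ctx C T A (t # \<Gamma>) = sem_ctx C T A \<Gamma> \<otimes>\<^bsub>C\<^esub> sem_ty C T A t"
  by (simp_all add: sem_ctx_def)

text \<open>A locale form of \<open>lcfix_structure\<close>, so that the two structures compared in
  each half of the theorem can be interpreted side by side.\<close>

locale lcfix_model = omega_cpo_bicc C + pseudo_lifting_monad C T bot0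
  for \<Sigma> :: "('b, 'k, 'e) signature" and C :: "('o, 'm) bicc" (structure)
    and T :: "('o, 'm) smonad" and bot0 :: 'm and A :: "'b \<Rightarrow> 'o" and a :: "'k + 'e \<Rightarrow> 'm" +
  assumes const_hom: "c \<in> const_syms \<Sigma> \<Longrightarrow>
        a (Inl c) \<in> hom C (sem_ty C T A (ar \<Sigma> (Inl c))) (sem_ty C T A (car \<Sigma> (Inl c)))"
    and eff_hom: "e \<in> eff_syms \<Sigma> \<Longrightarrow>
        a (Inr e) \<in> hom C (sem_ty C T A (ar \<Sigma> (Inr e))) (fob T (sem_ty C T A (car \<Sigma> (Inr e))))"

lemma lcfix_structure_model: "lcfix_structure \<Sigma> C T bot0 A a \<longleftrightarrow> lcfix_model \<Sigma> C T bot0 A a"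
  by (auto simp: lcfix_structure_def lcfix_model_def lcfix_model_axioms_def)

context lcfix_model
begin

abbreviation "ty \<equiv> sem_ty C T A"
abbreviation "cx \<equiv> sem_ctx C T A"
abbreviation "sm \<equiv> sem \<Sigma> C T bot0 A a"
abbreviation "vp \<equiv> var_proj C T A"
abbreviation "bt \<equiv> bottom C T bot0"

section \<open>Bottom computations\<close>

lemma bottom_simps [simp]: "bt X \<in> arrs C" "src C (bt X) = \<one>" "tgt C (bt X) = fob T X"
  using bot0_hom by (auto simp: bottom_def hom_iff)

text \<open>Bottom is the image of a computation of type \<open>\<zero>\<close>. On
  \<open>W \<otimes> \<zero>\<close>, which is initial, every continuation agrees with a pure one,
  and mapping along the initial arrow gives bottom again.\<close>

lemma bnd_bottom [simp]:
  assumes "k \<in> arrs C" "src C k = W \<otimes> X" "tgt C k = fob T Z"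
  shows "bnd X Z (bt X \<cdot> bang C W) k = bt Z \<cdot> bang C W"
proof -
  have "k \<cdot> \<langle>pr1 C W \<zero>, cobang C X \<cdot> pr2 C W \<zero>\<rangle> = ret T Z \<cdot> cobang C Z \<cdot> pr2 C W \<zero>"
    by (rule over_zero_eq[OF pr2_hom]) (use assms in \<open>auto simp: hom_iff\<close>)
  then have "bnd X Z (far T (cobang C X) \<cdot> (bot0 \<cdot> bang C W)) k
    = bnd \<zero> Z (bot0 \<cdot> bang C W) (ret T Z \<cdot> cobang C Z \<cdot> pr2 C W \<zero>)"
    using assms bot0_hom by (simp add: hom_iff del: cmp_cobang)
  also have "\<dots> = far T (cobang C Z) \<cdot> bot0 \<cdot> bang C W"
    using bot0_hom by (subst far_eq_bnd) (simp_all add: hom_iff)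
  finally show ?thesis
    using bot0_hom by (simp add: bottom_def hom_iff)
qed

lemma far_bottom [simp]:
  assumes "f \<in> arrs C" "src C f = X"
  shows "far T f \<cdot> (bt X \<cdot> bang C W) = bt (tgt C f) \<cdot> bang C W"
  using assms by (subst far_eq_bnd) simp_all

lemma al_bottom: "al C T X Z \<cdot> (bt (X \<leadsto> fob T Z) \<cdot> bang C W) = curry C W X (bt Z \<cdot> bang C (W \<otimes> X))"
  by (rule expo_eqI) (auto simp: hom_iff ev_al)

text \<open>The bottom is assumed least only at stage \<open>\<one>\<close>. For a stage \<open>W\<close>, apply this at the exponential
  \<open>W \<leadsto> fob T Z\<close>, which is a \<open>T\<close>-algebra.\<close>

lemma bottom_le:
  assumes g: "g \<in> hom C W (fob T Z)"
  shows "bt Z \<cdot> bang C W \<sqsubseteq> g"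
proof -
  let ?F = "W \<leadsto> fob T Z"
  let ?c = "curry C \<one> W (g \<cdot> pr2 C \<one> W)"
  have c: "?c \<in> hom C \<one> ?F"
    using g by (auto simp: hom_iff)
  have 1: "bt ?F \<sqsubseteq> ret T ?F \<cdot> ?c"
    by (rule bottom_least) (use c in \<open>auto simp: hom_iff\<close>)
  have "al C T W Z \<cdot> bt ?F \<sqsubseteq> al C T W Z \<cdot> (ret T ?F \<cdot> ?c)"
    by (rule cmp_mono[OF le_refl 1]) (use c in \<open>auto simp: hom_iff\<close>)
  then have 2: "al C T W Z \<cdot> bt ?F \<sqsubseteq> ?c"
    using al_ret[OF c] by simp
  have "(al C T W Z \<cdot> bt ?F) \<cdot> bang C W \<sqsubseteq> ?c \<cdot> bang C W"
    by (rule cmp_mono[OF 2 le_refl]) (use c in \<open>auto simp: hom_iff\<close>)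
  then have "\<langle>(al C T W Z \<cdot> bt ?F) \<cdot> bang C W, idn C W\<rangle> \<sqsubseteq> \<langle>?c \<cdot> bang C W, idn C W\<rangle>"
    by (rule tup_mono[OF _ le_refl]) (use c g in \<open>auto simp: hom_iff\<close>)
  then have "ev C W (fob T Z) \<cdot> \<langle>(al C T W Z \<cdot> bt ?F) \<cdot> bang C W, idn C W\<rangle>
      \<sqsubseteq> ev C W (fob T Z) \<cdot> \<langle>?c \<cdot> bang C W, idn C W\<rangle>"
    by (rule cmp_mono[OF le_refl, rotated]) (use c g in \<open>auto simp: hom_iff\<close>)
  then show ?thesis
    using g by (simp add: hom_iff al_bottom)
qed

text \<open>No continuity of \<open>far T\<close> is at hand. It suffices that the computation
  occurs only as the second component of a tuple in front of the arrow \<open>g\<close>, which does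
  not depend on the chain.\<close>

lemma bnd_lub:
  assumes F: "chain_in W (fob T X) F" "lub_of W (fob T X) F f" and k: "k \<in> hom C (W \<otimes> X) (fob T Z)"
  shows "lub_of W (fob T Z) (\<lambda>n. bnd X Z (F n) k) (bnd X Z f k)"
proof -
  have src: "src C (F n) = W" "src C f = W" for n
    using F by (auto simp: omega_chain_def is_omega_lub_def hom_iff)
  define g where "g = mul T Z \<cdot> far T k \<cdot> str T W X"
  have g: "g \<in> hom C (W \<otimes> fob T X) (fob T Z)"
    using k by (auto simp: g_def hom_iff)
  have "bnd X Z m k = g \<cdot> \<langle>idn C W, m\<rangle>" if "m \<in> hom C W (fob T X)" for m
    using that k by (simp add: bnd_def g_def hom_iff)
  then have "bnd X Z (F n) k = g \<cdot> \<langle>idn C W, F n\<rangle>" "bnd X Z f k = g \<cdot> \<langle>idn C W, f\<rangle>" for n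
    using F by (auto simp: omega_chain_def is_omega_lub_def)
  moreover note tup_lub[OF const_chain lub_const F, of "idn C W"]
  ultimately show ?thesis
    using cmp_lub[OF _ _ g] by (simp add: idn_hom)
qed

lemma ev_tup_lub:
  assumes F: "chain_in W (X \<leadsto> Z) F" "lub_of W (X \<leadsto> Z) F f" and h: "h \<in> hom C V W" and u: "u \<in> hom C V X"
  shows "chain_in V Z (\<lambda>n. ev C X Z \<cdot> \<langle>F n \<cdot> h, u\<rangle>)"
    "lub_of V Z (\<lambda>n. ev C X Z \<cdot> \<langle>F n \<cdot> h, u\<rangle>) (ev C X Z \<cdot> \<langle>f \<cdot> h, u\<rangle>)"
  using cmp_lub[OF _ _ ev_hom] cmp_chain[OF _ ev_hom]
    tup_lub[OF precmp_chain[OF F(1) h] precmp_lub[OF F h] const_chain[OF u] lub_const[OF u]] by blast+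

text \<open>Kleene approximations at the function type itself, with parameters in \<open>G\<close>.
  The start is the image under \<open>al\<close> of the bottom from which \<open>fixp\<close>
  iterates, by \<open>al_bottom\<close>.\<close>

fun mu_seq :: "'o \<Rightarrow> 'o \<Rightarrow> 'o \<Rightarrow> 'm \<Rightarrow> nat \<Rightarrow> 'm" where
  "mu_seq G X Z \<phi> 0 = curry C G X (bt Z \<cdot> bang C (G \<otimes> X))"
| "mu_seq G X Z \<phi> (Suc n) = curry C (G \<otimes> (X \<leadsto> fob T Z)) X \<phi> \<cdot> \<langle>idn C G, mu_seq G X Z \<phi> n\<rangle>"

definition mu_fix :: "'o \<Rightarrow> 'o \<Rightarrow> 'o \<Rightarrow> 'm \<Rightarrow> 'm" where
  "mu_fix G X Z \<phi> = omega_lub (hom C G (X \<leadsto> fob T Z)) (le C) (mu_seq G X Z \<phi>)"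

text \<open>The fixed point is computed on \<open>fob T (X \<leadsto> fob T Z)\<close>; the algebra map \<open>al\<close> carries its
  approximations to those of \<open>mu_fix\<close>.\<close>

lemma mu_fix:
  assumes \<phi>: "\<phi> \<in> hom C ((G \<otimes> (X \<leadsto> fob T Z)) \<otimes> X) (fob T Z)"
  shows mu_seq_chain: "chain_in G (X \<leadsto> fob T Z) (mu_seq G X Z \<phi>)"
    and mu_fix_lub: "lub_of G (X \<leadsto> fob T Z) (mu_seq G X Z \<phi>) (mu_fix G X Z \<phi>)"
    and al_fixp: "al C T X Z \<cdot> fixp C T bot0 G (X \<leadsto> fob T Z)
      ((ret T (X \<leadsto> fob T Z) \<cdot> curry C (G \<otimes> (X \<leadsto> fob T Z)) X \<phi>) \<cdot> (idn C G \<otimes>\<^sub>a al C T X Z))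
      = mu_fix G X Z \<phi>"
proof -
  let ?F = "X \<leadsto> fob T Z"
  define c where "c = curry C (G \<otimes> ?F) X \<phi>"
  have c: "c \<in> hom C (G \<otimes> ?F) ?F"
    using \<phi> by (auto simp: c_def hom_iff)
  define f where "f = (ret T ?F \<cdot> c) \<cdot> (idn C G \<otimes>\<^sub>a al C T X Z)"
  have f: "f \<in> hom C (G \<otimes> fob T ?F) (fob T ?F)"
    using c by (auto simp: f_def hom_iff)
  \<comment> \<open>These are the second components of the iterates in \<open>fixp\<close>; their
    first component stays \<open>idn C G\<close>, as \<open>iter\<close> below shows.\<close>
  define m where "m n = ((\<lambda>x. f \<cdot> \<langle>idn C G, x\<rangle>) ^^ n) (bt ?F \<cdot> bang C G)" for n
  have m_Suc: "m (Suc n) = f \<cdot> \<langle>idn C G, m n\<rangle>" for n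
    by (simp add: m_def)
  have m: "m n \<in> hom C G (fob T ?F)" for n
  proof (induction n)
    case 0
    show ?case by (auto simp: m_def hom_iff)
  next
    case (Suc n)
    then show ?case using f by (auto simp: m_Suc hom_iff)
  qed
  have le: "m n \<sqsubseteq> m (Suc n)" for n
  proof (induction n)
    case 0
    show ?case
      using bottom_le[OF m[of "Suc 0"]] by (simp add: m_def)
  next
    case (Suc n)
    have "\<langle>idn C G, m n\<rangle> \<sqsubseteq> \<langle>idn C G, m (Suc n)\<rangle>"
      by (rule tup_mono[OF _ Suc]) (use m in \<open>auto simp: hom_iff\<close>)
    then have "f \<cdot> \<langle>idn C G, m n\<rangle> \<sqsubseteq> f \<cdot> \<langle>idn C G, m (Suc n)\<rangle>"
      by (rule cmp_mono[OF le_refl, rotated]) (use m f in \<open>auto simp: hom_iff\<close>)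
    then show ?case
      by (simp only: m_Suc)
  qed
  have chain: "chain_in G (fob T ?F) m"
    using m le by (auto simp: omega_chain_def)
  then obtain s where s: "lub_of G (fob T ?F) m s"
    using lub_exists by blast
  \<comment> \<open>\<open>f\<close> ends in \<open>ret\<close>, which \<open>al\<close> cancels by
    \<open>al_ret\<close>, so under \<open>al\<close> one step of \<open>f\<close> becomes one step
    of \<open>c\<close>.\<close>
  have seq: "mu_seq G X Z \<phi> n = al C T X Z \<cdot> m n" for n
  proof (induction n)
    case 0
    show ?case by (simp add: m_def al_bottom)
  next
    case (Suc n)
    have "al C T X Z \<cdot> m (Suc n) = al C T X Z \<cdot> (ret T ?F \<cdot> (c \<cdot> \<langle>idn C G, al C T X Z \<cdot> m n\<rangle>))"
      using m[of n] c by (simp add: m_Suc f_def hom_iff)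
    also have "\<dots> = c \<cdot> \<langle>idn C G, al C T X Z \<cdot> m n\<rangle>"
      by (rule al_ret) (use m[of n] c in \<open>auto simp: hom_iff\<close>)
    finally show ?case
      using Suc by (simp add: c_def)
  qed
  have al: "al C T X Z \<in> hom C (fob T ?F) ?F"
    by (auto simp: hom_iff)
  show "chain_in G ?F (mu_seq G X Z \<phi>)"
    using cmp_chain[OF chain al] by (simp flip: seq)
  have lub: "lub_of G ?F (mu_seq G X Z \<phi>) (al C T X Z \<cdot> s)"
    using cmp_lub[OF chain s al] by (simp add: seq is_omega_lub_def)
  then have eq: "mu_fix G X Z \<phi> = al C T X Z \<cdot> s"
    unfolding mu_fix_def by (rule omega_lub_eqI)
  with lub show "lub_of G ?F (mu_seq G X Z \<phi>) (mu_fix G X Z \<phi>)"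
    by simp
  have iter: "((\<lambda>g. \<langle>pr1 C G (fob T ?F), f\<rangle> \<cdot> g) ^^ n) \<langle>idn C G, bt ?F \<cdot> bang C G\<rangle> = \<langle>idn C G, m n\<rangle>" for n
  proof (induction n)
    case 0
    show ?case by (simp add: m_def)
  next
    case (Suc n)
    then show ?case using f m[of n] by (simp add: m_Suc hom_iff)
  qed
  have "lub_of G (G \<otimes> fob T ?F) (\<lambda>n. \<langle>idn C G, m n\<rangle>) \<langle>idn C G, s\<rangle>"
    by (rule tup_lub(2)[OF const_chain lub_const chain s]) (auto simp: hom_iff)
  from omega_lub_eqI[OF this] have "fixp C T bot0 G ?F f = s"
    unfolding fixp_def iter using s by (simp add: is_omega_lub_def hom_iff)
  then show "al C T X Z \<cdot> fixp C T bot0 G ?F ((ret T ?F \<cdot> curry C (G \<otimes> ?F) X \<phi>) \<cdot> (idn C G \<otimes>\<^sub>a al C T X Z))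
      = mu_fix G X Z \<phi>"
    by (simp add: eq f_def c_def)
qed

lemma mu_seq_hom:
  "\<phi> \<in> hom C ((G \<otimes> (X \<leadsto> fob T Z)) \<otimes> X) (fob T Z) \<Longrightarrow> mu_seq G X Z \<phi> n \<in> hom C G (X \<leadsto> fob T Z)"
  using mu_seq_chain by (simp add: omega_chain_def)

lemma mu_fix_hom:
  "\<phi> \<in> hom C ((G \<otimes> (X \<leadsto> fob T Z)) \<otimes> X) (fob T Z) \<Longrightarrow> mu_fix G X Z \<phi> \<in> hom C G (X \<leadsto> fob T Z)"
  using mu_fix_lub by (simp add: is_omega_lub_def)

text \<open>Pre- and postcomposition preserve the supremum, and suprema are unique.\<close>

lemma mu_fix_eqI:
  assumes "\<phi> \<in> hom C ((G \<otimes> (X \<leadsto> fob T Z)) \<otimes> X) (fob T Z)"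
    "lub_of W V (\<lambda>n. f \<cdot> mu_seq G X Z \<phi> n \<cdot> h) g"
    "f \<in> hom C (X \<leadsto> fob T Z) V" "h \<in> hom C W G"
  shows "f \<cdot> mu_fix G X Z \<phi> \<cdot> h = g"
proof -
  have "lub_of W V (\<lambda>n. f \<cdot> mu_seq G X Z \<phi> n \<cdot> h) (f \<cdot> mu_fix G X Z \<phi> \<cdot> h)"
    using cmp_lub[OF precmp_chain[OF mu_seq_chain assms(4)] precmp_lub[OF mu_seq_chain mu_fix_lub assms(4)] assms(3)]
      assms(1) by blast
  then show ?thesis
    using assms(2) by (rule lub_unique)
qed

text \<open>Recursion is natural in its parameters: the approximations are so by induction, and
  precomposition preserves their supremum.\<close>

lemma mu_fix_cmp:
  assumes \<phi>: "\<phi> \<in> hom C ((G \<otimes> (X \<leadsto> fob T Z)) \<otimes> X) (fob T Z)" and h: "h \<in> hom C W G"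
    and F: "F = (X \<leadsto> fob T Z)"
    and \<psi>: "\<psi> = \<phi> \<cdot> \<langle>\<langle>h \<cdot> pr1 C W F \<cdot> pr1 C (W \<otimes> F) X, pr2 C W F \<cdot> pr1 C (W \<otimes> F) X\<rangle>, pr2 C (W \<otimes> F) X\<rangle>"
  shows "mu_fix G X Z \<phi> \<cdot> h = mu_fix W X Z \<psi>"
proof -
  have \<psi>_hom: "\<psi> \<in> hom C ((W \<otimes> (X \<leadsto> fob T Z)) \<otimes> X) (fob T Z)"
    using \<phi> h by (auto simp: F \<psi> hom_iff)
  have seq: "mu_seq G X Z \<phi> n \<cdot> h = mu_seq W X Z \<psi> n" for n
  proof (induction n)
    case 0
    show ?case using h by (simp add: hom_iff)
  next
    case (Suc n)
    have "mu_seq G X Z \<phi> (Suc n) \<cdot> h = curry C (G \<otimes> F) X \<phi> \<cdot> \<langle>h, mu_seq G X Z \<phi> n \<cdot> h\<rangle>"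
      using mu_seq_hom[OF \<phi>, of n] \<phi> h F by (simp add: hom_iff del: curry_cmp)
    also have "\<dots> = mu_seq W X Z \<psi> (Suc n)"
      using mu_seq_hom[OF \<psi>_hom, of n] \<phi> h F by (simp add: Suc hom_iff \<psi>)
    finally show ?case .
  qed
  have "lub_of W F (mu_seq W X Z \<psi>) (mu_fix G X Z \<phi> \<cdot> h)"
    using precmp_lub[OF mu_seq_chain[OF \<phi>] mu_fix_lub[OF \<phi>] h] by (simp add: seq F)
  then show ?thesis
    using mu_fix_lub[OF \<psi>_hom] lub_unique F by blast
qed

section \<open>Interpretation of terms by Kleisli extensions\<close>

lemma vp_hom: "i < length \<Gamma> \<Longrightarrow> vp \<Gamma> i \<in> hom C (cx \<Gamma>) (ty (\<Gamma> ! i))"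
proof (induction \<Gamma> arbitrary: i)
  case (Cons t \<Gamma>)
  then show ?case by (cases i) (auto simp: hom_iff)
qed simp

lemma sm_Mu:
  assumes "sm (s # TFun s t # \<Gamma>) M \<in> hom C ((cx \<Gamma> \<otimes> (ty s \<leadsto> fob T (ty t))) \<otimes> ty s) (fob T (ty t))"
  shows "sm \<Gamma> (Mu s t M) = ret T (ty s \<leadsto> fob T (ty t)) \<cdot> mu_fix (cx \<Gamma>) (ty s) (ty t) (sm (s # TFun s t # \<Gamma>) M)"
  using al_fixp[OF assms] by (simp only: Let_def sem.simps)

lemma sm_hom: "typing \<Sigma> \<Gamma> M t \<Longrightarrow> sm \<Gamma> M \<in> hom C (cx \<Gamma>) (fob T (ty t))"
proof (induction rule: typing.induct)
  case (Var \<Gamma> i)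
  then show ?case using vp_hom[of i \<Gamma>] by (auto simp: hom_iff)
next
  case (Cst c \<Gamma> M)
  then show ?case using const_hom[of c] by (auto simp: hom_iff)
next
  case (Eff e \<Gamma> M)
  then show ?case using eff_hom[of e] by (auto simp: hom_iff)
next
  case (Mu s t \<Gamma> M)
  then have M: "sm (s # TFun s t # \<Gamma>) M \<in> hom C ((cx \<Gamma> \<otimes> (ty s \<leadsto> fob T (ty t))) \<otimes> ty s) (fob T (ty t))"
    by simp
  from mu_fix_hom[OF this] show ?case
    unfolding sm_Mu[OF M] by (auto simp: hom_iff)
qed (auto simp: hom_iff tyof_eq Let_def)

lemma sm_Tup:
  assumes "typing \<Sigma> \<Gamma> M s" "typing \<Sigma> \<Gamma> N t"
  shows "sm \<Gamma> (Tup M N) = bnd (ty s) (ty s \<otimes> ty t) (sm \<Gamma> M) (bnd (ty t) (ty s \<otimes> ty t)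
    (sm \<Gamma> N \<cdot> pr1 C (cx \<Gamma>) (ty s))
    (ret T (ty s \<otimes> ty t) \<cdot> under C (pr2 C (cx \<Gamma>) (ty s)) (cx \<Gamma> \<otimes> ty s) (ty t)))"
  using pairing_eq_bnd[OF sm_hom[OF assms(1)] sm_hom[OF assms(2)]] assms by (simp add: tyof_eq Let_def)

lemma sm_App:
  assumes "typing \<Sigma> \<Gamma> M (TFun s t)" "typing \<Sigma> \<Gamma> N s" "F = (ty s \<leadsto> fob T (ty t))"
  shows "sm \<Gamma> (App M N) = bnd F (ty t) (sm \<Gamma> M) (bnd (ty s) (ty t) (sm \<Gamma> N \<cdot> pr1 C (cx \<Gamma>) F)
    (ev C (ty s) (fob T (ty t)) \<cdot> under C (pr2 C (cx \<Gamma>) F) (cx \<Gamma> \<otimes> F) (ty s)))"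
  using application_eq_bnd[of "sm \<Gamma> M" "cx \<Gamma>" "ty s" "ty t" "sm \<Gamma> N" F]
    sm_hom[OF assms(1)] sm_hom[OF assms(2)] assms
  by (simp add: tyof_eq Let_def del: cmp_cmp cmp_simps)

lemma sm_Case:
  assumes "typing \<Sigma> \<Gamma> M (TSum t1 t2)" "typing \<Sigma> (t1 # \<Gamma>) N1 t"
  shows "sm \<Gamma> (Case M t1 N1 t2 N2) = bnd (ty t1 \<oplus> ty t2) (ty t) (sm \<Gamma> M)
    (cse (cx \<Gamma>) (ty t1) (ty t2) (sm (t1 # \<Gamma>) N1) (sm (t2 # \<Gamma>) N2))"
  using sm_hom[OF assms(1)] assms by (simp add: tyof_eq Let_def bnd_def cse_def hom_iff del: far_cmp_eq)

lemma sm_Lam: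
  assumes "typing \<Sigma> (s # \<Gamma>) M t"
  shows "sm \<Gamma> (Lam s M) = ret T (ty s \<leadsto> fob T (ty t)) \<cdot> curry C (cx \<Gamma>) (ty s) (sm (s # \<Gamma>) M)"
  using assms by (simp add: tyof_eq)

text \<open>The administrative redexes of the translation have this form, and each reduces to a
  single binding.\<close>

lemma sm_App_Lam:
  assumes "typing \<Sigma> (s # \<Gamma>) M t" "typing \<Sigma> \<Gamma> N s"
  shows "sm \<Gamma> (App (Lam s M) N) = bnd (ty s) (ty t) (sm \<Gamma> N) (sm (s # \<Gamma>) M)"
  using sm_App[OF typing.Lam[OF assms(1)] assms(2) refl] sm_Lam[OF assms(1)]
    sm_hom[OF assms(1)] sm_hom[OF assms(2)] by (simp add: hom_iff)

end


section \<open>Substitution\<close>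

text \<open>The translation only substitutes variables and projections of variables, for which
  weakening is immediate; hence no separate renaming lemma is needed.\<close>

definition simple_trm :: "('b, 'k, 'e) trm \<Rightarrow> bool" where
  "simple_trm N \<longleftrightarrow> (\<exists>i. N = Var i \<or> N = Prj1 (Var i) \<or> N = Prj2 (Var i))"

lemma lift_sub_simps [simp]:
  "lift_sub \<sigma> 0 = Var 0" "lift_sub \<sigma> (Suc i) = ren Suc (\<sigma> i)"
  by (simp_all add: lift_sub_def)

lemma lift_sub_Var: "lift_sub (Var \<circ> r) = Var \<circ> lift_ren r"
  by (rule ext) (simp add: lift_sub_def lift_ren_def split: nat.split)

lemma ren_eq_sub: "ren r M = sub (Var \<circ> r) M"
  by (induction M arbitrary: r) (simp_all add: lift_sub_Var)

context lcfix_model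
begin

text \<open>\<open>\<theta>\<close> is the substitution as an arrow of contexts. The substituted
  terms must denote values (\<open>ret\<close> after an arrow), since precomposition with an arrow
  could not express their effects.\<close>

definition subst_ok ::
  "'b ctx \<Rightarrow> (nat \<Rightarrow> ('b, 'k, 'e) trm) \<Rightarrow> 'b ctx \<Rightarrow> 'm \<Rightarrow> bool" where
  "subst_ok \<Delta> \<sigma> \<Gamma> \<theta> \<longleftrightarrow> wf_ctx \<Sigma> \<Delta> \<and> \<theta> \<in> hom C (cx \<Delta>) (cx \<Gamma>) \<and>
    (\<forall>i<length \<Gamma>. simple_trm (\<sigma> i) \<and> typing \<Sigma> \<Delta> (\<sigma> i) (\<Gamma> ! i) \<and>
      sm \<Delta> (\<sigma> i) = ret T (ty (\<Gamma> ! i)) \<cdot> vp \<Gamma> i \<cdot> \<theta>)"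

lemma simple_weaken:
  assumes "simple_trm N" "typing \<Sigma> \<Delta> N s" "set_ty t \<subseteq> bases \<Sigma>"
  shows "simple_trm (ren Suc N)" "typing \<Sigma> (t # \<Delta>) (ren Suc N) s"
    "sm (t # \<Delta>) (ren Suc N) = sm \<Delta> N \<cdot> pr1 C (cx \<Delta>) (ty t)"
proof -
  show "simple_trm (ren Suc N)"
    using assms(1) by (auto simp: simple_trm_def)
  have V: "typing \<Sigma> (t # \<Delta>) (Var (Suc i)) r \<and>
      sm (t # \<Delta>) (Var (Suc i)) = sm \<Delta> (Var i) \<cdot> pr1 C (cx \<Delta>) (ty t)"
    if "typing \<Sigma> \<Delta> (Var i) r" for i r
    using that assms(3) typing.Var[of \<Sigma> "t # \<Delta>" "Suc i"] vp_hom[of i \<Delta>]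
    by (auto elim!: typing_VarE simp: hom_iff)
  show "typing \<Sigma> (t # \<Delta>) (ren Suc N) s"
    using assms(1,2) V[THEN conjunct1]
    by (auto simp: simple_trm_def elim!: typing_Prj1E typing_Prj2E) (blast intro: typing.Prj1 typing.Prj2)+
  show "sm (t # \<Delta>) (ren Suc N) = sm \<Delta> N \<cdot> pr1 C (cx \<Delta>) (ty t)"
    using assms(1,2) V sm_hom
    by (auto simp: simple_trm_def hom_iff tyof_eq tyof_eq[OF conjunct1[OF V]] simp del: sem.simps(1)
        elim!: typing_Prj1E typing_Prj2E)
qed

lemma subst_ok_lift:
  assumes "subst_ok \<Delta> \<sigma> \<Gamma> \<theta>" "set_ty t \<subseteq> bases \<Sigma>"
  shows "subst_ok (t # \<Delta>) (lift_sub \<sigma>) (t # \<Gamma>) (under C \<theta> (cx \<Delta>) (ty t))"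
  unfolding subst_ok_def
proof (intro conjI allI impI)
  show "wf_ctx \<Sigma> (t # \<Delta>)"
    "under C \<theta> (cx \<Delta>) (ty t) \<in> hom C (cx (t # \<Delta>)) (cx (t # \<Gamma>))"
    using assms by (auto simp: subst_ok_def hom_iff)
  fix i
  assume i: "i < length (t # \<Gamma>)"
  have *: "simple_trm (lift_sub \<sigma> i) \<and> typing \<Sigma> (t # \<Delta>) (lift_sub \<sigma> i) ((t # \<Gamma>) ! i) \<and>
    sm (t # \<Delta>) (lift_sub \<sigma> i) = ret T (ty ((t # \<Gamma>) ! i)) \<cdot> vp (t # \<Gamma>) i \<cdot>
      under C \<theta> (cx \<Delta>) (ty t)"
  proof (cases i)
    case 0
    then show ?thesis
      using assms typing.Var[of \<Sigma> "t # \<Delta>" 0] by (auto simp: simple_trm_def subst_ok_def hom_iff)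
  next
    case (Suc j)
    with i assms(1) have "simple_trm (\<sigma> j)" "typing \<Sigma> \<Delta> (\<sigma> j) (\<Gamma> ! j)"
      "sm \<Delta> (\<sigma> j) = ret T (ty (\<Gamma> ! j)) \<cdot> vp \<Gamma> j \<cdot> \<theta>" "\<theta> \<in> hom C (cx \<Delta>) (cx \<Gamma>)"
      by (auto simp: subst_ok_def)
    then show ?thesis
      using simple_weaken[of "\<sigma> j" \<Delta> "\<Gamma> ! j" t] vp_hom[of j \<Gamma>] Suc i assms(2) by (simp add: hom_iff)
  qed
  then show "simple_trm (lift_sub \<sigma> i)" "typing \<Sigma> (t # \<Delta>) (lift_sub \<sigma> i) ((t # \<Gamma>) ! i)"
    "sm (t # \<Delta>) (lift_sub \<sigma> i) = ret T (ty ((t # \<Gamma>) ! i)) \<cdot> vp (t # \<Gamma>) i \<cdot>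
      under C \<theta> (cx \<Delta>) (ty t)"
    by auto
qed

text \<open>Every clause of the semantics is natural in the context, and under a binder
  \<open>\<theta>\<close> is extended by \<open>subst_ok_lift\<close>. Typing is proved together
  with the meaning because the meaning depends on \<open>tyof\<close>.\<close>

lemma sub_sem:
  assumes "typing \<Sigma> \<Gamma> M t" "subst_ok \<Delta> \<sigma> \<Gamma> \<theta>"
  shows "typing \<Sigma> \<Delta> (sub \<sigma> M) t \<and> sm \<Delta> (sub \<sigma> M) = sm \<Gamma> M \<cdot> \<theta>"
  using assms
proof (induction arbitrary: \<Delta> \<sigma> \<theta> rule: typing.induct)
  case (Var \<Gamma> i)
  then show ?case using vp_hom[of i \<Gamma>] by (auto simp: subst_ok_def hom_iff)
next
  case (Cst c \<Gamma> M)
  have "\<theta> \<in> hom C (cx \<Delta>) (cx \<Gamma>)" using Cst.prems by (simp add: subst_ok_def)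
  then show ?case
    using Cst.IH[OF Cst.prems] Cst.hyps const_hom[of c] sm_hom[OF Cst.hyps(2)]
    by (simp add: hom_iff typing.Cst)
next
  case (Eff e \<Gamma> M)
  have "\<theta> \<in> hom C (cx \<Delta>) (cx \<Gamma>)" using Eff.prems by (simp add: subst_ok_def)
  then show ?case
    using Eff.IH[OF Eff.prems] Eff.hyps eff_hom[of e] sm_hom[OF Eff.hyps(2)]
    by (simp add: hom_iff typing.Eff)
next
  case (Star \<Gamma>)
  then show ?case by (simp add: subst_ok_def hom_iff typing.Star)
next
  case (Tup \<Gamma> M s N t)
  have \<theta>: "\<theta> \<in> hom C (cx \<Delta>) (cx \<Gamma>)" using Tup.prems by (simp add: subst_ok_def)
  note M = Tup.IH(1)[OF Tup.prems] and N = Tup.IH(2)[OF Tup.prems]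
  have "sm \<Delta> (sub \<sigma> (Tup M N)) = sm \<Gamma> (Tup M N) \<cdot> \<theta>"
    using M N \<theta> sm_hom[OF Tup.hyps(1)] sm_hom[OF Tup.hyps(2)]
    by (simp add: sm_Tup[OF Tup.hyps] sm_Tup[OF conjunct1[OF M] conjunct1[OF N]] hom_iff
        del: sem.simps)
  then show ?case using M N by (simp add: typing.Tup del: sem.simps)
next
  case (Prj1 \<Gamma> M s t)
  have "\<theta> \<in> hom C (cx \<Delta>) (cx \<Gamma>)" using Prj1.prems by (simp add: subst_ok_def)
  then show ?case
    using Prj1.IH[OF Prj1.prems] sm_hom[OF Prj1.hyps] Prj1.hyps
    by (auto simp: hom_iff tyof_eq intro: typing.Prj1)
next
  case (Prj2 \<Gamma> M s t)
  have "\<theta> \<in> hom C (cx \<Delta>) (cx \<Gamma>)" using Prj2.prems by (simp add: subst_ok_def)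
  then show ?case
    using Prj2.IH[OF Prj2.prems] sm_hom[OF Prj2.hyps] Prj2.hyps
    by (auto simp: hom_iff tyof_eq intro: typing.Prj2)
next
  case (Abort \<Gamma> M t)
  have "\<theta> \<in> hom C (cx \<Delta>) (cx \<Gamma>)" using Abort.prems by (simp add: subst_ok_def)
  then show ?case
    using Abort.IH[OF Abort.prems] sm_hom[OF Abort.hyps(1)] Abort.hyps
    by (simp add: hom_iff typing.Abort)
next
  case (Inj1 \<Gamma> M s t)
  have "\<theta> \<in> hom C (cx \<Delta>) (cx \<Gamma>)" using Inj1.prems by (simp add: subst_ok_def)
  then show ?case
    using Inj1.IH[OF Inj1.prems] sm_hom[OF Inj1.hyps(1)] Inj1.hyps
    by (auto simp: hom_iff typing.Inj1 tyof_eq)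
next
  case (Inj2 \<Gamma> M t s)
  have "\<theta> \<in> hom C (cx \<Delta>) (cx \<Gamma>)" using Inj2.prems by (simp add: subst_ok_def)
  then show ?case
    using Inj2.IH[OF Inj2.prems] sm_hom[OF Inj2.hyps(1)] Inj2.hyps
    by (auto simp: hom_iff typing.Inj2 tyof_eq)
next
  case (Case \<Gamma> M t\<^sub>1 t\<^sub>2 N\<^sub>1 t N\<^sub>2)
  have \<theta>: "\<theta> \<in> hom C (cx \<Delta>) (cx \<Gamma>)" using Case.prems by (simp add: subst_ok_def)
  have wf: "set_ty t\<^sub>1 \<subseteq> bases \<Sigma>" "set_ty t\<^sub>2 \<subseteq> bases \<Sigma>"
    using typing_wf_ctx[OF Case.hyps(2)] typing_wf_ctx[OF Case.hyps(3)] by auto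
  note M = Case.IH(1)[OF Case.prems]
  note N1 = Case.IH(2)[OF subst_ok_lift[OF Case.prems wf(1)]]
  note N2 = Case.IH(3)[OF subst_ok_lift[OF Case.prems wf(2)]]
  have "sm \<Delta> (sub \<sigma> (Case M t\<^sub>1 N\<^sub>1 t\<^sub>2 N\<^sub>2)) = sm \<Gamma> (Case M t\<^sub>1 N\<^sub>1 t\<^sub>2 N\<^sub>2) \<cdot> \<theta>"
    using M N1 N2 \<theta> sm_hom[OF Case.hyps(1)] sm_hom[OF Case.hyps(2)] sm_hom[OF Case.hyps(3)]
    by (simp add: sm_Case[OF Case.hyps(1,2)] sm_Case[OF conjunct1[OF M] conjunct1[OF N1]] hom_iff cse_times
        del: sem.simps)
  then show ?case using M N1 N2 by (simp add: typing.Case del: sem.simps)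
next
  case (Lam s \<Gamma> M t)
  have \<theta>: "\<theta> \<in> hom C (cx \<Delta>) (cx \<Gamma>)" using Lam.prems by (simp add: subst_ok_def)
  have wf: "set_ty s \<subseteq> bases \<Sigma>"
    using typing_wf_ctx[OF Lam.hyps] by auto
  note M = Lam.IH[OF subst_ok_lift[OF Lam.prems wf]]
  have "sm \<Delta> (sub \<sigma> (Lam s M)) = sm \<Gamma> (Lam s M) \<cdot> \<theta>"
    using M \<theta> sm_hom[OF Lam.hyps]
    by (simp add: sm_Lam[OF Lam.hyps] sm_Lam[OF conjunct1[OF M]] hom_iff del: sem.simps)
  then show ?case using M by (simp add: typing.Lam del: sem.simps)
next
  case (App \<Gamma> M s t N)
  have \<theta>: "\<theta> \<in> hom C (cx \<Delta>) (cx \<Gamma>)" using App.prems by (simp add: subst_ok_def)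
  note M = App.IH(1)[OF App.prems] and N = App.IH(2)[OF App.prems]
  have "sm \<Delta> (sub \<sigma> (App M N)) = sm \<Gamma> (App M N) \<cdot> \<theta>"
    using M N \<theta> sm_hom[OF App.hyps(1)] sm_hom[OF App.hyps(2)]
    by (simp add: sm_App[OF App.hyps refl] sm_App[OF conjunct1[OF M] conjunct1[OF N] refl] hom_iff
        del: sem.simps)
  then show ?case using M N by (simp add: typing.App[of _ _ _ s] del: sem.simps)
next
  case (Mu s t \<Gamma> M)
  have \<theta>: "\<theta> \<in> hom C (cx \<Delta>) (cx \<Gamma>)" using Mu.prems by (simp add: subst_ok_def)
  have wf: "set_ty s \<subseteq> bases \<Sigma>" "set_ty (TFun s t) \<subseteq> bases \<Sigma>"
    using typing_wf_ctx[OF Mu.hyps] by auto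
  note M = Mu.IH[OF subst_ok_lift[OF subst_ok_lift[OF Mu.prems wf(2)] wf(1)]]
  have M_hom: "sm (s # TFun s t # \<Gamma>) M \<in> hom C ((cx \<Gamma> \<otimes> (ty s \<leadsto> fob T (ty t))) \<otimes> ty s) (fob T (ty t))"
    using sm_hom[OF Mu.hyps] by simp
  have M'_hom: "sm (s # TFun s t # \<Delta>) (sub (lift_sub (lift_sub \<sigma>)) M)
      \<in> hom C ((cx \<Delta> \<otimes> (ty s \<leadsto> fob T (ty t))) \<otimes> ty s) (fob T (ty t))"
    using sm_hom[OF conjunct1[OF M]] by simp
  have "sm \<Delta> (Mu s t (sub (lift_sub (lift_sub \<sigma>)) M)) = sm \<Gamma> (Mu s t M) \<cdot> \<theta>"
    unfolding sm_Mu[OF M_hom] sm_Mu[OF M'_hom]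
    using mu_fix_cmp[OF M_hom \<theta> refl refl] mu_fix_hom[OF M_hom] M \<theta> by (simp add: hom_iff)
  then show ?case using M by (simp add: typing.Mu del: sem.simps)
qed

text \<open>Terms that denote a value, together with the arrow \<open>p\<close> of that value. The
  variables, projections, tuples and injections that the translation inserts are such terms, and the
  rules below compute their meaning compositionally.\<close>

definition pure :: "'b ctx \<Rightarrow> ('b, 'k, 'e) trm \<Rightarrow> 'b ty \<Rightarrow> 'm \<Rightarrow> bool" where
  "pure \<Gamma> M t p \<longleftrightarrow> typing \<Sigma> \<Gamma> M t \<and> p \<in> hom C (cx \<Gamma>) (ty t) \<and> sm \<Gamma> M = ret T (ty t) \<cdot> p"

lemma pure_Var: "wf_ctx \<Sigma> \<Gamma> \<Longrightarrow> i < length \<Gamma> \<Longrightarrow> pure \<Gamma> (Var i) (\<Gamma> ! i) (vp \<Gamma> i)"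
  using vp_hom by (auto simp: pure_def typing.Var)

lemma pure_Star: "wf_ctx \<Sigma> \<Gamma> \<Longrightarrow> pure \<Gamma> Star TUnit (bang C (cx \<Gamma>))"
  by (auto simp: pure_def typing.Star hom_iff)

lemma pure_Prj1: "pure \<Gamma> M (TProd s t) p \<Longrightarrow> pure \<Gamma> (Prj1 M) s (pr1 C (ty s) (ty t) \<cdot> p)"
  by (auto simp: pure_def typing.Prj1 hom_iff tyof_eq)

lemma pure_Prj2: "pure \<Gamma> M (TProd s t) p \<Longrightarrow> pure \<Gamma> (Prj2 M) t (pr2 C (ty s) (ty t) \<cdot> p)"
  by (auto simp: pure_def typing.Prj2 hom_iff tyof_eq)

lemma pure_Tup:
  assumes "pure \<Gamma> M s p" "pure \<Gamma> N t q"
  shows "pure \<Gamma> (Tup M N) (TProd s t) \<langle>p, q\<rangle>"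
  using assms sm_Tup[of \<Gamma> M s N t]
  by (auto simp: pure_def hom_iff simp del: sem.simps intro: typing.Tup)

lemma pure_Abort: "pure \<Gamma> M TZero p \<Longrightarrow> set_ty t \<subseteq> bases \<Sigma> \<Longrightarrow> pure \<Gamma> (Abort t M) t (cobang C (ty t) \<cdot> p)"
  by (auto simp: pure_def typing.Abort hom_iff)

lemma pure_Inj1:
  "pure \<Gamma> M s p \<Longrightarrow> set_ty t \<subseteq> bases \<Sigma> \<Longrightarrow> pure \<Gamma> (Inj1 t M) (TSum s t) (in1 C (ty s) (ty t) \<cdot> p)"
  by (auto simp: pure_def typing.Inj1 hom_iff tyof_eq)

lemma pure_Inj2:
  "pure \<Gamma> M t p \<Longrightarrow> set_ty s \<subseteq> bases \<Sigma> \<Longrightarrow> pure \<Gamma> (Inj2 s M) (TSum s t) (in2 C (ty s) (ty t) \<cdot> p)"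
  by (auto simp: pure_def typing.Inj2 hom_iff tyof_eq)

lemma pure_Lam:
  "typing \<Sigma> (s # \<Gamma>) M t \<Longrightarrow> pure \<Gamma> (Lam s M) (TFun s t) (curry C (cx \<Gamma>) (ty s) (sm (s # \<Gamma>) M))"
  using sm_hom[of "s # \<Gamma>" M t] sm_Lam[of s \<Gamma> M t]
  by (auto simp: pure_def typing.Lam hom_iff simp del: sem.simps)

lemma pure_Mu:
  assumes "typing \<Sigma> (s # TFun s t # \<Gamma>) M t"
  shows "pure \<Gamma> (Mu s t M) (TFun s t) (mu_fix (cx \<Gamma>) (ty s) (ty t) (sm (s # TFun s t # \<Gamma>) M))"
proof -
  have M: "sm (s # TFun s t # \<Gamma>) M \<in> hom C ((cx \<Gamma> \<otimes> (ty s \<leadsto> fob T (ty t))) \<otimes> ty s) (fob T (ty t))"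
    using sm_hom[OF assms] by simp
  show ?thesis
    using mu_fix_hom[OF M] sm_Mu[OF M] assms by (simp add: pure_def typing.Mu del: sem.simps)
qed

lemma subst_okI:
  assumes "wf_ctx \<Sigma> \<Delta>" "\<theta> \<in> hom C (cx \<Delta>) (cx \<Gamma>)"
    "\<And>i. i < length \<Gamma> \<Longrightarrow> simple_trm (\<sigma> i) \<and> pure \<Delta> (\<sigma> i) (\<Gamma> ! i) (vp \<Gamma> i \<cdot> \<theta>)"
  shows "subst_ok \<Delta> \<sigma> \<Gamma> \<theta>"
  using assms by (auto simp: subst_ok_def pure_def)

end

lemma sem_ty_ground: "ground t \<Longrightarrow> sem_ty C T A t = sem_ty C U A t"
  by (induction t) auto

lemma ground_ctx_ty: "ground (ctx_ty \<Gamma>) \<longleftrightarrow> (\<forall>s \<in> set \<Gamma>. ground s)"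
  by (induction \<Gamma>) auto


section \<open>Monad morphisms\<close>

locale lcfix_morphism = T: lcfix_model \<Sigma> C T bot0 A a + strong_monad_morphism C T U \<alpha>
  for \<Sigma> :: "('b, 'k, 'e) signature" and C :: "('o, 'm) bicc" (structure)
    and T :: "('o, 'm) smonad" and bot0 :: 'm and A :: "'b \<Rightarrow> 'o" and a :: "'k + 'e \<Rightarrow> 'm"
    and U :: "('o, 'm) smonad" and \<alpha> :: "'o \<Rightarrow> 'm" +
  assumes wf_sig: "wf_signature \<Sigma>"
begin

lemma mor_simps [simp]: "\<alpha> X \<in> arrs C" "src C (\<alpha> X) = fob T X" "tgt C (\<alpha> X) = fob U X"
  using mor_hom[of X] by (auto simp: hom_iff)

lemma ground_sig:
  "c \<in> const_syms \<Sigma> \<Longrightarrow> ground (ar \<Sigma> (Inl c)) \<and> ground (car \<Sigma> (Inl c))"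
  "e \<in> eff_syms \<Sigma> \<Longrightarrow> ground (ar \<Sigma> (Inr e)) \<and> ground (car \<Sigma> (Inr e))"
  using wf_sig unfolding wf_signature_def by (meson InlI InrI)+

text \<open>For leastness: an arrow \<open>g\<close> into \<open>fob U X\<close> is the image of
  \<open>ret T (fob U X) \<cdot> g\<close> under \<open>mul U X \<cdot> \<alpha> (fob U X)\<close>,
  and the bottom of \<open>T\<close> at \<open>fob U X\<close> is sent to that of \<open>U\<close>
  at \<open>X\<close>; composition is monotone. The operations are typed correctly because ground
  types have the same interpretation on both sides.\<close>

sublocale U: lcfix_model \<Sigma> C U "\<alpha> \<zero> \<cdot> bot0" A "mor_op \<Sigma> C T \<alpha> A a"
proof (unfold_locales)
  show bot: "\<alpha> \<zero> \<cdot> bot0 \<in> hom C \<one> (fob U \<zero>)"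
    using T.bot0_hom by (auto simp: hom_iff)
  show "bottom C U (\<alpha> \<zero> \<cdot> bot0) X \<sqsubseteq> g" if g: "g \<in> hom C \<one> (fob U X)" for g X
  proof -
    have "mul U X \<cdot> \<alpha> (fob U X) \<cdot> T.bt (fob U X) \<sqsubseteq> mul U X \<cdot> \<alpha> (fob U X) \<cdot> (ret T (fob U X) \<cdot> g)"
    proof (intro T.cmp_mono[OF T.le_refl])
      show "T.bt (fob U X) \<sqsubseteq> ret T (fob U X) \<cdot> g"
        by (rule T.bottom_least) (use g in \<open>auto simp: hom_iff\<close>)
    qed (use g in \<open>auto simp: hom_iff\<close>)
    moreover have "mul U X \<cdot> \<alpha> (fob U X) \<cdot> (ret T (fob U X) \<cdot> g) = g"
    proof -
      have "mul U X \<cdot> \<alpha> (fob U X) \<cdot> (ret T (fob U X) \<cdot> g)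
        = mul U X \<cdot> (\<alpha> (fob U X) \<cdot> ret T (fob U X)) \<cdot> g"
        using g by (simp add: hom_iff)
      then show ?thesis
        using g by (simp only: mor_ret) (simp add: hom_iff)
    qed
    \<comment> \<open>By initiality the arrow from \<open>\<zero>\<close> to \<open>fob U X\<close>
      is \<open>ret U X\<close> after \<open>cobang C X\<close>, so the multiplication
      cancels.\<close>
    moreover have "mul U X \<cdot> \<alpha> (fob U X) \<cdot> T.bt (fob U X) = bottom C U (\<alpha> \<zero> \<cdot> bot0) X"
    proof -
      have "mul U X \<cdot> \<alpha> (fob U X) \<cdot> T.bt (fob U X)
        = mul U X \<cdot> (\<alpha> (fob U X) \<cdot> far T (cobang C (fob U X))) \<cdot> bot0"
        using T.bot0_hom by (simp add: hom_iff bottom_def)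
      also have "\<dots> = mul U X \<cdot> (far U (ret U X \<cdot> cobang C X) \<cdot> \<alpha> \<zero>) \<cdot> bot0"
        using mor_natural[OF T.cobang_hom] by simp
      also have "\<dots> = (mul U X \<cdot> far U (ret U X)) \<cdot> (far U (cobang C X) \<cdot> \<alpha> \<zero> \<cdot> bot0)"
        using T.bot0_hom by (simp add: hom_iff del: T.cmp_cobang)
      also have "\<dots> = bottom C U (\<alpha> \<zero> \<cdot> bot0) X"
        using T.bot0_hom by (simp only: U.mul_far_ret) (simp add: hom_iff bottom_def)
      finally show ?thesis .
    qed
    ultimately show ?thesis by simp
  qed
  show "mor_op \<Sigma> C T \<alpha> A a (Inl c) \<in> hom C (sem_ty C U A (ar \<Sigma> (Inl c))) (sem_ty C U A (car \<Sigma> (Inl c)))"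
    if "c \<in> const_syms \<Sigma>" for c
    using T.const_hom[OF that] ground_sig(1)[OF that] by (simp add: mor_op_def sem_ty_ground[of _ C U A T])
  show "mor_op \<Sigma> C T \<alpha> A a (Inr e) \<in> hom C (sem_ty C U A (ar \<Sigma> (Inr e))) (fob U (sem_ty C U A (car \<Sigma> (Inr e))))"
    if "e \<in> eff_syms \<Sigma>" for e
    using T.eff_hom[OF that] ground_sig(2)[OF that]
    by (simp add: mor_op_def sem_ty_ground[of _ C U A T] hom_iff)
qed

text \<open>\<open>\<alpha>\<close> moves inwards through the multiplication, the continuation and
  the strength in turn, one axiom of monad morphisms for each.\<close>

lemma mor_bnd:
  assumes "m \<in> hom C W (fob T X)" "k \<in> hom C (W \<otimes> X) (fob T Z)"
  shows "\<alpha> Z \<cdot> T.bnd X Z m k = U.bnd X Z (\<alpha> X \<cdot> m) (\<alpha> Z \<cdot> k)"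
proof -
  have "\<alpha> Z \<cdot> T.bnd X Z m k = (\<alpha> Z \<cdot> mul T Z) \<cdot> far T k \<cdot> str T W X \<cdot> \<langle>idn C W, m\<rangle>"
    using assms by (simp add: T.bnd_def hom_iff)
  also have "\<dots> = mul U Z \<cdot> far U (\<alpha> Z) \<cdot> (\<alpha> (fob T Z) \<cdot> far T k) \<cdot> str T W X \<cdot> \<langle>idn C W, m\<rangle>"
    using assms by (simp only: mor_mul) (simp add: hom_iff)
  also have "\<dots> = mul U Z \<cdot> far U (\<alpha> Z) \<cdot> far U k \<cdot> (\<alpha> (W \<otimes> X) \<cdot> str T W X) \<cdot> \<langle>idn C W, m\<rangle>"
    using mor_natural[OF assms(2)] assms by (simp add: hom_iff)
  also have "\<dots> = U.bnd X Z (\<alpha> X \<cdot> m) (\<alpha> Z \<cdot> k)"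
    using assms by (simp only: mor_str) (simp add: U.bnd_def hom_iff)
  finally show ?thesis .
qed

lemma mor_ret_cmp [simp]:
  assumes "u \<in> arrs C" "tgt C u = X"
  shows "\<alpha> X \<cdot> (ret T X \<cdot> u) = ret U X \<cdot> u"
proof -
  have "\<alpha> X \<cdot> (ret T X \<cdot> u) = (\<alpha> X \<cdot> ret T X) \<cdot> u"
    using assms by simp
  then show ?thesis
    by (simp only: mor_ret)
qed

lemma mor_bottom: "\<alpha> X \<cdot> (T.bt X \<cdot> bang C W) = U.bt X \<cdot> bang C W"
proof -
  have "\<alpha> X \<cdot> (T.bt X \<cdot> bang C W) = (\<alpha> X \<cdot> far T (cobang C X)) \<cdot> bot0 \<cdot> bang C W"
    using T.bot0_hom by (simp add: hom_iff bottom_def)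
  then show ?thesis
    using T.bot0_hom mor_natural[OF T.cobang_hom] by (simp add: hom_iff bottom_def)
qed

text \<open>At sums, \<open>rel\<close> is biorthogonal, like \<open>lifted\<close>, because a generalized element of a sum need
  not factor through an injection.\<close>

definition agree :: "('o \<Rightarrow> 'm \<Rightarrow> 'm \<Rightarrow> bool) \<Rightarrow> 'o \<Rightarrow> 'm \<Rightarrow> 'm \<Rightarrow> bool" where
  "agree R V k k' \<longleftrightarrow>
    (\<forall>V' g u v. g \<in> hom C V' V \<longrightarrow> R V' u v \<longrightarrow> k \<cdot> \<langle>g, u\<rangle> = k' \<cdot> \<langle>g, v\<rangle>)"

text \<open>Both computations are tested in \<open>U\<close>, where \<open>\<alpha>\<close> carries
  the first one, so that a test is an equation of arrows. Quantifying over \<open>h\<close> builds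
  in stability under change of stage. The relation is a parameter because \<open>rel\<close> calls
  this in its own recursion.\<close>

definition lifted :: "('o \<Rightarrow> 'm \<Rightarrow> 'm \<Rightarrow> bool) \<Rightarrow> 'o \<Rightarrow> 'o \<Rightarrow> 'o \<Rightarrow> 'm \<Rightarrow> 'm \<Rightarrow> bool" where
  "lifted R X X' W m m' \<longleftrightarrow> m \<in> hom C W (fob T X) \<and> m' \<in> hom C W (fob U X') \<and>
    (\<forall>V h \<Omega> k k'. h \<in> hom C V W \<longrightarrow> k \<in> hom C (V \<otimes> X) (fob U \<Omega>) \<longrightarrow> k' \<in> hom C (V \<otimes> X') (fob U \<Omega>) \<longrightarrow>
      agree R V k k' \<longrightarrow> U.bnd X \<Omega> (\<alpha> X \<cdot> m \<cdot> h) k = U.bnd X' \<Omega> (m' \<cdot> h) k')"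

primrec rel :: "'b ty \<Rightarrow> 'o \<Rightarrow> 'm \<Rightarrow> 'm \<Rightarrow> bool" where
  "rel (TBase b) W u v \<longleftrightarrow> u = v \<and> u \<in> hom C W (A b)"
| "rel TUnit W u v \<longleftrightarrow> u = v \<and> u \<in> hom C W \<one>"
| "rel TZero W u v \<longleftrightarrow> u = v \<and> u \<in> hom C W \<zero>"
| "rel (TProd s t) W u v \<longleftrightarrow>
     u \<in> hom C W (T.ty (TProd s t)) \<and> v \<in> hom C W (U.ty (TProd s t)) \<and>
     rel s W (pr1 C (T.ty s) (T.ty t) \<cdot> u) (pr1 C (U.ty s) (U.ty t) \<cdot> v) \<and>
     rel t W (pr2 C (T.ty s) (T.ty t) \<cdot> u) (pr2 C (U.ty s) (U.ty t) \<cdot> v)"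
| "rel (TSum s t) W u v \<longleftrightarrow>
     u \<in> hom C W (T.ty (TSum s t)) \<and> v \<in> hom C W (U.ty (TSum s t)) \<and>
     (\<forall>V h \<Omega> k1 k2 k1' k2'. h \<in> hom C V W \<longrightarrow>
        k1 \<in> hom C (V \<otimes> T.ty s) \<Omega> \<longrightarrow> k2 \<in> hom C (V \<otimes> T.ty t) \<Omega> \<longrightarrow>
        k1' \<in> hom C (V \<otimes> U.ty s) \<Omega> \<longrightarrow> k2' \<in> hom C (V \<otimes> U.ty t) \<Omega> \<longrightarrow>
        agree (rel s) V k1 k1' \<longrightarrow> agree (rel t) V k2 k2' \<longrightarrow>
        T.cse V (T.ty s) (T.ty t) k1 k2 \<cdot> \<langle>idn C V, u \<cdot> h\<rangle>
          = T.cse V (U.ty s) (U.ty t) k1' k2' \<cdot> \<langle>idn C V, v \<cdot> h\<rangle>)"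
| "rel (TFun s t) W u v \<longleftrightarrow>
     u \<in> hom C W (T.ty (TFun s t)) \<and> v \<in> hom C W (U.ty (TFun s t)) \<and>
     (\<forall>V h x y. h \<in> hom C V W \<longrightarrow> rel s V x y \<longrightarrow>
        lifted (rel t) (T.ty t) (U.ty t) V
          (ev C (T.ty s) (fob T (T.ty t)) \<cdot> \<langle>u \<cdot> h, x\<rangle>) (ev C (U.ty s) (fob U (U.ty t)) \<cdot> \<langle>v \<cdot> h, y\<rangle>))"

abbreviation "clift t \<equiv> lifted (rel t) (T.ty t) (U.ty t)"

section \<open>Closure properties of the relations\<close>

lemma rel_hom: "rel t W u v \<Longrightarrow> u \<in> hom C W (T.ty t) \<and> v \<in> hom C W (U.ty t)"
  by (cases t) auto

lemma clift_hom: "clift t W m m' \<Longrightarrow> m \<in> hom C W (fob T (T.ty t)) \<and> m' \<in> hom C W (fob U (U.ty t))"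
  by (auto simp: lifted_def)

lemma lifted_cmp:
  assumes "lifted R X X' W m m'" "h \<in> hom C V W"
  shows "lifted R X X' V (m \<cdot> h) (m' \<cdot> h)"
  unfolding lifted_def
proof (intro conjI allI impI)
  show "m \<cdot> h \<in> hom C V (fob T X)" "m' \<cdot> h \<in> hom C V (fob U X')"
    using assms by (auto simp: lifted_def hom_iff)
  fix V' h' \<Omega> k k'
  assume "h' \<in> hom C V' V" "k \<in> hom C (V' \<otimes> X) (fob U \<Omega>)" "k' \<in> hom C (V' \<otimes> X') (fob U \<Omega>)" "agree R V' k k'"
  moreover from this assms(2) have "h \<cdot> h' \<in> hom C V' W"
    by (auto simp: hom_iff)
  ultimately have "U.bnd X \<Omega> (\<alpha> X \<cdot> m \<cdot> (h \<cdot> h')) k = U.bnd X' \<Omega> (m' \<cdot> (h \<cdot> h')) k'"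
    using assms(1) unfolding lifted_def by blast
  moreover have "\<alpha> X \<cdot> (m \<cdot> h) \<cdot> h' = \<alpha> X \<cdot> m \<cdot> (h \<cdot> h')" "(m' \<cdot> h) \<cdot> h' = m' \<cdot> (h \<cdot> h')"
    using assms \<open>h' \<in> _\<close> by (auto simp: lifted_def hom_iff)
  ultimately show "U.bnd X \<Omega> (\<alpha> X \<cdot> (m \<cdot> h) \<cdot> h') k = U.bnd X' \<Omega> ((m' \<cdot> h) \<cdot> h') k'"
    by simp
qed

text \<open>Kripke monotonicity. At sums and functions it is immediate, because these clauses
  already quantify over all later stages; only products use the induction hypotheses.\<close>

lemma rel_cmp: "rel t W u v \<Longrightarrow> h \<in> hom C V W \<Longrightarrow> rel t V (u \<cdot> h) (v \<cdot> h)"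
proof (induction t arbitrary: W u v)
  case (TProd s t)
  have "rel s V ((pr1 C (T.ty s) (T.ty t) \<cdot> u) \<cdot> h) ((pr1 C (U.ty s) (U.ty t) \<cdot> v) \<cdot> h)"
    "rel t V ((pr2 C (T.ty s) (T.ty t) \<cdot> u) \<cdot> h) ((pr2 C (U.ty s) (U.ty t) \<cdot> v) \<cdot> h)"
    using TProd by auto
  then show ?case
    using TProd.prems by (simp add: hom_iff)
next
  case (TSum s t)
  have uv: "u \<in> hom C W (T.ty (TSum s t))" "v \<in> hom C W (U.ty (TSum s t))"
    using TSum.prems by auto
  have "T.cse V' (T.ty s) (T.ty t) k1 k2 \<cdot> \<langle>idn C V', (u \<cdot> h) \<cdot> h'\<rangle>
          = T.cse V' (U.ty s) (U.ty t) k1' k2' \<cdot> \<langle>idn C V', (v \<cdot> h) \<cdot> h'\<rangle>"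
    if "h' \<in> hom C V' V" "k1 \<in> hom C (V' \<otimes> T.ty s) \<Omega>" "k2 \<in> hom C (V' \<otimes> T.ty t) \<Omega>"
      "k1' \<in> hom C (V' \<otimes> U.ty s) \<Omega>" "k2' \<in> hom C (V' \<otimes> U.ty t) \<Omega>" "agree (rel s) V' k1 k1'"
      "agree (rel t) V' k2 k2'" for V' h' \<Omega> k1 k2 k1' k2'
  proof -
    have "(u \<cdot> h) \<cdot> h' = u \<cdot> (h \<cdot> h')" "(v \<cdot> h) \<cdot> h' = v \<cdot> (h \<cdot> h')" "h \<cdot> h' \<in> hom C V' W"
      using that(1) TSum.prems(2) uv by (auto simp: hom_iff)
    then show ?thesis
      using TSum.prems(1) that by simp
  qed
  moreover have "u \<cdot> h \<in> hom C V (T.ty (TSum s t))" "v \<cdot> h \<in> hom C V (U.ty (TSum s t))"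
    using uv TSum.prems(2) by (auto simp: hom_iff)
  ultimately show ?case
    by (simp only: rel.simps) blast
next
  case (TFun s t)
  have uv: "u \<in> hom C W (T.ty (TFun s t))" "v \<in> hom C W (U.ty (TFun s t))"
    using TFun.prems by auto
  have "lifted (rel t) (T.ty t) (U.ty t) V'
      (ev C (T.ty s) (fob T (T.ty t)) \<cdot> \<langle>(u \<cdot> h) \<cdot> h', x\<rangle>) (ev C (U.ty s) (fob U (U.ty t)) \<cdot> \<langle>(v \<cdot> h) \<cdot> h', y\<rangle>)"
    if "h' \<in> hom C V' V" "rel s V' x y" for V' h' x y
  proof -
    have "(u \<cdot> h) \<cdot> h' = u \<cdot> (h \<cdot> h')" "(v \<cdot> h) \<cdot> h' = v \<cdot> (h \<cdot> h')" "h \<cdot> h' \<in> hom C V' W"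
      using that(1) TFun.prems(2) uv by (auto simp: hom_iff)
    then show ?thesis
      using TFun.prems(1) that by simp
  qed
  moreover have "u \<cdot> h \<in> hom C V (T.ty (TFun s t))" "v \<cdot> h \<in> hom C V (U.ty (TFun s t))"
    using uv TFun.prems(2) by (auto simp: hom_iff)
  ultimately show ?case
    by (simp only: rel.simps) blast
qed (auto simp: hom_iff)

text \<open>If the relation is reflexive, the two projections of \<open>V \<otimes> X\<close> form a
  generic argument at which to compare.\<close>

lemma agree_eqD:
  assumes "agree R V k k'" "\<And>W u. u \<in> hom C W X \<Longrightarrow> R W u u"
    "k \<in> hom C (V \<otimes> X) Z" "k' \<in> hom C (V \<otimes> X) Z"
  shows "k = k'"
proof -
  have "k \<cdot> \<langle>pr1 C V X, pr2 C V X\<rangle> = k' \<cdot> \<langle>pr1 C V X, pr2 C V X\<rangle>"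
    using assms(1) assms(2)[OF T.pr2_hom] T.pr1_hom unfolding agree_def by blast
  then show ?thesis
    using assms(3,4) by (simp add: hom_iff)
qed

lemma rel_ground: "ground t \<Longrightarrow> rel t W u v \<longleftrightarrow> u = v \<and> u \<in> hom C W (T.ty t)"
proof (induction t arbitrary: W u v)
  case (TProd s t)
  have "U.ty s = T.ty s" "U.ty t = T.ty t"
    using TProd.prems by (auto intro: sem_ty_ground)
  then show ?case
    using TProd.IH TProd.prems T.prod_eqI[of u v "T.ty s" "T.ty t"] by (auto simp: hom_iff)
next
  case (TSum s t)
  have eq: "U.ty s = T.ty s" "U.ty t = T.ty t"
    using TSum.prems by (auto intro: sem_ty_ground)
  have refl: "rel s W u u" if "u \<in> hom C W (T.ty s)" for W u
    using that TSum.IH(1) TSum.prems by simp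
  have refl': "rel t W u u" if "u \<in> hom C W (T.ty t)" for W u
    using that TSum.IH(2) TSum.prems by simp
  show ?case
  proof
    assume r: "rel (TSum s t) W u v"
    \<comment> \<open>Tests at a sum may land in any object, so the injections themselves are
      admissible; their case map is the second projection, which returns \<open>u\<close> and
      \<open>v\<close>.\<close>
    let ?k1 = "in1 C (T.ty s) (T.ty t) \<cdot> pr2 C W (T.ty s)" and ?k2 = "in2 C (T.ty s) (T.ty t) \<cdot> pr2 C W (T.ty t)"
    have k: "T.cse W (T.ty s) (T.ty t) ?k1 ?k2 = pr2 C W (T.ty s \<oplus> T.ty t)"
      by (rule T.distrib_eqI) (auto simp: hom_iff)
    have "agree (rel s) W ?k1 ?k1" "agree (rel t) W ?k2 ?k2"
      unfolding agree_def using TSum.IH TSum.prems by auto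
    with r[unfolded rel.simps, THEN conjunct2, THEN conjunct2, rule_format,
        of "idn C W" W ?k1 "T.ty s \<oplus> T.ty t" ?k2 ?k1 ?k2]
    have "T.cse W (T.ty s) (T.ty t) ?k1 ?k2 \<cdot> \<langle>idn C W, u \<cdot> idn C W\<rangle>
      = T.cse W (T.ty s) (T.ty t) ?k1 ?k2 \<cdot> \<langle>idn C W, v \<cdot> idn C W\<rangle>"
      unfolding eq by (simp add: hom_iff)
    then show "u = v \<and> u \<in> hom C W (T.ty (TSum s t))"
      using r unfolding k by (simp add: hom_iff eq)
  next
    assume u: "u = v \<and> u \<in> hom C W (T.ty (TSum s t))"
    \<comment> \<open>Conversely, by induction both summands carry equality, so agreeing tests are
      equal and every tested equation becomes trivial.\<close>
    have "k1 = k1' \<and> k2 = k2'"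
      if "k1 \<in> hom C (V \<otimes> T.ty s) \<Omega>" "k2 \<in> hom C (V \<otimes> T.ty t) \<Omega>"
        "k1' \<in> hom C (V \<otimes> T.ty s) \<Omega>" "k2' \<in> hom C (V \<otimes> T.ty t) \<Omega>"
        "agree (rel s) V k1 k1'" "agree (rel t) V k2 k2'" for V \<Omega> k1 k1' k2 k2'
      using agree_eqD[OF that(5) refl that(1,3)] agree_eqD[OF that(6) refl' that(2,4)] by simp
    then have "T.cse V (T.ty s) (T.ty t) k1 k2 = T.cse V (T.ty s) (T.ty t) k1' k2'"
      if "k1 \<in> hom C (V \<otimes> T.ty s) \<Omega>" "k2 \<in> hom C (V \<otimes> T.ty t) \<Omega>"
        "k1' \<in> hom C (V \<otimes> T.ty s) \<Omega>" "k2' \<in> hom C (V \<otimes> T.ty t) \<Omega>"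
        "agree (rel s) V k1 k1'" "agree (rel t) V k2 k2'" for V \<Omega> k1 k1' k2 k2'
      using that by blast
    then show "rel (TSum s t) W u v"
      using u unfolding rel.simps sem_ty.simps eq by metis
  qed
qed auto

lemma lifted_ret:
  assumes "\<And>V h. h \<in> hom C V W \<Longrightarrow> R V (u \<cdot> h) (v \<cdot> h)"
    "u \<in> hom C W X" "v \<in> hom C W X'"
  shows "lifted R X X' W (ret T X \<cdot> u) (ret U X' \<cdot> v)"
  unfolding lifted_def
proof (intro conjI allI impI)
  show "ret T X \<cdot> u \<in> hom C W (fob T X)" "ret U X' \<cdot> v \<in> hom C W (fob U X')"
    using assms by (auto simp: hom_iff)
  fix V h \<Omega> k k'
  assume h: "h \<in> hom C V W" and k: "k \<in> hom C (V \<otimes> X) (fob U \<Omega>)" "k' \<in> hom C (V \<otimes> X') (fob U \<Omega>)"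
    and "agree R V k k'"
  then have "k \<cdot> \<langle>idn C V, u \<cdot> h\<rangle> = k' \<cdot> \<langle>idn C V, v \<cdot> h\<rangle>"
    using assms(1)[OF h] T.idn_hom unfolding agree_def by blast
  then show "U.bnd X \<Omega> (\<alpha> X \<cdot> (ret T X \<cdot> u) \<cdot> h) k = U.bnd X' \<Omega> ((ret U X' \<cdot> v) \<cdot> h) k'"
    using assms(2,3) h k by (simp add: hom_iff)
qed

lemma clift_ret: "rel t W u v \<Longrightarrow> clift t W (ret T (T.ty t) \<cdot> u) (ret U (U.ty t) \<cdot> v)"
  using lifted_ret[of W "rel t" u v "T.ty t" "U.ty t"] rel_cmp[of t W u v] rel_hom[of t W u v] by blast

text \<open>By associativity a test after a binding is a test of the bound computation; this
  supplies that the two resulting tests agree. The assumption on \<open>k\<close>, \<open>k'\<close>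
  is used at the later stage \<open>V'\<close>, with \<open>l\<close>, \<open>l'\<close> restricted
  along \<open>g\<close>.\<close>

lemma agree_continuation:
  assumes k: "k \<in> hom C (W \<otimes> T.ty s) (fob T (T.ty t))" "k' \<in> hom C (W \<otimes> U.ty s) (fob U (U.ty t))"
    and kk': "\<And>V h u v. h \<in> hom C V W \<Longrightarrow> rel s V u v \<Longrightarrow> clift t V (k \<cdot> \<langle>h, u\<rangle>) (k' \<cdot> \<langle>h, v\<rangle>)"
    and h: "h \<in> hom C V W" and l: "l \<in> hom C (V \<otimes> T.ty t) (fob U \<Omega>)" "l' \<in> hom C (V \<otimes> U.ty t) (fob U \<Omega>)"
    and ag: "agree (rel t) V l l'"
  shows "agree (rel s) V
    (U.bnd (T.ty t) \<Omega> (\<alpha> (T.ty t) \<cdot> k \<cdot> under C h V (T.ty s))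
      (l \<cdot> under C (pr1 C V (T.ty s)) (V \<otimes> T.ty s) (T.ty t)))
    (U.bnd (U.ty t) \<Omega> (k' \<cdot> under C h V (U.ty s))
      (l' \<cdot> under C (pr1 C V (U.ty s)) (V \<otimes> U.ty s) (U.ty t)))"
    (is "agree _ _ ?K ?K'")
  unfolding agree_def
proof (intro allI impI)
  let ?Z = "T.ty t" and ?Z' = "U.ty t"
  fix V' g u v
  assume g: "g \<in> hom C V' V" and uv: "rel s V' u v"
  have uvh: "u \<in> hom C V' (T.ty s)" "v \<in> hom C V' (U.ty s)"
    using rel_hom[OF uv] by auto
  let ?l = "l \<cdot> under C g V' ?Z" and ?l' = "l' \<cdot> under C g V' ?Z'"
  have "agree (rel t) V' ?l ?l'"
    unfolding agree_def
  proof (intro allI impI)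
    fix V'' g' x y
    assume g': "g' \<in> hom C V'' V'" and xy: "rel t V'' x y"
    have "g \<cdot> g' \<in> hom C V'' V"
      using g g' by (auto simp: hom_iff)
    then have "l \<cdot> \<langle>g \<cdot> g', x\<rangle> = l' \<cdot> \<langle>g \<cdot> g', y\<rangle>"
      using ag xy unfolding agree_def by blast
    then show "?l \<cdot> \<langle>g', x\<rangle> = ?l' \<cdot> \<langle>g', y\<rangle>"
      using g g' rel_hom[OF xy] l by (simp add: hom_iff)
  qed
  moreover have "clift t V' (k \<cdot> \<langle>h \<cdot> g, u\<rangle>) (k' \<cdot> \<langle>h \<cdot> g, v\<rangle>)"
    using kk'[OF _ uv] T.cmp_hom[OF g h] by blast
  moreover have "?l \<in> hom C (V' \<otimes> ?Z) (fob U \<Omega>)" "?l' \<in> hom C (V' \<otimes> ?Z') (fob U \<Omega>)"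
    using l g by (auto simp: hom_iff)
  ultimately have "U.bnd ?Z \<Omega> (\<alpha> ?Z \<cdot> (k \<cdot> \<langle>h \<cdot> g, u\<rangle>) \<cdot> idn C V') ?l
    = U.bnd ?Z' \<Omega> ((k' \<cdot> \<langle>h \<cdot> g, v\<rangle>) \<cdot> idn C V') ?l'"
    unfolding lifted_def using T.idn_hom by blast
  then show "?K \<cdot> \<langle>g, u\<rangle> = ?K' \<cdot> \<langle>g, v\<rangle>"
    using g h uvh k l by (simp add: hom_iff)
qed

text \<open>By \<open>bnd_bnd\<close> a test \<open>l\<close> of the extension becomes a test
  \<open>K\<close> of \<open>m\<close>, after \<open>\<alpha>\<close> has passed the binding by
  \<open>mor_bnd\<close>.\<close>

lemma clift_bnd:
  assumes m: "clift s W m m'"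
    and k: "k \<in> hom C (W \<otimes> T.ty s) (fob T (T.ty t))" "k' \<in> hom C (W \<otimes> U.ty s) (fob U (U.ty t))"
    and kk': "\<And>V h u v. h \<in> hom C V W \<Longrightarrow> rel s V u v \<Longrightarrow> clift t V (k \<cdot> \<langle>h, u\<rangle>) (k' \<cdot> \<langle>h, v\<rangle>)"
  shows "clift t W (T.bnd (T.ty s) (T.ty t) m k) (U.bnd (U.ty s) (U.ty t) m' k')"
  unfolding lifted_def
proof (intro conjI allI impI)
  let ?X = "T.ty s" and ?X' = "U.ty s" and ?Z = "T.ty t" and ?Z' = "U.ty t"
  have mh: "m \<in> hom C W (fob T ?X)" "m' \<in> hom C W (fob U ?X')"
    using clift_hom[OF m] by auto
  show "T.bnd ?X ?Z m k \<in> hom C W (fob T ?Z)" "U.bnd ?X' ?Z' m' k' \<in> hom C W (fob U ?Z')"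
    using mh k by (auto simp: hom_iff)
  fix V h \<Omega> l l'
  assume h: "h \<in> hom C V W" and l: "l \<in> hom C (V \<otimes> ?Z) (fob U \<Omega>)" "l' \<in> hom C (V \<otimes> ?Z') (fob U \<Omega>)"
    and ag: "agree (rel t) V l l'"
  define K where "K = U.bnd ?Z \<Omega> (\<alpha> ?Z \<cdot> k \<cdot> under C h V ?X)
    (l \<cdot> under C (pr1 C V ?X) (V \<otimes> ?X) ?Z)"
  define K' where "K' = U.bnd ?Z' \<Omega> (k' \<cdot> under C h V ?X')
    (l' \<cdot> under C (pr1 C V ?X') (V \<otimes> ?X') ?Z')"
  have K: "K \<in> hom C (V \<otimes> ?X) (fob U \<Omega>)" "K' \<in> hom C (V \<otimes> ?X') (fob U \<Omega>)"
    using k l h by (auto simp: K_def K'_def hom_iff)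
  have "agree (rel s) V K K'"
    unfolding K_def K'_def by (rule agree_continuation[OF k kk' h l ag])
  then have "U.bnd ?X \<Omega> (\<alpha> ?X \<cdot> m \<cdot> h) K = U.bnd ?X' \<Omega> (m' \<cdot> h) K'"
    using m h K unfolding lifted_def by blast
  moreover have "U.bnd ?Z \<Omega> (\<alpha> ?Z \<cdot> T.bnd ?X ?Z m k \<cdot> h) l = U.bnd ?X \<Omega> (\<alpha> ?X \<cdot> m \<cdot> h) K"
  proof -
    have "\<alpha> ?Z \<cdot> T.bnd ?X ?Z m k \<cdot> h = (\<alpha> ?Z \<cdot> T.bnd ?X ?Z m k) \<cdot> h"
      using mh k h by (simp add: hom_iff del: T.bnd_cmp)
    then show ?thesis
      using mh k h l by (simp add: mor_bnd[OF mh(1) k(1)] hom_iff K_def del: T.bnd_cmp)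
  qed
  moreover have "U.bnd ?Z' \<Omega> (U.bnd ?X' ?Z' m' k' \<cdot> h) l' = U.bnd ?X' \<Omega> (m' \<cdot> h) K'"
    using mh k h l by (simp add: hom_iff K'_def)
  ultimately show "U.bnd ?Z \<Omega> (\<alpha> ?Z \<cdot> T.bnd ?X ?Z m k \<cdot> h) l = U.bnd ?Z' \<Omega> (U.bnd ?X' ?Z' m' k' \<cdot> h) l'"
    by simp
qed

lemma clift_far:
  assumes m: "clift s W m m'" and f: "f \<in> hom C (T.ty s) (T.ty t)" "f' \<in> hom C (U.ty s) (U.ty t)"
    and ff': "\<And>V u v. rel s V u v \<Longrightarrow> rel t V (f \<cdot> u) (f' \<cdot> v)"
  shows "clift t W (far T f \<cdot> m) (far U f' \<cdot> m')"
proof -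
  have mh: "m \<in> hom C W (fob T (T.ty s))" "m' \<in> hom C W (fob U (U.ty s))"
    using clift_hom[OF m] by auto
  have "clift t W (T.bnd (T.ty s) (T.ty t) m (ret T (T.ty t) \<cdot> f \<cdot> pr2 C W (T.ty s)))
    (U.bnd (U.ty s) (U.ty t) m' (ret U (U.ty t) \<cdot> f' \<cdot> pr2 C W (U.ty s)))"
  proof (rule clift_bnd[OF m])
    fix V h u v
    assume h: "h \<in> hom C V W" and uv: "rel s V u v"
    show "clift t V ((ret T (T.ty t) \<cdot> f \<cdot> pr2 C W (T.ty s)) \<cdot> \<langle>h, u\<rangle>)
      ((ret U (U.ty t) \<cdot> f' \<cdot> pr2 C W (U.ty s)) \<cdot> \<langle>h, v\<rangle>)"
      using clift_ret[OF ff'[OF uv]] rel_hom[OF uv] h f by (simp add: hom_iff)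
  qed (use f in \<open>auto simp: hom_iff\<close>)
  then show ?thesis
    using T.far_eq_bnd[of m f] U.far_eq_bnd[of m' f'] mh f by (simp add: hom_iff)
qed

text \<open>At ground types the relation is equality, so agreeing tests are equal arrows by
  \<open>agree_eqD\<close>, and both sides of a tested equation coincide.\<close>

lemma clift_ground:
  assumes "ground t" "m \<in> hom C W (fob T (T.ty t))"
  shows "clift t W m (\<alpha> (T.ty t) \<cdot> m)"
  unfolding lifted_def
proof (intro conjI allI impI)
  have eq: "U.ty t = T.ty t"
    using assms(1) by (rule sem_ty_ground)
  show "m \<in> hom C W (fob T (T.ty t))" "\<alpha> (T.ty t) \<cdot> m \<in> hom C W (fob U (U.ty t))"
    using assms(2) by (auto simp: hom_iff eq)
  fix V h \<Omega> k k'
  assume h: "h \<in> hom C V W" and k: "k \<in> hom C (V \<otimes> T.ty t) (fob U \<Omega>)" "k' \<in> hom C (V \<otimes> U.ty t) (fob U \<Omega>)"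
    and ag: "agree (rel t) V k k'"
  have "k = k'"
    using agree_eqD[OF ag _ k(1)] k(2) rel_ground[OF assms(1)] unfolding eq by blast
  then show "U.bnd (T.ty t) \<Omega> (\<alpha> (T.ty t) \<cdot> m \<cdot> h) k = U.bnd (U.ty t) \<Omega> ((\<alpha> (T.ty t) \<cdot> m) \<cdot> h) k'"
    using assms(2) h by (simp add: eq hom_iff)
qed

lemma clift_groundD:
  assumes t: "ground t" and m: "clift t W m m'"
  shows "\<alpha> (T.ty t) \<cdot> m = m'"
proof -
  have eq: "U.ty t = T.ty t"
    using t by (rule sem_ty_ground)
  let ?k = "ret U (T.ty t) \<cdot> pr2 C W (T.ty t)"
  have "agree (rel t) W ?k ?k"
    unfolding agree_def using rel_ground[OF t] by auto
  moreover have "?k \<in> hom C (W \<otimes> T.ty t) (fob U (T.ty t))"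
    by (auto simp: hom_iff)
  ultimately have "U.bnd (T.ty t) (T.ty t) (\<alpha> (T.ty t) \<cdot> m \<cdot> idn C W) ?k
    = U.bnd (T.ty t) (T.ty t) (m' \<cdot> idn C W) ?k"
    using m T.idn_hom unfolding lifted_def eq by blast
  moreover have "m \<in> hom C W (fob T (T.ty t))" "m' \<in> hom C W (fob U (T.ty t))"
    using clift_hom[OF m] eq by auto
  ultimately show ?thesis
    using U.bnd_ret_right[of m' "T.ty t"] U.bnd_ret_right[of "\<alpha> (T.ty t) \<cdot> m" "T.ty t"] by (simp add: hom_iff)
qed

lemma rel_in:
  assumes "rel s W u v"
  shows "rel (TSum s t) W (in1 C (T.ty s) (T.ty t) \<cdot> u) (in1 C (U.ty s) (U.ty t) \<cdot> v)"
    and "rel (TSum t s) W (in2 C (T.ty t) (T.ty s) \<cdot> u) (in2 C (U.ty t) (U.ty s) \<cdot> v)"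
  using rel_hom[OF assms] rel_cmp[OF assms] T.idn_hom by (simp_all add: hom_iff agree_def)

text \<open>By \<open>bnd_cse\<close> a test after the case is pushed into both branches. This gives
  tests of the sum value itself, which agree by \<open>agree_continuation\<close>, and the clause of
  \<open>rel\<close> for sums applies to them.\<close>

lemma clift_cse:
  assumes uv: "rel (TSum s1 s2) W u v"
    and n: "n1 \<in> hom C (W \<otimes> T.ty s1) (fob T (T.ty t))" "n2 \<in> hom C (W \<otimes> T.ty s2) (fob T (T.ty t))"
      "n1' \<in> hom C (W \<otimes> U.ty s1) (fob U (U.ty t))" "n2' \<in> hom C (W \<otimes> U.ty s2) (fob U (U.ty t))"
    and n1: "\<And>V h x y. h \<in> hom C V W \<Longrightarrow> rel s1 V x y \<Longrightarrow> clift t V (n1 \<cdot> \<langle>h, x\<rangle>) (n1' \<cdot> \<langle>h, y\<rangle>)"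
    and n2: "\<And>V h x y. h \<in> hom C V W \<Longrightarrow> rel s2 V x y \<Longrightarrow> clift t V (n2 \<cdot> \<langle>h, x\<rangle>) (n2' \<cdot> \<langle>h, y\<rangle>)"
  shows "clift t W (T.cse W (T.ty s1) (T.ty s2) n1 n2 \<cdot> \<langle>idn C W, u\<rangle>)
    (T.cse W (U.ty s1) (U.ty s2) n1' n2' \<cdot> \<langle>idn C W, v\<rangle>)"
  unfolding lifted_def
proof (intro conjI allI impI)
  let ?Z = "T.ty t" and ?Z' = "U.ty t"
  have uvh: "u \<in> hom C W (T.ty s1 \<oplus> T.ty s2)" "v \<in> hom C W (U.ty s1 \<oplus> U.ty s2)"
    using rel_hom[OF uv] by auto
  show "T.cse W (T.ty s1) (T.ty s2) n1 n2 \<cdot> \<langle>idn C W, u\<rangle> \<in> hom C W (fob T ?Z)"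
    "T.cse W (U.ty s1) (U.ty s2) n1' n2' \<cdot> \<langle>idn C W, v\<rangle> \<in> hom C W (fob U ?Z')"
    using uvh n by (auto simp: hom_iff)
  fix V h \<Omega> l l'
  assume h: "h \<in> hom C V W" and l: "l \<in> hom C (V \<otimes> ?Z) (fob U \<Omega>)" "l' \<in> hom C (V \<otimes> ?Z') (fob U \<Omega>)"
    and ag: "agree (rel t) V l l'"
  define K where "K X n = U.bnd ?Z \<Omega> (\<alpha> ?Z \<cdot> n \<cdot> under C h V X)
    (l \<cdot> under C (pr1 C V X) (V \<otimes> X) ?Z)" for X n
  define K' where "K' X n = U.bnd ?Z' \<Omega> (n \<cdot> under C h V X)
    (l' \<cdot> under C (pr1 C V X) (V \<otimes> X) ?Z')" for X n
  have K: "K X k \<in> hom C (V \<otimes> X) (fob U \<Omega>)" if "k \<in> hom C (W \<otimes> X) (fob T ?Z)" for X k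
    using that l h by (auto simp: K_def hom_iff)
  have K': "K' X k \<in> hom C (V \<otimes> X) (fob U \<Omega>)" if "k \<in> hom C (W \<otimes> X) (fob U ?Z')" for X k
    using that l h by (auto simp: K'_def hom_iff)
  have agK: "agree (rel s) V (K (T.ty s) k) (K' (U.ty s) k')"
    if k: "k \<in> hom C (W \<otimes> T.ty s) (fob T ?Z)" "k' \<in> hom C (W \<otimes> U.ty s) (fob U ?Z')"
      and kk': "\<And>V h x y. h \<in> hom C V W \<Longrightarrow> rel s V x y \<Longrightarrow> clift t V (k \<cdot> \<langle>h, x\<rangle>) (k' \<cdot> \<langle>h, y\<rangle>)"
    for s k k'
    unfolding K_def K'_def by (rule agree_continuation[OF k kk' h l ag])
  have rel: "T.cse V (T.ty s1) (T.ty s2) (K (T.ty s1) n1) (K (T.ty s2) n2) \<cdot> \<langle>idn C V, u \<cdot> h\<rangle>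
    = T.cse V (U.ty s1) (U.ty s2) (K' (U.ty s1) n1') (K' (U.ty s2) n2') \<cdot> \<langle>idn C V, v \<cdot> h\<rangle>"
    by (rule uv[unfolded rel.simps, THEN conjunct2, THEN conjunct2, rule_format,
          OF h K[OF n(1)] K[OF n(2)] K'[OF n(3)] K'[OF n(4)] agK[OF n(1,3) n1] agK[OF n(2,4) n2]])
  have T: "U.bnd ?Z \<Omega> (\<alpha> ?Z \<cdot> (T.cse W (T.ty s1) (T.ty s2) n1 n2 \<cdot> \<langle>idn C W, u\<rangle>) \<cdot> h) l
    = T.cse V (T.ty s1) (T.ty s2) (K (T.ty s1) n1) (K (T.ty s2) n2) \<cdot> \<langle>idn C V, u \<cdot> h\<rangle>"
  proof -
    have uh: "u \<cdot> h \<in> hom C V (T.ty s1 \<oplus> T.ty s2)"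
      using uvh h by (auto simp: hom_iff)
    \<comment> \<open>Postcomposition enters the branches because the two injections in context are
      jointly epic.\<close>
    have *: "\<alpha> ?Z \<cdot> T.cse V (T.ty s1) (T.ty s2) f g = T.cse V (T.ty s1) (T.ty s2) (\<alpha> ?Z \<cdot> f) (\<alpha> ?Z \<cdot> g)"
      if "f \<in> hom C (V \<otimes> T.ty s1) (fob T ?Z)" "g \<in> hom C (V \<otimes> T.ty s2) (fob T ?Z)" for f g
      by (rule T.distrib_eqI) (use that in \<open>auto simp: hom_iff\<close>)
    have "\<alpha> ?Z \<cdot> (T.cse W (T.ty s1) (T.ty s2) n1 n2 \<cdot> \<langle>idn C W, u\<rangle>) \<cdot> h
      = \<alpha> ?Z \<cdot> (T.cse W (T.ty s1) (T.ty s2) n1 n2 \<cdot> \<langle>h, u \<cdot> h\<rangle>)"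
      using uvh n h by (simp add: hom_iff)
    also have "\<dots> = (\<alpha> ?Z \<cdot> T.cse V (T.ty s1) (T.ty s2)
        (n1 \<cdot> under C h V (T.ty s1))
        (n2 \<cdot> under C h V (T.ty s2))) \<cdot> \<langle>idn C V, u \<cdot> h\<rangle>"
      by (subst T.cse_tup[OF _ _ _ _ _ h uh]) (use uvh n h in \<open>auto simp: hom_iff\<close>)
    also have "\<dots> = T.cse V (T.ty s1) (T.ty s2)
        (\<alpha> ?Z \<cdot> n1 \<cdot> under C h V (T.ty s1))
        (\<alpha> ?Z \<cdot> n2 \<cdot> under C h V (T.ty s2)) \<cdot> \<langle>idn C V, u \<cdot> h\<rangle>"
      by (subst *) (use uvh n h in \<open>auto simp: hom_iff\<close>)
    finally show ?thesis
      using U.bnd_cse[OF _ _ l(1) uh] n h by (simp add: K_def hom_iff)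
  qed
  have U: "U.bnd ?Z' \<Omega> ((T.cse W (U.ty s1) (U.ty s2) n1' n2' \<cdot> \<langle>idn C W, v\<rangle>) \<cdot> h) l'
    = T.cse V (U.ty s1) (U.ty s2) (K' (U.ty s1) n1') (K' (U.ty s2) n2') \<cdot> \<langle>idn C V, v \<cdot> h\<rangle>"
  proof -
    have vh: "v \<cdot> h \<in> hom C V (U.ty s1 \<oplus> U.ty s2)"
      using uvh h by (auto simp: hom_iff)
    have "(T.cse W (U.ty s1) (U.ty s2) n1' n2' \<cdot> \<langle>idn C W, v\<rangle>) \<cdot> h
      = T.cse W (U.ty s1) (U.ty s2) n1' n2' \<cdot> \<langle>h, v \<cdot> h\<rangle>"
      using uvh n h by (simp add: hom_iff)
    also have "\<dots> = T.cse V (U.ty s1) (U.ty s2)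
        (n1' \<cdot> under C h V (U.ty s1))
        (n2' \<cdot> under C h V (U.ty s2)) \<cdot> \<langle>idn C V, v \<cdot> h\<rangle>"
      by (rule T.cse_tup[OF _ _ _ _ _ h vh]) (use uvh n h in \<open>auto simp: hom_iff\<close>)
    finally show ?thesis
      using U.bnd_cse[OF _ _ l(2) vh] n h by (simp add: K'_def hom_iff)
  qed
  show "U.bnd ?Z \<Omega> (\<alpha> ?Z \<cdot> (T.cse W (T.ty s1) (T.ty s2) n1 n2 \<cdot> \<langle>idn C W, u\<rangle>) \<cdot> h) l
    = U.bnd ?Z' \<Omega> ((T.cse W (U.ty s1) (U.ty s2) n1' n2' \<cdot> \<langle>idn C W, v\<rangle>) \<cdot> h) l'"
    unfolding T U by (rule rel)
qed

lemma clift_bottom: "clift t W (T.bt (T.ty t) \<cdot> bang C W) (U.bt (U.ty t) \<cdot> bang C W)"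
  by (auto simp: lifted_def hom_iff mor_bottom)

text \<open>Each tested equation compares suprema of two sequences that agree term by term;
  continuity of \<open>bnd\<close> in its first argument gives this.\<close>

lemma clift_lub:
  assumes F: "T.chain_in W (fob T (T.ty t)) F" "T.lub_of W (fob T (T.ty t)) F f"
    and F': "T.chain_in W (fob U (U.ty t)) F'" "T.lub_of W (fob U (U.ty t)) F' f'"
    and c: "\<And>n. clift t W (F n) (F' n)"
  shows "clift t W f f'"
  unfolding lifted_def
proof (intro conjI allI impI)
  show fh: "f \<in> hom C W (fob T (T.ty t))" "f' \<in> hom C W (fob U (U.ty t))"
    using F F' by (auto simp: is_omega_lub_def)
  fix V h \<Omega> k k'
  assume h: "h \<in> hom C V W" and k: "k \<in> hom C (V \<otimes> T.ty t) (fob U \<Omega>)" "k' \<in> hom C (V \<otimes> U.ty t) (fob U \<Omega>)"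
    and ag: "agree (rel t) V k k'"
  have F_hom: "F n \<in> hom C W (fob T (T.ty t))" for n
    using F by (simp add: omega_chain_def)
  have "T.lub_of V (fob U \<Omega>) (\<lambda>n. U.bnd (T.ty t) \<Omega> (\<alpha> (T.ty t) \<cdot> F n \<cdot> h) k) (U.bnd (T.ty t) \<Omega> (\<alpha> (T.ty t) \<cdot> f \<cdot> h) k)"
    using U.bnd_lub[OF T.cmp_chain[OF T.precmp_chain[OF F(1) h] mor_hom]
        T.cmp_lub[OF T.precmp_chain[OF F(1) h] T.precmp_lub[OF F h] mor_hom] k(1)] .
  moreover have "T.lub_of V (fob U \<Omega>) (\<lambda>n. U.bnd (U.ty t) \<Omega> (F' n \<cdot> h) k') (U.bnd (U.ty t) \<Omega> (f' \<cdot> h) k')"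
    using U.bnd_lub[OF T.precmp_chain[OF F'(1) h] T.precmp_lub[OF F' h] k(2)] .
  moreover have "U.bnd (T.ty t) \<Omega> (\<alpha> (T.ty t) \<cdot> F n \<cdot> h) k = U.bnd (U.ty t) \<Omega> (F' n \<cdot> h) k'" for n
    using c[of n] h k ag unfolding lifted_def by blast
  ultimately show "U.bnd (T.ty t) \<Omega> (\<alpha> (T.ty t) \<cdot> f \<cdot> h) k = U.bnd (U.ty t) \<Omega> (f' \<cdot> h) k'"
    using T.lub_unique by simp
qed

text \<open>Evaluation at fixed arguments preserves suprema, which reduces this pointwise to
  \<open>clift_lub\<close>.\<close>

lemma rel_fun_lub:
  assumes F: "T.chain_in W (T.ty (TFun s t)) F" "T.lub_of W (T.ty (TFun s t)) F f"
    and F': "T.chain_in W (U.ty (TFun s t)) F'" "T.lub_of W (U.ty (TFun s t)) F' f'"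
    and c: "\<And>n. rel (TFun s t) W (F n) (F' n)"
  shows "rel (TFun s t) W f f'"
  unfolding rel.simps
proof (intro conjI allI impI)
  show "f \<in> hom C W (T.ty (TFun s t))" "f' \<in> hom C W (U.ty (TFun s t))"
    using F F' by (auto simp: is_omega_lub_def)
  fix V h x y
  assume h: "h \<in> hom C V W" and xy: "rel s V x y"
  then have xyh: "x \<in> hom C V (T.ty s)" "y \<in> hom C V (U.ty s)"
    using rel_hom by auto
  show "clift t V (ev C (T.ty s) (fob T (T.ty t)) \<cdot> \<langle>f \<cdot> h, x\<rangle>) (ev C (U.ty s) (fob U (U.ty t)) \<cdot> \<langle>f' \<cdot> h, y\<rangle>)"
    by (rule clift_lub[OF T.ev_tup_lub[OF F[simplified] h xyh(1)] U.ev_tup_lub[OF F'[simplified] h xyh(2)]])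
      (use c h xy in auto)
qed

text \<open>Fixed-point induction: all approximations are related, starting from
  \<open>clift_bottom\<close>, and \<open>rel_fun_lub\<close> passes to the supremum.\<close>

lemma rel_mu_fix:
  assumes \<phi>: "\<phi> \<in> hom C ((G \<otimes> (T.ty s \<leadsto> fob T (T.ty t))) \<otimes> T.ty s) (fob T (T.ty t))"
    and \<phi>': "\<phi>' \<in> hom C ((G' \<otimes> (U.ty s \<leadsto> fob U (U.ty t))) \<otimes> U.ty s) (fob U (U.ty t))"
    and \<gamma>: "\<gamma> \<in> hom C W G" "\<gamma>' \<in> hom C W G'"
    and c: "\<And>V h f f' x y. h \<in> hom C V W \<Longrightarrow> rel (TFun s t) V f f' \<Longrightarrow> rel s V x y \<Longrightarrow>
      clift t V (\<phi> \<cdot> \<langle>\<langle>\<gamma> \<cdot> h, f\<rangle>, x\<rangle>) (\<phi>' \<cdot> \<langle>\<langle>\<gamma>' \<cdot> h, f'\<rangle>, y\<rangle>)"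
  shows "rel (TFun s t) W (T.mu_fix G (T.ty s) (T.ty t) \<phi> \<cdot> \<gamma>) (U.mu_fix G' (U.ty s) (U.ty t) \<phi>' \<cdot> \<gamma>')"
proof (rule rel_fun_lub)
  let ?X = "T.ty s" and ?Z = "T.ty t" and ?X' = "U.ty s" and ?Z' = "U.ty t"
  show "T.chain_in W (T.ty (TFun s t)) (\<lambda>n. T.mu_seq G ?X ?Z \<phi> n \<cdot> \<gamma>)"
    using T.precmp_chain[OF T.mu_seq_chain[OF \<phi>] \<gamma>(1)] by simp
  show "T.lub_of W (T.ty (TFun s t)) (\<lambda>n. T.mu_seq G ?X ?Z \<phi> n \<cdot> \<gamma>) (T.mu_fix G ?X ?Z \<phi> \<cdot> \<gamma>)"
    using T.precmp_lub[OF T.mu_seq_chain[OF \<phi>] T.mu_fix_lub[OF \<phi>] \<gamma>(1)] by simp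
  show "T.chain_in W (U.ty (TFun s t)) (\<lambda>n. U.mu_seq G' ?X' ?Z' \<phi>' n \<cdot> \<gamma>')"
    using T.precmp_chain[OF U.mu_seq_chain[OF \<phi>'] \<gamma>(2)] by simp
  show "T.lub_of W (U.ty (TFun s t)) (\<lambda>n. U.mu_seq G' ?X' ?Z' \<phi>' n \<cdot> \<gamma>') (U.mu_fix G' ?X' ?Z' \<phi>' \<cdot> \<gamma>')"
    using T.precmp_lub[OF U.mu_seq_chain[OF \<phi>'] U.mu_fix_lub[OF \<phi>'] \<gamma>(2)] by simp
  fix n
  show "rel (TFun s t) W (T.mu_seq G ?X ?Z \<phi> n \<cdot> \<gamma>) (U.mu_seq G' ?X' ?Z' \<phi>' n \<cdot> \<gamma>')"
  proof (induction n)
    case 0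
    have "clift t V (ev C ?X (fob T ?Z) \<cdot> \<langle>(T.mu_seq G ?X ?Z \<phi> 0 \<cdot> \<gamma>) \<cdot> h, x\<rangle>)
        (ev C ?X' (fob U ?Z') \<cdot> \<langle>(U.mu_seq G' ?X' ?Z' \<phi>' 0 \<cdot> \<gamma>') \<cdot> h, y\<rangle>)"
      if "h \<in> hom C V W" "rel s V x y" for V h x y
      using clift_bottom[of t V] that(1) rel_hom[OF that(2)] \<gamma> by (simp add: hom_iff)
    then show ?case
      using \<gamma> by (auto simp: hom_iff)
  next
    case (Suc n)
    let ?p = "T.mu_seq G ?X ?Z \<phi> n" and ?p' = "U.mu_seq G' ?X' ?Z' \<phi>' n"
    note p = T.mu_seq_hom[OF \<phi>, of n] U.mu_seq_hom[OF \<phi>', of n]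
    have "clift t V (ev C ?X (fob T ?Z) \<cdot> \<langle>(T.mu_seq G ?X ?Z \<phi> (Suc n) \<cdot> \<gamma>) \<cdot> h, x\<rangle>)
        (ev C ?X' (fob U ?Z') \<cdot> \<langle>(U.mu_seq G' ?X' ?Z' \<phi>' (Suc n) \<cdot> \<gamma>') \<cdot> h, y\<rangle>)"
      if h: "h \<in> hom C V W" and xy: "rel s V x y" for V h x y
    proof -
      have "clift t V (\<phi> \<cdot> \<langle>\<langle>\<gamma> \<cdot> h, (?p \<cdot> \<gamma>) \<cdot> h\<rangle>, x\<rangle>) (\<phi>' \<cdot> \<langle>\<langle>\<gamma>' \<cdot> h, (?p' \<cdot> \<gamma>') \<cdot> h\<rangle>, y\<rangle>)"
        by (rule c[OF h rel_cmp[OF Suc h] xy])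
      moreover have "ev C ?X (fob T ?Z) \<cdot> \<langle>(T.mu_seq G ?X ?Z \<phi> (Suc n) \<cdot> \<gamma>) \<cdot> h, x\<rangle>
          = \<phi> \<cdot> \<langle>\<langle>\<gamma> \<cdot> h, (?p \<cdot> \<gamma>) \<cdot> h\<rangle>, x\<rangle>"
        using p(1) \<phi> h \<gamma> rel_hom[OF xy] by (simp add: hom_iff)
      moreover have "ev C ?X' (fob U ?Z') \<cdot> \<langle>(U.mu_seq G' ?X' ?Z' \<phi>' (Suc n) \<cdot> \<gamma>') \<cdot> h, y\<rangle>
          = \<phi>' \<cdot> \<langle>\<langle>\<gamma>' \<cdot> h, (?p' \<cdot> \<gamma>') \<cdot> h\<rangle>, y\<rangle>"
        using p(2) \<phi>' h \<gamma> rel_hom[OF xy] by (simp add: hom_iff)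
      ultimately show ?thesis by simp
    qed
    moreover have "T.mu_seq G ?X ?Z \<phi> (Suc n) \<cdot> \<gamma> \<in> hom C W (T.ty (TFun s t))"
      "U.mu_seq G' ?X' ?Z' \<phi>' (Suc n) \<cdot> \<gamma>' \<in> hom C W (U.ty (TFun s t))"
      using T.cmp_hom[OF \<gamma>(1) T.mu_seq_hom[OF \<phi>, of "Suc n"]] T.cmp_hom[OF \<gamma>(2) U.mu_seq_hom[OF \<phi>', of "Suc n"]]
      by simp_all
    ultimately show ?case
      by (simp only: rel.simps) blast
  qed
qed

text \<open>A stage that maps to \<open>\<zero>\<close> is initial, so all tested equations hold
  there. \<open>Abort\<close> needs this because its result type is arbitrary.\<close>

lemma rel_over_zero:
  assumes "z \<in> hom C W \<zero>" "u \<in> hom C W (T.ty t)" "v \<in> hom C W (U.ty t)"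
  shows "rel t W u v"
  using assms
proof (induction t arbitrary: W u v z)
  case (TProd s t)
  then show ?case by (fastforce simp: hom_iff)
next
  case (TSum s t)
  then show ?case
    using T.over_zero_eq[OF T.cmp_hom[OF _ TSum.prems(1)]] by (auto simp: hom_iff)
next
  case (TFun s t)
  have "lifted R X X' V m m'" if "h \<in> hom C V W" "m \<in> hom C V (fob T X)" "m' \<in> hom C V (fob U X')"
    for R X X' V h m m'
    using that T.over_zero_eq[OF T.cmp_hom[OF _ T.cmp_hom[OF that(1) TFun.prems(1)]]]
    by (auto simp: lifted_def hom_iff)
  then show ?case
    using TFun.prems(2,3) rel_hom by (fastforce simp: hom_iff)
qed (use T.over_zero_eq in \<open>fastforce simp: hom_iff\<close>)+

section \<open>Related environments and the fundamental lemma\<close>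

abbreviation "crel \<Gamma> \<equiv> rel (ctx_ty \<Gamma>)"

lemma crel_hom: "crel \<Gamma> W \<gamma> \<gamma>' \<Longrightarrow> \<gamma> \<in> hom C W (T.cx \<Gamma>) \<and> \<gamma>' \<in> hom C W (U.cx \<Gamma>)"
  using rel_hom by (simp add: sem_ctx_def)

lemma crel_Cons:
  assumes "crel \<Gamma> W \<gamma> \<gamma>'" "h \<in> hom C V W" "rel t V u v"
  shows "crel (t # \<Gamma>) V \<langle>\<gamma> \<cdot> h, u\<rangle> \<langle>\<gamma>' \<cdot> h, v\<rangle>"
  using rel_cmp[OF assms(1,2)] rel_hom[OF assms(1)] rel_hom[OF assms(3)] assms(2,3)
  by (simp add: hom_iff)

lemma rel_vp:
  "crel \<Gamma> W \<gamma> \<gamma>' \<Longrightarrow> i < length \<Gamma> \<Longrightarrow> rel (\<Gamma> ! i) W (T.vp \<Gamma> i \<cdot> \<gamma>) (U.vp \<Gamma> i \<cdot> \<gamma>')"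
proof (induction \<Gamma> arbitrary: i \<gamma> \<gamma>')
  case (Cons t \<Gamma>)
  have h: "\<gamma> \<in> hom C W (T.cx \<Gamma> \<otimes> T.ty t)" "\<gamma>' \<in> hom C W (U.cx \<Gamma> \<otimes> U.ty t)"
    using crel_hom[OF Cons.prems(1)] by simp_all
  show ?case
  proof (cases i)
    case 0
    then show ?thesis
      using Cons.prems(1) h by (simp add: sem_ctx_def)
  next
    case (Suc j)
    have "rel (\<Gamma> ! j) W (T.vp \<Gamma> j \<cdot> (pr1 C (T.cx \<Gamma>) (T.ty t) \<cdot> \<gamma>)) (U.vp \<Gamma> j \<cdot> (pr1 C (U.cx \<Gamma>) (U.ty t) \<cdot> \<gamma>'))"
      using Cons Suc by (simp add: sem_ctx_def)
    then show ?thesis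
      using T.vp_hom[of j \<Gamma>] U.vp_hom[of j \<Gamma>] h Suc Cons.prems(2) by (simp add: hom_iff)
  qed
qed simp

text \<open>Written with \<open>bnd\<close>, the effectful clauses are instances of
  \<open>clift_bnd\<close>. The environments are generalized elements at an arbitrary stage, so that
  binders can extend them at later stages.\<close>

lemma fundamental:
  assumes "typing \<Sigma> \<Gamma> M t" "crel \<Gamma> W \<gamma> \<gamma>'"
  shows "clift t W (T.sm \<Gamma> M \<cdot> \<gamma>) (U.sm \<Gamma> M \<cdot> \<gamma>')"
  using assms
proof (induction arbitrary: W \<gamma> \<gamma>' rule: typing.induct)
  case (Var \<Gamma> i)
  then show ?case
    using clift_ret[OF rel_vp[OF Var.prems Var.hyps(2)]] crel_hom[OF Var.prems]
      T.vp_hom[OF Var.hyps(2)] U.vp_hom[OF Var.hyps(2)] by (simp add: hom_iff)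
next
  case (Cst c \<Gamma> M)
  have eq: "U.ty (ar \<Sigma> (Inl c)) = T.ty (ar \<Sigma> (Inl c))" "U.ty (car \<Sigma> (Inl c)) = T.ty (car \<Sigma> (Inl c))"
    using ground_sig(1)[OF Cst.hyps(1)] by (auto intro: sem_ty_ground)
  have "clift (car \<Sigma> (Inl c)) W (far T (a (Inl c)) \<cdot> (T.sm \<Gamma> M \<cdot> \<gamma>)) (far U (a (Inl c)) \<cdot> (U.sm \<Gamma> M \<cdot> \<gamma>'))"
    by (rule clift_far[OF Cst.IH[OF Cst.prems]])
      (use T.const_hom[OF Cst.hyps(1)] ground_sig(1)[OF Cst.hyps(1)] in \<open>auto simp: eq rel_ground hom_iff\<close>)
  then show ?case
    using crel_hom[OF Cst.prems] T.sm_hom[OF Cst.hyps(2)] U.sm_hom[OF Cst.hyps(2)] T.const_hom[OF Cst.hyps(1)]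
    by (simp add: hom_iff eq mor_op_def)
next
  case (Eff e \<Gamma> M)
  let ?s = "ar \<Sigma> (Inr e)" and ?t = "car \<Sigma> (Inr e)"
  have eq: "U.ty ?s = T.ty ?s" "U.ty ?t = T.ty ?t"
    using ground_sig(2)[OF Eff.hyps(1)] by (auto intro: sem_ty_ground)
  have g: "\<gamma> \<in> hom C W (T.cx \<Gamma>)" "\<gamma>' \<in> hom C W (U.cx \<Gamma>)"
    using crel_hom[OF Eff.prems] by auto
  note M = T.sm_hom[OF Eff.hyps(2)] U.sm_hom[OF Eff.hyps(2)] and e = T.eff_hom[OF Eff.hyps(1)]
  have "clift ?t W (T.bnd (T.ty ?s) (T.ty ?t) (T.sm \<Gamma> M \<cdot> \<gamma>) (a (Inr e) \<cdot> pr2 C W (T.ty ?s)))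
    (U.bnd (U.ty ?s) (U.ty ?t) (U.sm \<Gamma> M \<cdot> \<gamma>') ((\<alpha> (T.ty ?t) \<cdot> a (Inr e)) \<cdot> pr2 C W (U.ty ?s)))"
  proof (rule clift_bnd[OF Eff.IH[OF Eff.prems]])
    fix V h u v
    assume h: "h \<in> hom C V W" and "rel ?s V u v"
    then have uv: "v = u" "u \<in> hom C V (T.ty ?s)"
      using ground_sig(2)[OF Eff.hyps(1)] by (auto simp: rel_ground)
    \<comment> \<open>The operation on the side of \<open>U\<close> is that of \<open>T\<close>
      followed by \<open>\<alpha>\<close>, which is the related pair that
      \<open>clift_ground\<close> provides.\<close>
    have "clift ?t V (a (Inr e) \<cdot> u) (\<alpha> (T.ty ?t) \<cdot> (a (Inr e) \<cdot> u))"
      by (rule clift_ground) (use ground_sig(2)[OF Eff.hyps(1)] T.cmp_hom[OF uv(2) e] in auto)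
    then show "clift ?t V ((a (Inr e) \<cdot> pr2 C W (T.ty ?s)) \<cdot> \<langle>h, u\<rangle>)
      (((\<alpha> (T.ty ?t) \<cdot> a (Inr e)) \<cdot> pr2 C W (U.ty ?s)) \<cdot> \<langle>h, v\<rangle>)"
      using h uv e by (simp add: hom_iff eq)
  qed (use e in \<open>auto simp: hom_iff eq\<close>)
  then show ?case
    using g M e by (simp add: hom_iff eq mor_op_def T.mul_far_eq_bnd U.mul_far_eq_bnd del: U.far_cmp_eq)
next
  case (Star \<Gamma>)
  have "clift TUnit W (ret T (T.ty TUnit) \<cdot> bang C W) (ret U (U.ty TUnit) \<cdot> bang C W)"
    by (rule clift_ret) (auto simp: hom_iff)
  then show ?case
    using crel_hom[OF Star.prems] by (simp add: hom_iff del: rel.simps)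
next
  case (Tup \<Gamma> M s N t)
  have g: "\<gamma> \<in> hom C W (T.cx \<Gamma>)" "\<gamma>' \<in> hom C W (U.cx \<Gamma>)"
    using crel_hom[OF Tup.prems] by auto
  note M = T.sm_hom[OF Tup.hyps(1)] U.sm_hom[OF Tup.hyps(1)]
  note N = T.sm_hom[OF Tup.hyps(2)] U.sm_hom[OF Tup.hyps(2)]
  let ?X = "T.ty s" and ?Z = "T.ty t" and ?X' = "U.ty s" and ?Z' = "U.ty t"
  have "clift (TProd s t) W
    (T.bnd ?X (T.ty (TProd s t)) (T.sm \<Gamma> M \<cdot> \<gamma>) (T.bnd ?Z (T.ty (TProd s t)) (T.sm \<Gamma> N \<cdot> \<gamma> \<cdot> pr1 C W ?X)
      (ret T (?X \<otimes> ?Z) \<cdot> under C (pr2 C W ?X) (W \<otimes> ?X) ?Z)))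
    (U.bnd ?X' (U.ty (TProd s t)) (U.sm \<Gamma> M \<cdot> \<gamma>') (U.bnd ?Z' (U.ty (TProd s t)) (U.sm \<Gamma> N \<cdot> \<gamma>' \<cdot> pr1 C W ?X')
      (ret U (?X' \<otimes> ?Z') \<cdot> under C (pr2 C W ?X') (W \<otimes> ?X') ?Z')))"
  proof (rule clift_bnd[OF Tup.IH(1)[OF Tup.prems]])
    fix V h u v
    assume h: "h \<in> hom C V W" and uv: "rel s V u v"
    have uvh: "u \<in> hom C V ?X" "v \<in> hom C V ?X'"
      using rel_hom[OF uv] by auto
    have "clift (TProd s t) V
      (T.bnd ?Z (T.ty (TProd s t)) ((T.sm \<Gamma> N \<cdot> \<gamma>) \<cdot> h) (ret T (?X \<otimes> ?Z) \<cdot> under C u V ?Z))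
      (U.bnd ?Z' (U.ty (TProd s t)) ((U.sm \<Gamma> N \<cdot> \<gamma>') \<cdot> h) (ret U (?X' \<otimes> ?Z') \<cdot> under C v V ?Z'))"
    proof (rule clift_bnd[OF lifted_cmp[OF Tup.IH(2)[OF Tup.prems] h]])
      fix V' h' u' v'
      assume h': "h' \<in> hom C V' V" and uv': "rel t V' u' v'"
      have "rel (TProd s t) V' \<langle>u \<cdot> h', u'\<rangle> \<langle>v \<cdot> h', v'\<rangle>"
        using rel_cmp[OF uv h'] uv' uvh rel_hom[OF uv'] h' by (simp add: hom_iff)
      from clift_ret[OF this]
      show "clift (TProd s t) V' ((ret T (?X \<otimes> ?Z) \<cdot> under C u V ?Z) \<cdot> \<langle>h', u'\<rangle>)
        ((ret U (?X' \<otimes> ?Z') \<cdot> under C v V ?Z') \<cdot> \<langle>h', v'\<rangle>)"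
        using uvh rel_hom[OF uv'] h' by (simp add: hom_iff)
    qed (use uvh in \<open>auto simp: hom_iff\<close>)
    then show "clift (TProd s t) V
      (T.bnd ?Z (T.ty (TProd s t)) (T.sm \<Gamma> N \<cdot> \<gamma> \<cdot> pr1 C W ?X)
        (ret T (?X \<otimes> ?Z) \<cdot> under C (pr2 C W ?X) (W \<otimes> ?X) ?Z) \<cdot> \<langle>h, u\<rangle>)
      (U.bnd ?Z' (U.ty (TProd s t)) (U.sm \<Gamma> N \<cdot> \<gamma>' \<cdot> pr1 C W ?X')
        (ret U (?X' \<otimes> ?Z') \<cdot> under C (pr2 C W ?X') (W \<otimes> ?X') ?Z') \<cdot> \<langle>h, v\<rangle>)"
      using uvh h g N by (simp add: hom_iff)
  qed (use g N in \<open>auto simp: hom_iff\<close>)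
  then show ?case
    using g M N by (simp add: T.sm_Tup[OF Tup.hyps] U.sm_Tup[OF Tup.hyps] hom_iff del: sem.simps rel.simps)
next
  case (Prj1 \<Gamma> M s t)
  have "clift s W (far T (pr1 C (T.ty s) (T.ty t)) \<cdot> (T.sm \<Gamma> M \<cdot> \<gamma>)) (far U (pr1 C (U.ty s) (U.ty t)) \<cdot> (U.sm \<Gamma> M \<cdot> \<gamma>'))"
    by (rule clift_far[OF Prj1.IH[OF Prj1.prems]]) (auto simp: hom_iff)
  then show ?case
    using crel_hom[OF Prj1.prems] T.sm_hom[OF Prj1.hyps] U.sm_hom[OF Prj1.hyps] Prj1.hyps
    by (simp add: hom_iff tyof_eq)
next
  case (Prj2 \<Gamma> M s t)
  have "clift t W (far T (pr2 C (T.ty s) (T.ty t)) \<cdot> (T.sm \<Gamma> M \<cdot> \<gamma>)) (far U (pr2 C (U.ty s) (U.ty t)) \<cdot> (U.sm \<Gamma> M \<cdot> \<gamma>'))"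
    by (rule clift_far[OF Prj2.IH[OF Prj2.prems]]) (auto simp: hom_iff)
  then show ?case
    using crel_hom[OF Prj2.prems] T.sm_hom[OF Prj2.hyps] U.sm_hom[OF Prj2.hyps] Prj2.hyps
    by (simp add: hom_iff tyof_eq)
next
  case (Abort \<Gamma> M t)
  have "clift t W (far T (cobang C (T.ty t)) \<cdot> (T.sm \<Gamma> M \<cdot> \<gamma>)) (far U (cobang C (U.ty t)) \<cdot> (U.sm \<Gamma> M \<cdot> \<gamma>'))"
  proof (rule clift_far[OF Abort.IH[OF Abort.prems]])
    fix V u v
    assume "rel TZero V u v"
    then show "rel t V (cobang C (T.ty t) \<cdot> u) (cobang C (U.ty t) \<cdot> v)"
      by (intro rel_over_zero[of u]) (auto simp: hom_iff)
  qed (auto simp: hom_iff)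
  then show ?case
    using crel_hom[OF Abort.prems] T.sm_hom[OF Abort.hyps(1)] U.sm_hom[OF Abort.hyps(1)]
    by (simp add: hom_iff)
next
  case (Inj1 \<Gamma> M s t)
  have "clift (TSum s t) W (far T (in1 C (T.ty s) (T.ty t)) \<cdot> (T.sm \<Gamma> M \<cdot> \<gamma>)) (far U (in1 C (U.ty s) (U.ty t)) \<cdot> (U.sm \<Gamma> M \<cdot> \<gamma>'))"
    by (rule clift_far[OF Inj1.IH[OF Inj1.prems] _ _ rel_in(1)]) (auto simp: hom_iff)
  then show ?case
    using crel_hom[OF Inj1.prems] T.sm_hom[OF Inj1.hyps(1)] U.sm_hom[OF Inj1.hyps(1)] Inj1.hyps
    by (simp add: hom_iff tyof_eq del: rel.simps)
next
  case (Inj2 \<Gamma> M t s)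
  have "clift (TSum s t) W (far T (in2 C (T.ty s) (T.ty t)) \<cdot> (T.sm \<Gamma> M \<cdot> \<gamma>)) (far U (in2 C (U.ty s) (U.ty t)) \<cdot> (U.sm \<Gamma> M \<cdot> \<gamma>'))"
    by (rule clift_far[OF Inj2.IH[OF Inj2.prems] _ _ rel_in(2)]) (auto simp: hom_iff)
  then show ?case
    using crel_hom[OF Inj2.prems] T.sm_hom[OF Inj2.hyps(1)] U.sm_hom[OF Inj2.hyps(1)] Inj2.hyps
    by (simp add: hom_iff tyof_eq del: rel.simps)
next
  case (Case \<Gamma> M t\<^sub>1 t\<^sub>2 N\<^sub>1 t N\<^sub>2)
  have g: "\<gamma> \<in> hom C W (T.cx \<Gamma>)" "\<gamma>' \<in> hom C W (U.cx \<Gamma>)"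
    using crel_hom[OF Case.prems] by auto
  let ?X1 = "T.ty t\<^sub>1" and ?X2 = "T.ty t\<^sub>2" and ?X1' = "U.ty t\<^sub>1" and ?X2' = "U.ty t\<^sub>2"
  note M = T.sm_hom[OF Case.hyps(1)] U.sm_hom[OF Case.hyps(1)]
  note N1 = T.sm_hom[OF Case.hyps(2)] U.sm_hom[OF Case.hyps(2)]
  note N2 = T.sm_hom[OF Case.hyps(3)] U.sm_hom[OF Case.hyps(3)]
  let ?N1 = "T.sm (t\<^sub>1 # \<Gamma>) N\<^sub>1 \<cdot> under C \<gamma> W ?X1"
  let ?N2 = "T.sm (t\<^sub>2 # \<Gamma>) N\<^sub>2 \<cdot> under C \<gamma> W ?X2"
  let ?N1' = "U.sm (t\<^sub>1 # \<Gamma>) N\<^sub>1 \<cdot> under C \<gamma>' W ?X1'"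
  let ?N2' = "U.sm (t\<^sub>2 # \<Gamma>) N\<^sub>2 \<cdot> under C \<gamma>' W ?X2'"
  have "clift t W
    (T.bnd (T.ty (TSum t\<^sub>1 t\<^sub>2)) (T.ty t) (T.sm \<Gamma> M \<cdot> \<gamma>) (T.cse W ?X1 ?X2 ?N1 ?N2))
    (U.bnd (U.ty (TSum t\<^sub>1 t\<^sub>2)) (U.ty t) (U.sm \<Gamma> M \<cdot> \<gamma>') (T.cse W ?X1' ?X2' ?N1' ?N2'))"
  proof (rule clift_bnd[OF Case.IH(1)[OF Case.prems]])
    fix V h u v
    assume h: "h \<in> hom C V W" and uv: "rel (TSum t\<^sub>1 t\<^sub>2) V u v"
    have uvh: "u \<in> hom C V (?X1 \<oplus> ?X2)" "v \<in> hom C V (?X1' \<oplus> ?X2')"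
      using rel_hom[OF uv] by auto
    let ?K1 = "T.sm (t\<^sub>1 # \<Gamma>) N\<^sub>1 \<cdot> \<langle>\<gamma> \<cdot> h \<cdot> pr1 C V ?X1, pr2 C V ?X1\<rangle>"
    let ?K2 = "T.sm (t\<^sub>2 # \<Gamma>) N\<^sub>2 \<cdot> \<langle>\<gamma> \<cdot> h \<cdot> pr1 C V ?X2, pr2 C V ?X2\<rangle>"
    let ?K1' = "U.sm (t\<^sub>1 # \<Gamma>) N\<^sub>1 \<cdot> \<langle>\<gamma>' \<cdot> h \<cdot> pr1 C V ?X1', pr2 C V ?X1'\<rangle>"
    let ?K2' = "U.sm (t\<^sub>2 # \<Gamma>) N\<^sub>2 \<cdot> \<langle>\<gamma>' \<cdot> h \<cdot> pr1 C V ?X2', pr2 C V ?X2'\<rangle>"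
    have "clift t V (T.cse V ?X1 ?X2 ?K1 ?K2 \<cdot> \<langle>idn C V, u\<rangle>) (T.cse V ?X1' ?X2' ?K1' ?K2' \<cdot> \<langle>idn C V, v\<rangle>)"
    proof (rule clift_cse[OF uv])
      fix V' h' x y
      assume h': "h' \<in> hom C V' V"
      have hh': "h \<cdot> h' \<in> hom C V' W"
        using h h' by (auto simp: hom_iff)
      {
        assume xy: "rel t\<^sub>1 V' x y"
        show "clift t V' (?K1 \<cdot> \<langle>h', x\<rangle>) (?K1' \<cdot> \<langle>h', y\<rangle>)"
          using Case.IH(2)[OF crel_Cons[OF Case.prems hh' xy]] rel_hom[OF xy] h h' g N1
          by (simp add: hom_iff)
      next
        assume xy: "rel t\<^sub>2 V' x y"
        show "clift t V' (?K2 \<cdot> \<langle>h', x\<rangle>) (?K2' \<cdot> \<langle>h', y\<rangle>)"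
          using Case.IH(3)[OF crel_Cons[OF Case.prems hh' xy]] rel_hom[OF xy] h h' g N2
          by (simp add: hom_iff)
      }
    qed (use h g N1 N2 in \<open>auto simp: hom_iff\<close>)
    moreover have "T.cse W ?X1 ?X2 ?N1 ?N2 \<cdot> \<langle>h, u\<rangle> = T.cse V ?X1 ?X2 ?K1 ?K2 \<cdot> \<langle>idn C V, u\<rangle>"
      by (subst T.cse_tup[OF _ _ _ _ _ h uvh(1)]) (use g h N1 N2 in \<open>auto simp: hom_iff\<close>)
    moreover have "T.cse W ?X1' ?X2' ?N1' ?N2' \<cdot> \<langle>h, v\<rangle> = T.cse V ?X1' ?X2' ?K1' ?K2' \<cdot> \<langle>idn C V, v\<rangle>"
      by (subst T.cse_tup[OF _ _ _ _ _ h uvh(2)]) (use g h N1 N2 in \<open>auto simp: hom_iff\<close>)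
    ultimately show "clift t V (T.cse W ?X1 ?X2 ?N1 ?N2 \<cdot> \<langle>h, u\<rangle>) (T.cse W ?X1' ?X2' ?N1' ?N2' \<cdot> \<langle>h, v\<rangle>)"
      by simp
  qed (use g N1 N2 in \<open>auto simp: hom_iff\<close>)
  then show ?case
    using g M N1 N2
    by (simp add: T.sm_Case[OF Case.hyps(1,2)] U.sm_Case[OF Case.hyps(1,2)] hom_iff T.cse_times del: sem.simps)
next
  case (Lam s \<Gamma> M t)
  have g: "\<gamma> \<in> hom C W (T.cx \<Gamma>)" "\<gamma>' \<in> hom C W (U.cx \<Gamma>)"
    using crel_hom[OF Lam.prems] by auto
  note M = T.sm_hom[OF Lam.hyps] U.sm_hom[OF Lam.hyps]
  have "rel (TFun s t) W (curry C (T.cx \<Gamma>) (T.ty s) (T.sm (s # \<Gamma>) M) \<cdot> \<gamma>) (curry C (U.cx \<Gamma>) (U.ty s) (U.sm (s # \<Gamma>) M) \<cdot> \<gamma>')"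
    unfolding rel.simps
  proof (intro conjI allI impI)
    fix V h x y
    assume h: "h \<in> hom C V W" and xy: "rel s V x y"
    show "clift t V
       (ev C (T.ty s) (fob T (T.ty t)) \<cdot> \<langle>(curry C (T.cx \<Gamma>) (T.ty s) (T.sm (s # \<Gamma>) M) \<cdot> \<gamma>) \<cdot> h, x\<rangle>)
       (ev C (U.ty s) (fob U (U.ty t)) \<cdot> \<langle>(curry C (U.cx \<Gamma>) (U.ty s) (U.sm (s # \<Gamma>) M) \<cdot> \<gamma>') \<cdot> h, y\<rangle>)"
      using Lam.IH[OF crel_Cons[OF Lam.prems h xy]] rel_hom[OF xy] h g M by (simp add: hom_iff)
  qed (use g M in \<open>auto simp: hom_iff\<close>)
  from clift_ret[OF this] show ?case
    using g M by (simp add: T.sm_Lam[OF Lam.hyps] U.sm_Lam[OF Lam.hyps] hom_iff del: sem.simps rel.simps)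
next
  case (App \<Gamma> M s t N)
  have g: "\<gamma> \<in> hom C W (T.cx \<Gamma>)" "\<gamma>' \<in> hom C W (U.cx \<Gamma>)"
    using crel_hom[OF App.prems] by auto
  note M = T.sm_hom[OF App.hyps(1)] U.sm_hom[OF App.hyps(1)]
  note N = T.sm_hom[OF App.hyps(2)] U.sm_hom[OF App.hyps(2)]
  let ?X = "T.ty s" and ?Z = "T.ty t" and ?X' = "U.ty s" and ?Z' = "U.ty t"
  let ?F = "T.ty (TFun s t)" and ?F' = "U.ty (TFun s t)"
  have "clift t W
    (T.bnd ?F ?Z (T.sm \<Gamma> M \<cdot> \<gamma>) (T.bnd ?X ?Z (T.sm \<Gamma> N \<cdot> \<gamma> \<cdot> pr1 C W ?F)
      (ev C ?X (fob T ?Z) \<cdot> under C (pr2 C W ?F) (W \<otimes> ?F) ?X)))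
    (U.bnd ?F' ?Z' (U.sm \<Gamma> M \<cdot> \<gamma>') (U.bnd ?X' ?Z' (U.sm \<Gamma> N \<cdot> \<gamma>' \<cdot> pr1 C W ?F')
      (ev C ?X' (fob U ?Z') \<cdot> under C (pr2 C W ?F') (W \<otimes> ?F') ?X')))"
  proof (rule clift_bnd[OF App.IH(1)[OF App.prems]])
    fix V h u v
    assume h: "h \<in> hom C V W" and uv: "rel (TFun s t) V u v"
    have uvh: "u \<in> hom C V ?F" "v \<in> hom C V ?F'"
      using rel_hom[OF uv] by auto
    have "clift t V
      (T.bnd ?X ?Z ((T.sm \<Gamma> N \<cdot> \<gamma>) \<cdot> h) (ev C ?X (fob T ?Z) \<cdot> under C u V ?X))
      (U.bnd ?X' ?Z' ((U.sm \<Gamma> N \<cdot> \<gamma>') \<cdot> h) (ev C ?X' (fob U ?Z') \<cdot> under C v V ?X'))"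
    proof (rule clift_bnd[OF lifted_cmp[OF App.IH(2)[OF App.prems] h]])
      fix V' h' u' v'
      assume h': "h' \<in> hom C V' V" and uv': "rel s V' u' v'"
      have "clift t V' (ev C ?X (fob T ?Z) \<cdot> \<langle>u \<cdot> h', u'\<rangle>) (ev C ?X' (fob U ?Z') \<cdot> \<langle>v \<cdot> h', v'\<rangle>)"
        using uv h' uv' by simp
      then show "clift t V' ((ev C ?X (fob T ?Z) \<cdot> under C u V ?X) \<cdot> \<langle>h', u'\<rangle>)
        ((ev C ?X' (fob U ?Z') \<cdot> under C v V ?X') \<cdot> \<langle>h', v'\<rangle>)"
        using uvh rel_hom[OF uv'] h' by (simp add: hom_iff)
    qed (use uvh in \<open>auto simp: hom_iff\<close>)
    then show "clift t V
      (T.bnd ?X ?Z (T.sm \<Gamma> N \<cdot> \<gamma> \<cdot> pr1 C W ?F)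
        (ev C ?X (fob T ?Z) \<cdot> under C (pr2 C W ?F) (W \<otimes> ?F) ?X) \<cdot> \<langle>h, u\<rangle>)
      (U.bnd ?X' ?Z' (U.sm \<Gamma> N \<cdot> \<gamma>' \<cdot> pr1 C W ?F')
        (ev C ?X' (fob U ?Z') \<cdot> under C (pr2 C W ?F') (W \<otimes> ?F') ?X') \<cdot> \<langle>h, v\<rangle>)"
      using uvh h g N by (simp add: hom_iff)
  qed (use g N in \<open>auto simp: hom_iff\<close>)
  then show ?case
    using g M N by (simp add: T.sm_App[OF App.hyps refl] U.sm_App[OF App.hyps refl] hom_iff del: sem.simps)
next
  case (Mu s t \<Gamma> M)
  have g: "\<gamma> \<in> hom C W (T.cx \<Gamma>)" "\<gamma>' \<in> hom C W (U.cx \<Gamma>)"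
    using crel_hom[OF Mu.prems] by auto
  have M: "T.sm (s # TFun s t # \<Gamma>) M \<in> hom C ((T.cx \<Gamma> \<otimes> (T.ty s \<leadsto> fob T (T.ty t))) \<otimes> T.ty s) (fob T (T.ty t))"
    using T.sm_hom[OF Mu.hyps] by simp
  have M': "U.sm (s # TFun s t # \<Gamma>) M \<in> hom C ((U.cx \<Gamma> \<otimes> (U.ty s \<leadsto> fob U (U.ty t))) \<otimes> U.ty s) (fob U (U.ty t))"
    using U.sm_hom[OF Mu.hyps] by simp
  have "rel (TFun s t) W (T.mu_fix (T.cx \<Gamma>) (T.ty s) (T.ty t) (T.sm (s # TFun s t # \<Gamma>) M) \<cdot> \<gamma>)
    (U.mu_fix (U.cx \<Gamma>) (U.ty s) (U.ty t) (U.sm (s # TFun s t # \<Gamma>) M) \<cdot> \<gamma>')"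
  proof (rule rel_mu_fix[OF M M' g])
    fix V h f f' x y
    assume h: "h \<in> hom C V W" and f: "rel (TFun s t) V f f'" and xy: "rel s V x y"
    \<comment> \<open>Adding the function moves the environment to stage \<open>V\<close>; the
      argument is added at that same stage, hence the identity.\<close>
    from crel_Cons[OF crel_Cons[OF Mu.prems h f] T.idn_hom xy]
    have "crel (s # TFun s t # \<Gamma>) V \<langle>\<langle>\<gamma> \<cdot> h, f\<rangle>, x\<rangle> \<langle>\<langle>\<gamma>' \<cdot> h, f'\<rangle>, y\<rangle>"
      using g h rel_hom[OF f] by (simp add: hom_iff del: rel.simps ctx_ty.simps)
    from Mu.IH[OF this] show "clift t V (T.sm (s # TFun s t # \<Gamma>) M \<cdot> \<langle>\<langle>\<gamma> \<cdot> h, f\<rangle>, x\<rangle>)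
      (U.sm (s # TFun s t # \<Gamma>) M \<cdot> \<langle>\<langle>\<gamma>' \<cdot> h, f'\<rangle>, y\<rangle>)" .
  qed
  from clift_ret[OF this] show ?case
    unfolding T.sm_Mu[OF M] U.sm_Mu[OF M']
    using T.mu_fix_hom[OF M] U.mu_fix_hom[OF M'] g by (simp add: hom_iff del: rel.simps)
qed

text \<open>At a ground context the identity environment is related to itself, so
  \<open>\<alpha>\<close> maps one interpretation of \<open>M\<close> to the other. The rest is the
  square of \<open>q\<close> and naturality of \<open>\<alpha>\<close> at the
  post-condition.\<close>

theorem wp_inference_query:
  assumes "typing \<Sigma> \<Gamma> M t" "\<forall>s \<in> set \<Gamma>. ground s" "ground t"
    and Q: "Q \<in> hom C (T.ty t) \<Omega>T"
    and \<tau>: "\<tau>T \<in> hom C (fob T \<Omega>T) \<Omega>T" "\<tau>U \<in> hom C (fob U \<Omega>U) \<Omega>U"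
    and q: "inference_query C U \<alpha> \<Omega>T \<tau>T \<Omega>U \<tau>U q"
  shows "q \<cdot> wp \<Sigma> C T bot0 A a \<tau>T \<Gamma> M Q
    = wp \<Sigma> C U (\<alpha> \<zero> \<cdot> bot0) A (mor_op \<Sigma> C T \<alpha> A a) \<tau>U \<Gamma> M (q \<cdot> Q)"
proof -
  have \<Gamma>: "ground (ctx_ty \<Gamma>)"
    using assms(2) by (simp add: ground_ctx_ty)
  have eq: "U.ty t = T.ty t" "U.cx \<Gamma> = T.cx \<Gamma>"
    using assms(3) \<Gamma> by (auto simp: sem_ctx_def intro: sem_ty_ground)
  have M: "T.sm \<Gamma> M \<in> hom C (T.cx \<Gamma>) (fob T (T.ty t))" "U.sm \<Gamma> M \<in> hom C (T.cx \<Gamma>) (fob U (T.ty t))"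
    using T.sm_hom[OF assms(1)] U.sm_hom[OF assms(1)] by (simp_all add: eq)
  have "crel \<Gamma> (T.cx \<Gamma>) (idn C (T.cx \<Gamma>)) (idn C (T.cx \<Gamma>))"
    using T.idn_hom by (simp add: rel_ground[OF \<Gamma>] sem_ctx_def)
  then have "clift t (T.cx \<Gamma>) (T.sm \<Gamma> M \<cdot> idn C (T.cx \<Gamma>)) (U.sm \<Gamma> M \<cdot> idn C (T.cx \<Gamma>))"
    by (rule fundamental[OF assms(1)])
  then have sm: "U.sm \<Gamma> M = \<alpha> (T.ty t) \<cdot> T.sm \<Gamma> M"
    using clift_groundD[OF assms(3)] M by (simp add: hom_iff)
  have qh: "q \<in> hom C \<Omega>T \<Omega>U" and q\<tau>: "q \<cdot> \<tau>T = \<tau>U \<cdot> far U q \<cdot> \<alpha> \<Omega>T"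
    using q by (auto simp: inference_query_def)
  have "q \<cdot> wp \<Sigma> C T bot0 A a \<tau>T \<Gamma> M Q = (q \<cdot> \<tau>T) \<cdot> far T Q \<cdot> T.sm \<Gamma> M"
    using qh \<tau> Q M by (simp add: wp_def hom_iff)
  also have "\<dots> = \<tau>U \<cdot> far U q \<cdot> (\<alpha> \<Omega>T \<cdot> far T Q) \<cdot> T.sm \<Gamma> M"
    unfolding q\<tau> using qh \<tau> Q M by (simp add: hom_iff)
  also have "\<dots> = wp \<Sigma> C U (\<alpha> \<zero> \<cdot> bot0) A (mor_op \<Sigma> C T \<alpha> A a) \<tau>U \<Gamma> M (q \<cdot> Q)"
    unfolding mor_natural[OF Q] wp_def sm using qh \<tau> Q M by (simp add: hom_iff)
  finally show ?thesis .
qed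

end

section \<open>State-passing style\<close>

lemma ground_circ: "ground t \<Longrightarrow> circ t = map_ty Some t"
  by (induction t) auto

lemma set_ty_circ: "set_ty t \<subseteq> bases \<Sigma> \<Longrightarrow> set_ty (circ t) \<subseteq> bases (sps_sig \<Sigma>)"
  by (induction t) (auto simp: sps_sig_def)

lemma bY_wf: "set_ty bY \<subseteq> bases (sps_sig \<Sigma>)"
  by (simp add: sps_sig_def)

lemma set_ty_sps_ty: "set_ty t \<subseteq> bases \<Sigma> \<Longrightarrow> set_ty (sps_ty t) \<subseteq> bases (sps_sig \<Sigma>)"
  using set_ty_circ[of t \<Sigma>] bY_wf by (simp add: sps_ty_def)

lemma wf_sps_ctx: "wf_ctx \<Sigma> \<Gamma> \<Longrightarrow> wf_ctx (sps_sig \<Sigma>) (sps_ctx \<Gamma>)"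
  using set_ty_circ bY_wf by (fastforce simp: wf_ctx_def sps_ctx_def)

lemma ctx_ty_map_circ: "ctx_ty (map circ \<Gamma>) = circ (ctx_ty \<Gamma>)"
  by (induction \<Gamma>) auto

lemma state_monad_simps [simp]:
  "fob (state_monad C T Y) X = (Y \<leadsto>\<^bsub>C\<^esub> fob T (X \<otimes>\<^bsub>C\<^esub> Y))"
  by (simp add: state_monad_def)

lemma sps_base_simps [simp]: "sps_base Y A None = Y" "sps_base Y A (Some b) = A b"
  by (simp_all add: sps_base_def)

text \<open>\<open>botS\<close> and \<open>botT\<close> are given independently of each other; that
  they correspond is derived in \<open>bottom_S\<close>.\<close>

locale sps_model = S: lcfix_model \<Sigma> C "state_monad C T Y" botS A a +
  T: lcfix_model "sps_sig \<Sigma>" C T botT "sps_base Y A" "sps_op \<Sigma> C T Y A a"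
  for \<Sigma> :: "('b, 'k, 'e) signature" and C :: "('o, 'm) bicc" (structure)
    and T :: "('o, 'm) smonad" and Y :: 'o and botS botT :: 'm and A :: "'b \<Rightarrow> 'o"
    and a :: "'k + 'e \<Rightarrow> 'm" +
  assumes wf_sig: "wf_signature \<Sigma>"
begin

abbreviation "SM \<equiv> state_monad C T Y"
abbreviation "rh \<equiv> rho C T Y A"
abbreviation "ri t \<equiv> inv_arr C (rho C T Y A t)"
abbreviation "rhc \<equiv> rho_ctx C T Y A"

text \<open>A state computation \<open>m\<close> is run from the state \<open>y\<close> and its
  result is transported along the isomorphism. This is what the translated term is shown to
  compute.\<close>

abbreviation run :: "'b ty \<Rightarrow> 'm \<Rightarrow> 'm \<Rightarrow> 'm" where
  "run t m y \<equiv> far T (under C (rh t) (S.ty t) Y) \<cdot> (ev C Y (fob T (S.ty t \<otimes> Y)) \<cdot> \<langle>m, y\<rangle>)"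

lemma ty_sps_ty [simp]: "T.ty (sps_ty t) = T.ty (circ t) \<otimes> Y"
  by (simp add: sps_ty_def)

lemma cx_sps_ctx [simp]: "T.cx (sps_ctx \<Gamma>) = T.cx (map circ \<Gamma>) \<otimes> Y"
  by (simp add: sps_ctx_def)

section \<open>The state monad evaluated at a state\<close>

lemma ev_expo_idn:
  assumes "f \<in> hom C X Z" "m \<in> hom C W (Y \<leadsto> X)" "y \<in> hom C W Y"
  shows "ev C Y Z \<cdot> \<langle>expo_arr C (idn C Y) f \<cdot> m, y\<rangle> = f \<cdot> (ev C Y X \<cdot> \<langle>m, y\<rangle>)"
  using assms by (simp add: hom_iff expo_arr_def Let_def)

lemma ev_ret_S [simp]:
  assumes "u \<in> arrs C" "y \<in> arrs C" "src C u = src C y" "tgt C u = X" "tgt C y = Y" "V = fob T (X \<otimes> Y)"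
  shows "ev C Y V \<cdot> \<langle>ret SM X \<cdot> u, y\<rangle> = ret T (X \<otimes> Y) \<cdot> \<langle>u, y\<rangle>"
  using assms by (simp add: state_monad_def)

lemma ev_far_S [simp]:
  assumes "m \<in> arrs C" "y \<in> arrs C" "src C m = src C y" "f \<in> arrs C" "tgt C m = (Y \<leadsto> fob T (src C f \<otimes> Y))"
    "tgt C y = Y" "V = fob T (tgt C f \<otimes> Y)"
  shows "ev C Y V \<cdot> \<langle>far SM f \<cdot> m, y\<rangle>
    = far T (under C f (src C f) Y) \<cdot> (ev C Y (fob T (src C f \<otimes> Y)) \<cdot> \<langle>m, y\<rangle>)"
proof -
  have "far SM f = expo_arr C (idn C Y) (far T (f \<otimes>\<^sub>a idn C Y))"
    by (simp add: state_monad_def)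
  then show ?thesis
    using assms by (simp add: ev_expo_idn hom_iff)
qed

lemma ev_mul_S [simp]:
  assumes "m \<in> arrs C" "y \<in> arrs C" "src C m = src C y" "tgt C m = fob SM (fob SM X)" "tgt C y = Y"
    "V = fob T (X \<otimes> Y)"
  shows "ev C Y V \<cdot> \<langle>mul SM X \<cdot> m, y\<rangle>
    = mul T (X \<otimes> Y) \<cdot> (far T (ev C Y (fob T (X \<otimes> Y))) \<cdot> (ev C Y (fob T (fob SM X \<otimes> Y)) \<cdot> \<langle>m, y\<rangle>))"
proof -
  have "mul SM X = expo_arr C (idn C Y) (mul T (X \<otimes> Y) \<cdot> far T (ev C Y (fob T (X \<otimes> Y))))"
    by (simp add: state_monad_def)
  then show ?thesis
    using assms by (simp add: ev_expo_idn hom_iff)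
qed

lemma ev_str_S:
  assumes "m \<in> hom C W (fob SM X)" "y \<in> hom C W Y"
  shows "ev C Y (fob T ((W \<otimes> X) \<otimes> Y)) \<cdot> \<langle>str SM W X \<cdot> \<langle>idn C W, m\<rangle>, y\<rangle>
    = far T (unassoc C W X Y) \<cdot> str T W (X \<otimes> Y) \<cdot> \<langle>idn C W, ev C Y (fob T (X \<otimes> Y)) \<cdot> \<langle>m, y\<rangle>\<rangle>"
proof -
  have "str SM W X = curry C (W \<otimes> fob SM X) Y (far T (unassoc C W X Y) \<cdot> str T W (X \<otimes> Y) \<cdot>
         (idn C W \<otimes>\<^sub>a ev C Y (fob T (X \<otimes> Y))) \<cdot> assoc C W (fob SM X) Y)"
    by (simp add: state_monad_def)
  then show ?thesis
    using assms by (simp add: hom_iff assoc_def unassoc_def)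
qed

text \<open>The strength of \<open>SM\<close> keeps the context outside the state, so after
  regrouping by \<open>unassoc\<close> the bound value is a pair of a result and a new state. As a
  rewrite rule this carries evaluation to the innermost computations.\<close>

lemma ev_bnd_S [simp]:
  assumes "m \<in> arrs C" "k \<in> arrs C" "y \<in> arrs C" "src C m = src C y" "tgt C y = Y"
    "tgt C m = fob SM X" "src C k = src C y \<otimes> X" "tgt C k = fob SM Z" "V = fob T (Z \<otimes> Y)"
  shows "ev C Y V \<cdot> \<langle>S.bnd X Z m k, y\<rangle>
    = T.bnd (X \<otimes> Y) (Z \<otimes> Y) (ev C Y (fob T (X \<otimes> Y)) \<cdot> \<langle>m, y\<rangle>)
        (ev C Y (fob T (Z \<otimes> Y)) \<cdot> \<langle>k \<cdot> \<langle>pr1 C (src C y) (X \<otimes> Y), pr1 C X Y \<cdot> pr2 C (src C y) (X \<otimes> Y)\<rangle>,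
           pr2 C X Y \<cdot> pr2 C (src C y) (X \<otimes> Y)\<rangle>)"
proof -
  let ?W = "src C y"
  let ?r = "str T ?W (X \<otimes> Y) \<cdot> \<langle>idn C ?W, ev C Y (fob T (X \<otimes> Y)) \<cdot> \<langle>m, y\<rangle>\<rangle>"
  have "ev C Y V \<cdot> \<langle>S.bnd X Z m k, y\<rangle> = mul T (Z \<otimes> Y) \<cdot> (far T (ev C Y (fob T (Z \<otimes> Y)))
     \<cdot> (far T (under C k (?W \<otimes> X) Y)
      \<cdot> (ev C Y (fob T ((?W \<otimes> X) \<otimes> Y)) \<cdot> \<langle>str SM ?W X \<cdot> \<langle>idn C ?W, m\<rangle>, y\<rangle>)))"
    using assms by (simp add: S.bnd_def)
  also have "\<dots> = mul T (Z \<otimes> Y) \<cdot> far T (ev C Y (fob T (Z \<otimes> Y)))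
     \<cdot> (far T (under C k (?W \<otimes> X) Y) \<cdot> (far T (unassoc C ?W X Y) \<cdot> ?r))"
    using assms ev_str_S[of m ?W X y] by (simp add: hom_iff)
  also have "far T (under C k (?W \<otimes> X) Y) \<cdot> (far T (unassoc C ?W X Y) \<cdot> ?r)
    = far T ((under C k (?W \<otimes> X) Y) \<cdot> unassoc C ?W X Y) \<cdot> ?r"
    by (subst T.far_cmp_eq) (use assms in \<open>simp_all add: unassoc_def\<close>)
  finally show ?thesis
    using assms by (simp add: T.bnd_def unassoc_def)
qed

text \<open>One inequality is leastness for \<open>S\<close>. The other is leastness for
  \<open>T\<close> after evaluation at a state, transposed back by monotonicity of
  \<open>curry\<close>.\<close>

lemma bottom_S: "S.bt Z \<cdot> bang C W = curry C W Y (T.bt (Z \<otimes> Y) \<cdot> bang C (W \<otimes> Y))"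
proof (rule S.le_antisym[of _ _ W "fob SM Z"])
  show "S.bt Z \<cdot> bang C W \<sqsubseteq> curry C W Y (T.bt (Z \<otimes> Y) \<cdot> bang C (W \<otimes> Y))"
    by (rule S.bottom_le) (auto simp: hom_iff)
  have "curry C W Y (T.bt (Z \<otimes> Y) \<cdot> bang C (W \<otimes> Y))
    \<sqsubseteq> curry C W Y (ev C Y (fob T (Z \<otimes> Y)) \<cdot> under C (S.bt Z \<cdot> bang C W) W Y)"
    by (rule S.curry_mono[OF T.bottom_le]) (auto simp: hom_iff)
  then show "curry C W Y (T.bt (Z \<otimes> Y) \<cdot> bang C (W \<otimes> Y)) \<sqsubseteq> S.bt Z \<cdot> bang C W"
    by (subst (asm) S.curry_eta) auto
qed (auto simp: hom_iff)

text \<open>The isomorphism at function types in applicative form. The facts about \<open>s\<close>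
  and \<open>t\<close> are assumptions because \<open>rho_iso\<close> uses this inside its
  induction.\<close>

lemma rho_fun:
  assumes s: "rh s \<in> hom C (S.ty s) (T.ty (circ s))" "ri s \<in> hom C (T.ty (circ s)) (S.ty s)"
    and t: "rh t \<in> hom C (S.ty t) (T.ty (circ t))"
  shows "rh (TFun s t) \<in> hom C (S.ty (TFun s t)) (T.ty (circ (TFun s t)))"
    and "\<lbrakk>u \<in> arrs C; p \<in> arrs C; src C u = src C p; tgt C u = S.ty (TFun s t); tgt C p = T.ty (circ s) \<otimes> Y;
        V = fob T (T.ty (circ t) \<otimes> Y); X' = T.ty (circ s) \<otimes> Y\<rbrakk> \<Longrightarrow>
      ev C X' V \<cdot> \<langle>rh (TFun s t) \<cdot> u, p\<rangle>
      = run t (ev C (S.ty s) (Y \<leadsto> fob T (S.ty t \<otimes> Y)) \<cdot> \<langle>u, ri s \<cdot> (pr1 C (T.ty (circ s)) Y \<cdot> p)\<rangle>) (pr2 C (T.ty (circ s)) Y \<cdot> p)"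
proof -
  have fS: "far SM (rh t) \<in> hom C (fob SM (S.ty t)) (fob SM (T.ty (circ t)))"
    using S.far_hom[OF t] .
  show "rh (TFun s t) \<in> hom C (S.ty (TFun s t)) (T.ty (circ (TFun s t)))"
    using s t fS by (simp add: hom_iff curry_iso_def Let_def expo_arr_def unassoc_def)
  assume p: "u \<in> arrs C" "p \<in> arrs C" "src C u = src C p" "tgt C u = S.ty (TFun s t)"
    "tgt C p = T.ty (circ s) \<otimes> Y" "V = fob T (T.ty (circ t) \<otimes> Y)" "X' = T.ty (circ s) \<otimes> Y"
  show "ev C X' V \<cdot> \<langle>rh (TFun s t) \<cdot> u, p\<rangle>
      = run t (ev C (S.ty s) (Y \<leadsto> fob T (S.ty t \<otimes> Y)) \<cdot> \<langle>u, ri s \<cdot> (pr1 C (T.ty (circ s)) Y \<cdot> p)\<rangle>) (pr2 C (T.ty (circ s)) Y \<cdot> p)"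
    using s t fS p by (simp add: hom_iff curry_iso_def Let_def expo_arr_def unassoc_def)
qed

text \<open>\<open>inv_arr\<close> is a definite description and occurs in \<open>rho\<close> at
  function types, so its defining properties have to be carried through the induction.\<close>

lemma rho_iso:
  "rh t \<in> hom C (S.ty t) (T.ty (circ t)) \<and> ri t \<in> hom C (T.ty (circ t)) (S.ty t) \<and>
   ri t \<cdot> rh t = idn C (S.ty t) \<and> rh t \<cdot> ri t = idn C (T.ty (circ t))"
proof (induction t)
  case (TBase b)
  then show ?case by (simp add: hom_iff)
next
  case TUnit
  then show ?case by (simp add: hom_iff)
next
  case TZero
  then show ?case by (simp add: hom_iff)
next
  case (TProd s t)
  have cmp: "ri s \<cdot> (rh s \<cdot> u) = u" "ri t \<cdot> (rh t \<cdot> v) = v"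
    if "u \<in> arrs C" "tgt C u = S.ty s" "v \<in> arrs C" "tgt C v = S.ty t" for u v
    using that TProd S.cmp_cmp[of u "rh s" "ri s"] S.cmp_cmp[of v "rh t" "ri t"] by (auto simp: hom_iff)
  have cmp': "rh s \<cdot> (ri s \<cdot> u) = u" "rh t \<cdot> (ri t \<cdot> v) = v"
    if "u \<in> arrs C" "tgt C u = T.ty (circ s)" "v \<in> arrs C" "tgt C v = T.ty (circ t)" for u v
    using that TProd S.cmp_cmp[of u "ri s" "rh s"] S.cmp_cmp[of v "ri t" "rh t"] by (auto simp: hom_iff)
  show ?case
    by (rule S.inv_arr_iso[of _ _ _ "ri s \<otimes>\<^sub>a ri t"])
      (use TProd cmp[of "pr1 C (S.ty s) (S.ty t)" "pr2 C (S.ty s) (S.ty t)"]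
        cmp'[of "pr1 C (T.ty (circ s)) (T.ty (circ t))" "pr2 C (T.ty (circ s)) (T.ty (circ t))"]
        in \<open>simp_all add: hom_iff\<close>)
next
  case (TSum s t)
  let ?g = "cotup C (in1 C (S.ty s) (S.ty t) \<cdot> ri s) (in2 C (S.ty s) (S.ty t) \<cdot> ri t)"
  show ?case
  proof (rule S.inv_arr_iso)
    show "rh (TSum s t) \<in> hom C (S.ty (TSum s t)) (T.ty (circ (TSum s t)))"
      "?g \<in> hom C (T.ty (circ (TSum s t))) (S.ty (TSum s t))"
      using TSum by (auto simp: hom_iff plus_arr_def)
    show "?g \<cdot> rh (TSum s t) = idn C (S.ty (TSum s t))"
      by (rule S.sum_eqI[of _ "S.ty s" "S.ty t" "S.ty (TSum s t)"])
        (use TSum in \<open>simp_all add: hom_iff plus_arr_def\<close>)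
    show "rh (TSum s t) \<cdot> ?g = idn C (T.ty (circ (TSum s t)))"
      by (rule S.sum_eqI[of _ "T.ty (circ s)" "T.ty (circ t)" "T.ty (circ (TSum s t))"])
        (use TSum in \<open>simp_all add: hom_iff plus_arr_def\<close>)
  qed
next
  case (TFun s t)
  have s: "rh s \<in> hom C (S.ty s) (T.ty (circ s))" "ri s \<in> hom C (T.ty (circ s)) (S.ty s)"
    and t: "rh t \<in> hom C (S.ty t) (T.ty (circ t))" "ri t \<in> hom C (T.ty (circ t)) (S.ty t)"
    using TFun by auto
  note rh = rho_fun[OF s t(1)]
  let ?X = "S.ty s" and ?Z = "S.ty t" and ?X' = "T.ty (circ s)" and ?Z' = "T.ty (circ t)"
  let ?F = "S.ty (TFun s t)" and ?F' = "T.ty (circ (TFun s t))"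
  \<comment> \<open>The inverse conjugates the other way: transport the argument by
    \<open>rh s\<close>, run the function from the state, and transport the result back by
    \<open>ri t\<close>.\<close>
  define g where "g = curry C ?F' ?X (curry C (?F' \<otimes> ?X) Y (far T (ri t \<otimes>\<^sub>a idn C Y) \<cdot>
    (ev C (?X' \<otimes> Y) (fob T (?Z' \<otimes> Y)) \<cdot> \<langle>pr1 C ?F' ?X \<cdot> pr1 C (?F' \<otimes> ?X) Y,
      \<langle>rh s \<cdot> pr2 C ?F' ?X \<cdot> pr1 C (?F' \<otimes> ?X) Y, pr2 C (?F' \<otimes> ?X) Y\<rangle>\<rangle>)))"
  have g: "g \<in> hom C ?F' ?F"
    using s t by (simp add: g_def hom_iff)
  have cmp: "ri s \<cdot> (rh s \<cdot> u) = u" if "u \<in> arrs C" "tgt C u = ?X" for u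
    using that TFun(1) S.cmp_cmp[of u "rh s" "ri s"] by (simp add: hom_iff)
  have cmp': "rh s \<cdot> (ri s \<cdot> u) = u" if "u \<in> arrs C" "tgt C u = ?X'" for u
    using that TFun(1) S.cmp_cmp[of u "ri s" "rh s"] by (simp add: hom_iff)
  \<comment> \<open>Functoriality turns the inverse laws for \<open>t\<close> into inverse laws
    under \<open>fob T\<close>.\<close>
  have far1: "far T (under C (ri t) ?Z' Y) \<cdot> (far T (under C (rh t) ?Z Y) \<cdot> u) = u"
    if "u \<in> arrs C" "tgt C u = fob T (?Z \<otimes> Y)" for u
  proof -
    have "under C (ri t) ?Z' Y \<cdot> under C (rh t) ?Z Y = idn C (?Z \<otimes> Y)"
      using TFun(2) S.cmp_cmp[of "pr1 C ?Z Y" "rh t" "ri t"] by (simp add: hom_iff)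
    from arg_cong[OF this, of "\<lambda>x. far T x \<cdot> u"] show ?thesis
      using that t by (subst (asm) T.far_cmp_eq) (simp_all add: hom_iff)
  qed
  have far2: "far T (under C (rh t) ?Z Y) \<cdot> (far T (under C (ri t) ?Z' Y) \<cdot> u) = u"
    if "u \<in> arrs C" "tgt C u = fob T (?Z' \<otimes> Y)" for u
  proof -
    have "under C (rh t) ?Z Y \<cdot> under C (ri t) ?Z' Y = idn C (?Z' \<otimes> Y)"
      using TFun(2) S.cmp_cmp[of "pr1 C ?Z' Y" "ri t" "rh t"] by (simp add: hom_iff)
    from arg_cong[OF this, of "\<lambda>x. far T x \<cdot> u"] show ?thesis
      using that t by (subst (asm) T.far_cmp_eq) (simp_all add: hom_iff)
  qed
  have gr: "g \<cdot> rh (TFun s t) = idn C ?F"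
  proof (rule S.expo_eqI)
    show "g \<cdot> rh (TFun s t) \<in> hom C ?F (?X \<leadsto> (Y \<leadsto> fob T (?Z \<otimes> Y)))"
      "idn C ?F \<in> hom C ?F (?X \<leadsto> (Y \<leadsto> fob T (?Z \<otimes> Y)))"
      using S.cmp_hom[OF rh(1) g] by (simp_all add: hom_iff)
    show "ev C ?X (Y \<leadsto> fob T (?Z \<otimes> Y)) \<cdot> under C (g \<cdot> rh (TFun s t)) ?F ?X
      = ev C ?X (Y \<leadsto> fob T (?Z \<otimes> Y)) \<cdot> under C (idn C ?F) ?F ?X"
      by (rule S.expo_eqI[of _ "?F \<otimes> ?X" Y "fob T (?Z \<otimes> Y)"])
        (use rh s t in \<open>simp_all add: hom_iff g_def far1 cmp del: rho.simps\<close>)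
  qed
  have rg: "rh (TFun s t) \<cdot> g = idn C ?F'"
  proof (rule S.expo_eqI)
    show "rh (TFun s t) \<cdot> g \<in> hom C ?F' ((?X' \<otimes> Y) \<leadsto> fob T (?Z' \<otimes> Y))"
      "idn C ?F' \<in> hom C ?F' ((?X' \<otimes> Y) \<leadsto> fob T (?Z' \<otimes> Y))"
      using S.cmp_hom[OF g rh(1)] by (simp_all add: hom_iff)
    show "ev C (?X' \<otimes> Y) (fob T (?Z' \<otimes> Y)) \<cdot> under C (rh (TFun s t) \<cdot> g) ?F' (?X' \<otimes> Y)
      = ev C (?X' \<otimes> Y) (fob T (?Z' \<otimes> Y)) \<cdot> under C (idn C ?F') ?F' (?X' \<otimes> Y)"
      using rh s t by (simp add: hom_iff g_def far2 cmp' del: rho.simps)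
  qed
  show ?case
    by (rule S.inv_arr_iso[OF rh(1) g gr rg])
qed

declare rho.simps(6) [simp del]

lemma rh_simps [simp]:
  "rh t \<in> arrs C" "src C (rh t) = S.ty t" "tgt C (rh t) = T.ty (circ t)"
  "ri t \<in> arrs C" "src C (ri t) = T.ty (circ t)" "tgt C (ri t) = S.ty t"
  "ri t \<cdot> rh t = idn C (S.ty t)" "rh t \<cdot> ri t = idn C (T.ty (circ t))"
  using rho_iso[of t] by (auto simp: hom_iff)

lemma rh_ri_cmp [simp]:
  "u \<in> arrs C \<Longrightarrow> tgt C u = S.ty t \<Longrightarrow> ri t \<cdot> (rh t \<cdot> u) = u"
  "u \<in> arrs C \<Longrightarrow> tgt C u = T.ty (circ t) \<Longrightarrow> rh t \<cdot> (ri t \<cdot> u) = u"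
  by (simp_all flip: S.cmp_cmp)

lemma ev_rho_fun [simp]:
  "\<lbrakk>u \<in> arrs C; p \<in> arrs C; src C u = src C p; tgt C u = S.ty (TFun s t); tgt C p = T.ty (circ s) \<otimes> Y;
    V = fob T (T.ty (circ t) \<otimes> Y); X' = T.ty (circ s) \<otimes> Y\<rbrakk> \<Longrightarrow>
    ev C X' V \<cdot> \<langle>rh (TFun s t) \<cdot> u, p\<rangle>
      = run t (ev C (S.ty s) (Y \<leadsto> fob T (S.ty t \<otimes> Y)) \<cdot> \<langle>u, ri s \<cdot> (pr1 C (T.ty (circ s)) Y \<cdot> p)\<rangle>) (pr2 C (T.ty (circ s)) Y \<cdot> p)"
  by (rule rho_fun(2)) (auto simp: hom_iff)

lemma rh_ground: "ground t \<Longrightarrow> rh t = idn C (S.ty t)"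
proof (induction t)
  case (TSum s t)
  show ?case
    by (rule S.sum_eqI[of _ "S.ty s" "S.ty t" "S.ty (TSum s t)"])
      (use TSum rh_simps(3)[of s] rh_simps(3)[of t] in \<open>simp_all add: plus_arr_def hom_iff\<close>)
qed auto

text \<open>\<open>rh t\<close> is an identity, so its source and target coincide.\<close>

lemma ty_ground: "ground t \<Longrightarrow> T.ty (circ t) = S.ty t"
  using rh_simps(3)[of t] by (simp add: rh_ground)

lemma rhc_simps [simp]:
  "rhc \<Gamma> \<in> arrs C" "src C (rhc \<Gamma>) = S.cx \<Gamma>" "tgt C (rhc \<Gamma>) = T.cx (map circ \<Gamma>)"
  "rhc (t # \<Gamma>) = \<langle>rhc \<Gamma> \<cdot> pr1 C (S.cx \<Gamma>) (S.ty t), rh t \<cdot> pr2 C (S.cx \<Gamma>) (S.ty t)\<rangle>"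
  by (simp_all add: rho_ctx_def sem_ctx_def ctx_ty_map_circ)

lemma rho_vp:
  "i < length \<Gamma> \<Longrightarrow> T.vp (map circ \<Gamma>) i \<cdot> rhc \<Gamma> = rh (\<Gamma> ! i) \<cdot> S.vp \<Gamma> i"
proof (induction \<Gamma> arbitrary: i)
  case (Cons t \<Gamma>)
  show ?case
  proof (cases i)
    case (Suc j)
    have "(T.vp (map circ \<Gamma>) j \<cdot> rhc \<Gamma>) \<cdot> pr1 C (S.cx \<Gamma>) (S.ty t)
      = (rh (\<Gamma> ! j) \<cdot> S.vp \<Gamma> j) \<cdot> pr1 C (S.cx \<Gamma>) (S.ty t)"
      using Cons Suc by simp
    then show ?thesis
      using Suc Cons.prems T.vp_hom[of j "map circ \<Gamma>"] S.vp_hom[of j \<Gamma>] by (simp add: hom_iff)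
  qed simp
qed simp

section \<open>Renamings and substitutions used by the translation\<close>

lemma sps_wf:
  assumes "typing \<Sigma> \<Gamma> M t"
  shows "wf_ctx (sps_sig \<Sigma>) (sps_ctx \<Gamma>)" "set_ty (circ t) \<subseteq> bases (sps_sig \<Sigma>)"
    "set_ty (sps_ty t) \<subseteq> bases (sps_sig \<Sigma>)"
  using wf_sps_ctx[OF typing_wf_ctx[OF assms]] set_ty_circ[OF typing_wf_ty[OF wf_sig assms]]
    set_ty_sps_ty[OF typing_wf_ty[OF wf_sig assms]] .

text \<open>The new context has the inner \<open>y\<close> above \<open>z\<close> and the outer
  \<open>y\<close>. The arrow keeps the environment and the inner state and forgets the other
  two.\<close>

lemma sps_ren_ok:
  assumes "wf_ctx (sps_sig \<Sigma>) (sps_ctx \<Gamma>)" "set_ty z \<subseteq> bases (sps_sig \<Sigma>)"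
  shows "T.subst_ok (bY # z # sps_ctx \<Gamma>) (Var \<circ> sps_ren) (sps_ctx \<Gamma>)
    \<langle>pr1 C (T.cx (map circ \<Gamma>)) Y \<cdot> pr1 C (T.cx (map circ \<Gamma>) \<otimes> Y) (T.ty z) \<cdot> pr1 C ((T.cx (map circ \<Gamma>) \<otimes> Y) \<otimes> T.ty z) Y,
     pr2 C ((T.cx (map circ \<Gamma>) \<otimes> Y) \<otimes> T.ty z) Y\<rangle>"
    (is "T.subst_ok ?\<Delta> _ _ ?\<theta>")
proof (rule T.subst_okI)
  show wf: "wf_ctx (sps_sig \<Sigma>) ?\<Delta>"
    using assms bY_wf by simp
  fix i
  assume i: "i < length (sps_ctx \<Gamma>)"
  show "simple_trm ((Var \<circ> sps_ren) i) \<and> T.pure ?\<Delta> ((Var \<circ> sps_ren) i) (sps_ctx \<Gamma> ! i) (T.vp (sps_ctx \<Gamma>) i \<cdot> ?\<theta>)"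
  proof (cases i)
    case 0
    then show ?thesis
      using T.pure_Var[OF wf, of 0] by (simp add: sps_ren_def simple_trm_def sps_ctx_def)
  next
    case (Suc j)
    then show ?thesis
      using T.pure_Var[OF wf, of "j + 3"] T.vp_hom[of j "map circ \<Gamma>"] i
      by (simp add: sps_ren_def simple_trm_def sps_ctx_def numeral_3_eq_3 hom_iff)
  qed
qed (simp add: hom_iff)

text \<open>Value and state both come from the pair \<open>z\<close>, while the outer state held in
  \<open>sps_ctx \<Gamma>\<close> is dropped.\<close>

lemma sps_sub_ok:
  assumes "wf_ctx (sps_sig \<Sigma>) (sps_ctx \<Gamma>)" "set_ty (sps_ty t) \<subseteq> bases (sps_sig \<Sigma>)"
    "G = T.cx (map circ \<Gamma>)" "X = T.ty (circ t)"
  shows "T.subst_ok (sps_ty t # sps_ctx \<Gamma>) sps_sub (sps_ctx (t # \<Gamma>))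
    \<langle>\<langle>pr1 C G Y \<cdot> pr1 C (G \<otimes> Y) (X \<otimes> Y), pr1 C X Y \<cdot> pr2 C (G \<otimes> Y) (X \<otimes> Y)\<rangle>, pr2 C X Y \<cdot> pr2 C (G \<otimes> Y) (X \<otimes> Y)\<rangle>"
    (is "T.subst_ok ?\<Delta> _ _ ?\<theta>")
proof (rule T.subst_okI)
  show wf: "wf_ctx (sps_sig \<Sigma>) ?\<Delta>"
    using assms by simp
  have z: "T.pure ?\<Delta> (Var 0) (TProd (circ t) bY) (pr2 C (G \<otimes> Y) (X \<otimes> Y))"
    using T.pure_Var[OF wf, of 0] assms by (simp add: sps_ty_def)
  fix i
  assume i: "i < length (sps_ctx (t # \<Gamma>))"
  consider "i = 0" | "i = 1" | j where "i = Suc (Suc j)"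
    using not0_implies_Suc by (metis One_nat_def)
  then show "simple_trm (sps_sub i :: ('b option, 'k, 'e) trm) \<and>
      T.pure ?\<Delta> (sps_sub i) (sps_ctx (t # \<Gamma>) ! i) (T.vp (sps_ctx (t # \<Gamma>)) i \<cdot> ?\<theta>)"
  proof cases
    case 1
    then show ?thesis
      using T.pure_Prj2[OF z] assms by (auto simp: sps_sub_def simple_trm_def sps_ctx_def)
  next
    case 2
    then show ?thesis
      using T.pure_Prj1[OF z] assms by (auto simp: sps_sub_def simple_trm_def sps_ctx_def)
  next
    case 3
    then show ?thesis
      using T.pure_Var[OF wf, of i] T.vp_hom[of j "map circ \<Gamma>"] i assms
      by (auto simp: sps_sub_def simple_trm_def sps_ctx_def hom_iff)
  qed
qed (use assms in \<open>simp add: hom_iff\<close>)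

lemma sps_sub_mu_ok:
  assumes "wf_ctx (sps_sig \<Sigma>) (sps_ctx \<Gamma>)" "set_ty (sps_ty s) \<subseteq> bases (sps_sig \<Sigma>)"
    "set_ty (circ (TFun s t)) \<subseteq> bases (sps_sig \<Sigma>)"
    "G = T.cx (map circ \<Gamma>)" "X = T.ty (circ s)" "F = T.ty (circ (TFun s t))"
  shows "T.subst_ok (sps_ty s # TFun (sps_ty s) (sps_ty t) # sps_ctx \<Gamma>) sps_sub_mu (sps_ctx (s # TFun s t # \<Gamma>))
    \<langle>\<langle>\<langle>pr1 C G Y \<cdot> pr1 C (G \<otimes> Y) F \<cdot> pr1 C ((G \<otimes> Y) \<otimes> F) (X \<otimes> Y), pr2 C (G \<otimes> Y) F \<cdot> pr1 C ((G \<otimes> Y) \<otimes> F) (X \<otimes> Y)\<rangle>,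
      pr1 C X Y \<cdot> pr2 C ((G \<otimes> Y) \<otimes> F) (X \<otimes> Y)\<rangle>, pr2 C X Y \<cdot> pr2 C ((G \<otimes> Y) \<otimes> F) (X \<otimes> Y)\<rangle>"
    (is "T.subst_ok ?\<Delta> _ _ ?\<theta>")
proof (rule T.subst_okI)
  have F: "TFun (sps_ty s) (sps_ty t) = circ (TFun s t)"
    by (simp add: sps_ty_def)
  show wf: "wf_ctx (sps_sig \<Sigma>) ?\<Delta>"
    unfolding F using assms by simp
  have z: "T.pure ?\<Delta> (Var 0) (TProd (circ s) bY) (pr2 C ((G \<otimes> Y) \<otimes> F) (X \<otimes> Y))"
    using T.pure_Var[OF wf, of 0] assms by (simp add: sps_ty_def)
  fix i
  assume i: "i < length (sps_ctx (s # TFun s t # \<Gamma>))"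
  consider "i = 0" | "i = 1" | "i = 2" | j where "i = Suc (Suc (Suc j))"
    using not0_implies_Suc by (metis One_nat_def numeral_2_eq_2)
  then show "simple_trm (sps_sub_mu i :: ('b option, 'k, 'e) trm) \<and>
      T.pure ?\<Delta> (sps_sub_mu i) (sps_ctx (s # TFun s t # \<Gamma>) ! i) (T.vp (sps_ctx (s # TFun s t # \<Gamma>)) i \<cdot> ?\<theta>)"
  proof cases
    case 1
    then show ?thesis
      using T.pure_Prj2[OF z] assms by (auto simp: sps_sub_mu_def simple_trm_def sps_ctx_def)
  next
    case 2
    then show ?thesis
      using T.pure_Prj1[OF z] assms by (auto simp: sps_sub_mu_def simple_trm_def sps_ctx_def)
  next
    case 3
    then show ?thesis
      using T.pure_Var[OF wf, of 1] assms
      by (auto simp: sps_sub_mu_def simple_trm_def sps_ctx_def sps_ty_def numeral_2_eq_2)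
  next
    case 4
    then show ?thesis
      using T.pure_Var[OF wf, of i] T.vp_hom[of j "map circ \<Gamma>"] i assms
      by (auto simp: sps_sub_mu_def simple_trm_def sps_ctx_def hom_iff)
  qed
qed (use assms in \<open>simp add: hom_iff\<close>)

text \<open>This redex hands the state in \<open>z\<close> to the translation of a term. Its
  argument is a value, so the binding of \<open>sm_App_Lam\<close> collapses to replacing the state
  in the environment.\<close>

lemma app_lam_y:
  assumes N: "typing (sps_sig \<Sigma>) (sps_ctx \<Gamma>) N r" and s: "set_ty s \<subseteq> bases (sps_sig \<Sigma>)"
    and G: "G = T.cx (map circ \<Gamma>)" and X: "X = T.ty s"
  shows "typing (sps_sig \<Sigma>) (TProd s bY # sps_ctx \<Gamma>) (App (Lam bY (ren sps_ren N)) (Prj2 (Var 0))) r"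
    and "T.sm (TProd s bY # sps_ctx \<Gamma>) (App (Lam bY (ren sps_ren N)) (Prj2 (Var 0)))
      = T.sm (sps_ctx \<Gamma>) N \<cdot> \<langle>pr1 C G Y \<cdot> pr1 C (G \<otimes> Y) (X \<otimes> Y), pr2 C X Y \<cdot> pr2 C (G \<otimes> Y) (X \<otimes> Y)\<rangle>"
proof -
  have wf: "wf_ctx (sps_sig \<Sigma>) (TProd s bY # sps_ctx \<Gamma>)"
    using typing_wf_ctx[OF N] s bY_wf by simp
  have z: "T.pure (TProd s bY # sps_ctx \<Gamma>) (Prj2 (Var 0)) bY (pr2 C X Y \<cdot> pr2 C (G \<otimes> Y) (X \<otimes> Y))"
    using T.pure_Prj2[OF T.pure_Var[OF wf, of 0, simplified]] G X by simp
  have "set_ty (TProd s bY) \<subseteq> bases (sps_sig \<Sigma>)"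
    using wf by simp
  note r = T.sub_sem[OF N sps_ren_ok[OF typing_wf_ctx[OF N] this], folded ren_eq_sub]
  show "typing (sps_sig \<Sigma>) (TProd s bY # sps_ctx \<Gamma>) (App (Lam bY (ren sps_ren N)) (Prj2 (Var 0))) r"
    using r z by (auto simp: T.pure_def intro!: typing.App[of _ _ _ bY] typing.Lam)
  show "T.sm (TProd s bY # sps_ctx \<Gamma>) (App (Lam bY (ren sps_ren N)) (Prj2 (Var 0)))
      = T.sm (sps_ctx \<Gamma>) N \<cdot> \<langle>pr1 C G Y \<cdot> pr1 C (G \<otimes> Y) (X \<otimes> Y), pr2 C X Y \<cdot> pr2 C (G \<otimes> Y) (X \<otimes> Y)\<rangle>"
    using T.sm_App_Lam[OF conjunct1[OF r]] r z T.sm_hom[OF N] G X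
    by (simp add: T.pure_def hom_iff del: sem.simps)
qed

text \<open>The equation is stated for generalized elements \<open>\<gamma>\<close> and
  \<open>y\<close>, so that it can rewrite at any stage inside nested bindings. Typing is included
  because the meaning of a translated term depends on its type through \<open>tyof\<close>.\<close>

definition sps_ok :: "'b ctx \<Rightarrow> ('b, 'k, 'e) trm \<Rightarrow> 'b ty \<Rightarrow> bool" where
  "sps_ok \<Gamma> M t \<longleftrightarrow> typing (sps_sig \<Sigma>) (sps_ctx \<Gamma>) (sps \<Sigma> \<Gamma> M) (sps_ty t) \<and>
    (\<forall>\<gamma> y. \<gamma> \<in> arrs C \<longrightarrow> y \<in> arrs C \<longrightarrow> tgt C \<gamma> = S.cx \<Gamma> \<longrightarrow> tgt C y = Y \<longrightarrow> src C \<gamma> = src C y \<longrightarrow>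
      T.sm (sps_ctx \<Gamma>) (sps \<Sigma> \<Gamma> M) \<cdot> \<langle>rhc \<Gamma> \<cdot> \<gamma>, y\<rangle>
        = run t (S.sm \<Gamma> M \<cdot> \<gamma>) y)"

section \<open>Correctness of the translation, clause by clause\<close>

lemma sps_okI:
  assumes "typing (sps_sig \<Sigma>) (sps_ctx \<Gamma>) (sps \<Sigma> \<Gamma> M) (sps_ty t)"
    "\<And>\<gamma> y. \<lbrakk>\<gamma> \<in> arrs C; y \<in> arrs C; tgt C \<gamma> = S.cx \<Gamma>; tgt C y = Y; src C \<gamma> = src C y\<rbrakk> \<Longrightarrow>
      T.sm (sps_ctx \<Gamma>) (sps \<Sigma> \<Gamma> M) \<cdot> \<langle>rhc \<Gamma> \<cdot> \<gamma>, y\<rangle>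
        = run t (S.sm \<Gamma> M \<cdot> \<gamma>) y"
  shows "sps_ok \<Gamma> M t"
  using assms by (simp add: sps_ok_def)

lemma sps_okD:
  assumes "sps_ok \<Gamma> M t"
  shows sps_ok_typing: "typing (sps_sig \<Sigma>) (sps_ctx \<Gamma>) (sps \<Sigma> \<Gamma> M) (sps_ty t)"
    and sps_ok_sem: "\<And>\<gamma> y. \<lbrakk>\<gamma> \<in> arrs C; y \<in> arrs C; tgt C \<gamma> = S.cx \<Gamma>; tgt C y = Y; src C \<gamma> = src C y\<rbrakk> \<Longrightarrow>
      T.sm (sps_ctx \<Gamma>) (sps \<Sigma> \<Gamma> M) \<cdot> \<langle>rhc \<Gamma> \<cdot> \<gamma>, y\<rangle>
        = run t (S.sm \<Gamma> M \<cdot> \<gamma>) y"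
    and sps_ok_arr: "T.sm (sps_ctx \<Gamma>) (sps \<Sigma> \<Gamma> M) \<in> arrs C"
      "src C (T.sm (sps_ctx \<Gamma>) (sps \<Sigma> \<Gamma> M)) = T.cx (map circ \<Gamma>) \<otimes> Y"
      "tgt C (T.sm (sps_ctx \<Gamma>) (sps \<Sigma> \<Gamma> M)) = fob T (T.ty (circ t) \<otimes> Y)"
  using assms T.sm_hom[of "sps_ctx \<Gamma>" "sps \<Sigma> \<Gamma> M" "sps_ty t"] by (auto simp: sps_ok_def hom_iff)

text \<open>The five clauses of the translation that act on the value component by an arrow \<open>f\<close>.\<close>

lemma sps_ok_map:
  assumes M: "sps_ok \<Gamma> M s" "typing \<Sigma> \<Gamma> M s"
    and sps: "sps \<Sigma> \<Gamma> M' = App (Lam (sps_ty s) B) (sps \<Sigma> \<Gamma> M)"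
    and B: "T.pure (sps_ty s # sps_ctx \<Gamma>) B (sps_ty t)
      \<langle>f' \<cdot> pr1 C (T.ty (circ s)) Y \<cdot> pr2 C (T.cx (map circ \<Gamma>) \<otimes> Y) (T.ty (circ s) \<otimes> Y),
       pr2 C (T.ty (circ s)) Y \<cdot> pr2 C (T.cx (map circ \<Gamma>) \<otimes> Y) (T.ty (circ s) \<otimes> Y)\<rangle>"
    and f: "f \<in> hom C (S.ty s) (S.ty t)" "f' \<in> hom C (T.ty (circ s)) (T.ty (circ t))" "f' \<cdot> rh s = rh t \<cdot> f"
    and M': "S.sm \<Gamma> M' = far SM f \<cdot> S.sm \<Gamma> M"
  shows "sps_ok \<Gamma> M' t"
proof (rule sps_okI)
  have B_ty: "typing (sps_sig \<Sigma>) (sps_ty s # sps_ctx \<Gamma>) B (sps_ty t)"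
    using B by (simp add: T.pure_def)
  show "typing (sps_sig \<Sigma>) (sps_ctx \<Gamma>) (sps \<Sigma> \<Gamma> M') (sps_ty t)"
    unfolding sps using B_ty sps_ok_typing[OF M(1)] by (blast intro: typing.App typing.Lam)
  fix \<gamma> y
  assume g: "\<gamma> \<in> arrs C" "y \<in> arrs C" "tgt C \<gamma> = S.cx \<Gamma>" "tgt C y = Y" "src C \<gamma> = src C y"
  define e where "e = ev C Y (fob T (S.ty s \<otimes> Y)) \<cdot> \<langle>S.sm \<Gamma> M \<cdot> \<gamma>, y\<rangle>"
  have e: "e \<in> arrs C" "src C e = src C y" "tgt C e = fob T (S.ty s \<otimes> Y)"
    using g S.sm_hom[OF M(2)] by (simp_all add: e_def hom_iff)
  have ff: "f' \<cdot> (rh s \<cdot> u) = rh t \<cdot> (f \<cdot> u)" if "u \<in> arrs C" "tgt C u = S.ty s" for u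
  proof -
    have "(f' \<cdot> rh s) \<cdot> u = (rh t \<cdot> f) \<cdot> u"
      by (simp only: f(3))
    then show ?thesis
      using that f(1,2) by (simp add: hom_iff)
  qed
  have "T.sm (sps_ctx \<Gamma>) (sps \<Sigma> \<Gamma> M') \<cdot> \<langle>rhc \<Gamma> \<cdot> \<gamma>, y\<rangle>
    = T.bnd (S.ty s \<otimes> Y) (T.ty (circ t) \<otimes> Y) e (ret T (T.ty (circ t) \<otimes> Y) \<cdot>
        \<langle>rh t \<cdot> f \<cdot> pr1 C (S.ty s) Y \<cdot> pr2 C (src C y) (S.ty s \<otimes> Y), pr2 C (S.ty s) Y \<cdot> pr2 C (src C y) (S.ty s \<otimes> Y)\<rangle>)"
    unfolding sps T.sm_App_Lam[OF B_ty sps_ok_typing[OF M(1)]]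
    using B f g sps_ok_arr[OF M(1)] sps_ok_sem[OF M(1) g] e
    by (simp add: T.pure_def hom_iff ff flip: e_def)
  also have "\<dots> = far T (under C (rh t) (S.ty t) Y) \<cdot>
      (far T (under C f (S.ty s) Y) \<cdot> e)"
    using f e by (simp add: hom_iff T.far_eq_bnd)
  also have "\<dots> = run t (S.sm \<Gamma> M' \<cdot> \<gamma>) y"
    unfolding M' using f g S.sm_hom[OF M(2)] by (simp add: hom_iff e_def)
  finally show "T.sm (sps_ctx \<Gamma>) (sps \<Sigma> \<Gamma> M') \<cdot> \<langle>rhc \<Gamma> \<cdot> \<gamma>, y\<rangle>
    = run t (S.sm \<Gamma> M' \<cdot> \<gamma>) y" .
qed

lemma z_pure:
  assumes "wf_ctx (sps_sig \<Sigma>) (sps_ctx \<Gamma>)" "set_ty s \<subseteq> bases (sps_sig \<Sigma>)" "G = T.cx (map circ \<Gamma>)" "X = T.ty s"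
  shows "T.pure (TProd s bY # sps_ctx \<Gamma>) (Prj1 (Var 0)) s (pr1 C X Y \<cdot> pr2 C (G \<otimes> Y) (X \<otimes> Y))"
    and "T.pure (TProd s bY # sps_ctx \<Gamma>) (Prj2 (Var 0)) bY (pr2 C X Y \<cdot> pr2 C (G \<otimes> Y) (X \<otimes> Y))"
proof -
  have wf: "wf_ctx (sps_sig \<Sigma>) (TProd s bY # sps_ctx \<Gamma>)"
    using assms bY_wf by simp
  have z: "T.pure (TProd s bY # sps_ctx \<Gamma>) (Var 0) (TProd s bY) (pr2 C (G \<otimes> Y) (X \<otimes> Y))"
    using T.pure_Var[OF wf, of 0] assms by simp
  show "T.pure (TProd s bY # sps_ctx \<Gamma>) (Prj1 (Var 0)) s (pr1 C X Y \<cdot> pr2 C (G \<otimes> Y) (X \<otimes> Y))"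
    "T.pure (TProd s bY # sps_ctx \<Gamma>) (Prj2 (Var 0)) bY (pr2 C X Y \<cdot> pr2 C (G \<otimes> Y) (X \<otimes> Y))"
    using T.pure_Prj1[OF z] T.pure_Prj2[OF z] assms by simp_all
qed

lemma sps_ok_Var:
  assumes "wf_ctx \<Sigma> \<Gamma>" "i < length \<Gamma>"
  shows "sps_ok \<Gamma> (Var i) (\<Gamma> ! i)"
proof (rule sps_okI)
  note wf = wf_sps_ctx[OF assms(1)]
  have p: "T.pure (sps_ctx \<Gamma>) (Tup (Var (Suc i)) (Var 0)) (sps_ty (\<Gamma> ! i))
     (under C (T.vp (map circ \<Gamma>) i) (T.cx (map circ \<Gamma>)) Y)"
    using T.pure_Tup[OF T.pure_Var[OF wf, of "Suc i"] T.pure_Var[OF wf, of 0]] assms(2)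
    by (simp add: sps_ctx_def sps_ty_def)
  then show "typing (sps_sig \<Sigma>) (sps_ctx \<Gamma>) (sps \<Sigma> \<Gamma> (Var i)) (sps_ty (\<Gamma> ! i))"
    by (simp add: T.pure_def)
  fix \<gamma> y
  assume g: "\<gamma> \<in> arrs C" "y \<in> arrs C" "tgt C \<gamma> = S.cx \<Gamma>" "tgt C y = Y" "src C \<gamma> = src C y"
  have "T.vp (map circ \<Gamma>) i \<cdot> (rhc \<Gamma> \<cdot> \<gamma>) = rh (\<Gamma> ! i) \<cdot> (S.vp \<Gamma> i \<cdot> \<gamma>)"
    using arg_cong[OF rho_vp[OF assms(2)], of "\<lambda>x. x \<cdot> \<gamma>"] g T.vp_hom[of i "map circ \<Gamma>"] S.vp_hom[OF assms(2)] assms(2)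
    by (simp add: hom_iff)
  then show "T.sm (sps_ctx \<Gamma>) (sps \<Sigma> \<Gamma> (Var i)) \<cdot> \<langle>rhc \<Gamma> \<cdot> \<gamma>, y\<rangle>
     = run (\<Gamma> ! i) (S.sm \<Gamma> (Var i) \<cdot> \<gamma>) y"
    using p g T.vp_hom[of i "map circ \<Gamma>"] S.vp_hom[OF assms(2)] assms(2) by (simp add: T.pure_def hom_iff)
qed

lemma sps_ok_Star:
  assumes "wf_ctx \<Sigma> \<Gamma>"
  shows "sps_ok \<Gamma> Star TUnit"
proof (rule sps_okI)
  note wf = wf_sps_ctx[OF assms(1)]
  have p: "T.pure (sps_ctx \<Gamma>) (Tup Star (Var 0)) (sps_ty TUnit)
     \<langle>bang C (T.cx (map circ \<Gamma>) \<otimes> Y), pr2 C (T.cx (map circ \<Gamma>)) Y\<rangle>"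
    using T.pure_Tup[OF T.pure_Star[OF wf] T.pure_Var[OF wf, of 0]]
    by (simp add: sps_ctx_def sps_ty_def)
  then show "typing (sps_sig \<Sigma>) (sps_ctx \<Gamma>) (sps \<Sigma> \<Gamma> Star) (sps_ty TUnit)"
    by (simp add: T.pure_def)
  fix \<gamma> y
  assume g: "\<gamma> \<in> arrs C" "y \<in> arrs C" "tgt C \<gamma> = S.cx \<Gamma>" "tgt C y = Y" "src C \<gamma> = src C y"
  then show "T.sm (sps_ctx \<Gamma>) (sps \<Sigma> \<Gamma> Star) \<cdot> \<langle>rhc \<Gamma> \<cdot> \<gamma>, y\<rangle>
     = run TUnit (S.sm \<Gamma> Star \<cdot> \<gamma>) y"
    using p by (simp add: T.pure_def)
qed

text \<open>Arities are ground, so the isomorphisms at them are identities and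
  \<open>map_ty Some\<close> agrees with \<open>circ\<close> on them.\<close>

lemma sps_ar:
  assumes "k \<in> const_syms \<Sigma> <+> eff_syms \<Sigma>"
  shows "ar (sps_sig \<Sigma>) k = sps_ty (ar \<Sigma> k)" "car (sps_sig \<Sigma>) k = sps_ty (car \<Sigma> k)"
    "rh (ar \<Sigma> k) = idn C (S.ty (ar \<Sigma> k))" "rh (car \<Sigma> k) = idn C (S.ty (car \<Sigma> k))"
    "T.ty (circ (ar \<Sigma> k)) = S.ty (ar \<Sigma> k)" "T.ty (circ (car \<Sigma> k)) = S.ty (car \<Sigma> k)"
proof -
  have g: "ground (ar \<Sigma> k)" "ground (car \<Sigma> k)"
    using assms wf_sig unfolding wf_signature_def by blast+
  show "ar (sps_sig \<Sigma>) k = sps_ty (ar \<Sigma> k)" "car (sps_sig \<Sigma>) k = sps_ty (car \<Sigma> k)"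
    using g by (simp_all add: sps_sig_def sps_ty_def ground_circ)
  show "rh (ar \<Sigma> k) = idn C (S.ty (ar \<Sigma> k))" "rh (car \<Sigma> k) = idn C (S.ty (car \<Sigma> k))"
    "T.ty (circ (ar \<Sigma> k)) = S.ty (ar \<Sigma> k)" "T.ty (circ (car \<Sigma> k)) = S.ty (car \<Sigma> k)"
    using g by (simp_all add: rh_ground ty_ground)
qed

lemma sps_ok_Cst:
  assumes c: "c \<in> const_syms \<Sigma>" and M: "sps_ok \<Gamma> M (ar \<Sigma> (Inl c))" "typing \<Sigma> \<Gamma> M (ar \<Sigma> (Inl c))"
  shows "sps_ok \<Gamma> (Cst c M) (car \<Sigma> (Inl c))"
proof (rule sps_okI)
  note ar = sps_ar[of "Inl c", OF InlI[OF c]]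
  have "c \<in> const_syms (sps_sig \<Sigma>)"
    using c by (simp add: sps_sig_def)
  from typing.Cst[OF this] show "typing (sps_sig \<Sigma>) (sps_ctx \<Gamma>) (sps \<Sigma> \<Gamma> (Cst c M)) (sps_ty (car \<Sigma> (Inl c)))"
    using sps_ok_typing[OF M(1)] by (simp add: ar)
  fix \<gamma> y
  assume g: "\<gamma> \<in> arrs C" "y \<in> arrs C" "tgt C \<gamma> = S.cx \<Gamma>" "tgt C y = Y" "src C \<gamma> = src C y"
  then show "T.sm (sps_ctx \<Gamma>) (sps \<Sigma> \<Gamma> (Cst c M)) \<cdot> \<langle>rhc \<Gamma> \<cdot> \<gamma>, y\<rangle>
     = run (car \<Sigma> (Inl c)) (S.sm \<Gamma> (Cst c M) \<cdot> \<gamma>) y"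
    using sps_ok_sem[OF M(1) g] sps_ok_arr[OF M(1)] S.const_hom[OF c] S.sm_hom[OF M(2)]
    by (simp add: hom_iff ar sps_op_def)
qed

lemma sps_ok_Eff:
  assumes c: "c \<in> eff_syms \<Sigma>" and M: "sps_ok \<Gamma> M (ar \<Sigma> (Inr c))" "typing \<Sigma> \<Gamma> M (ar \<Sigma> (Inr c))"
  shows "sps_ok \<Gamma> (Eff c M) (car \<Sigma> (Inr c))"
proof (rule sps_okI)
  note ar = sps_ar[of "Inr c", OF InrI[OF c]]
  have "c \<in> eff_syms (sps_sig \<Sigma>)"
    using c by (simp add: sps_sig_def)
  from typing.Eff[OF this] show "typing (sps_sig \<Sigma>) (sps_ctx \<Gamma>) (sps \<Sigma> \<Gamma> (Eff c M)) (sps_ty (car \<Sigma> (Inr c)))"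
    using sps_ok_typing[OF M(1)] by (simp add: ar)
  fix \<gamma> y
  assume g: "\<gamma> \<in> arrs C" "y \<in> arrs C" "tgt C \<gamma> = S.cx \<Gamma>" "tgt C y = Y" "src C \<gamma> = src C y"
  then show "T.sm (sps_ctx \<Gamma>) (sps \<Sigma> \<Gamma> (Eff c M)) \<cdot> \<langle>rhc \<Gamma> \<cdot> \<gamma>, y\<rangle>
     = run (car \<Sigma> (Inr c)) (S.sm \<Gamma> (Eff c M) \<cdot> \<gamma>) y"
    using sps_ok_sem[OF M(1) g] sps_ok_arr[OF M(1)] S.eff_hom[OF c] S.sm_hom[OF M(2)]
    by (simp add: hom_iff ar sps_op_def uncurry_def)
qed

lemma sps_ok_Prj:
  assumes M: "sps_ok \<Gamma> M (TProd s t)" "typing \<Sigma> \<Gamma> M (TProd s t)"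
  shows "sps_ok \<Gamma> (Prj1 M) s" "sps_ok \<Gamma> (Prj2 M) t"
proof -
  note z = z_pure[OF sps_wf(1,2)[OF M(2)] refl refl]
  note z1 = T.pure_Tup[OF T.pure_Prj1[OF z(1)[unfolded circ.simps]] z(2)[unfolded circ.simps]]
  note z2 = T.pure_Tup[OF T.pure_Prj2[OF z(1)[unfolded circ.simps]] z(2)[unfolded circ.simps]]
  show "sps_ok \<Gamma> (Prj1 M) s"
    by (rule sps_ok_map[OF M, where f = "pr1 C (S.ty s) (S.ty t)" and f' = "pr1 C (T.ty (circ s)) (T.ty (circ t))"])
      (use M z1 in \<open>simp_all add: tyof_eq Let_def hom_iff sps_ty_def\<close>)
  show "sps_ok \<Gamma> (Prj2 M) t"
    by (rule sps_ok_map[OF M, where f = "pr2 C (S.ty s) (S.ty t)" and f' = "pr2 C (T.ty (circ s)) (T.ty (circ t))"])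
      (use M z2 in \<open>simp_all add: tyof_eq Let_def hom_iff sps_ty_def\<close>)
qed

lemma sps_ok_Abort:
  assumes M: "sps_ok \<Gamma> M TZero" "typing \<Sigma> \<Gamma> M TZero" and t: "set_ty t \<subseteq> bases \<Sigma>"
  shows "sps_ok \<Gamma> (Abort t M) t"
proof -
  note z = z_pure[OF sps_wf(1,2)[OF M(2)] refl refl]
  note z1 = T.pure_Tup[OF T.pure_Abort[OF z(1)[unfolded circ.simps] set_ty_circ[OF t]] z(2)[unfolded circ.simps]]
  show ?thesis
    by (rule sps_ok_map[OF M, where f = "cobang C (S.ty t)" and f' = "cobang C (T.ty (circ t))"])
      (use M z1 in \<open>simp_all add: tyof_eq Let_def hom_iff sps_ty_def\<close>)
qed

lemma sps_ok_Inj: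
  assumes M: "sps_ok \<Gamma> M s" "typing \<Sigma> \<Gamma> M s" and t: "set_ty t \<subseteq> bases \<Sigma>"
  shows "sps_ok \<Gamma> (Inj1 t M) (TSum s t)" "sps_ok \<Gamma> (Inj2 t M) (TSum t s)"
proof -
  note z = z_pure[OF sps_wf(1,2)[OF M(2)] refl refl]
  note z1 = T.pure_Tup[OF T.pure_Inj1[OF z(1) set_ty_circ[OF t]] z(2)]
  note z2 = T.pure_Tup[OF T.pure_Inj2[OF z(1) set_ty_circ[OF t]] z(2)]
  show "sps_ok \<Gamma> (Inj1 t M) (TSum s t)"
    by (rule sps_ok_map[OF M, where f = "in1 C (S.ty s) (S.ty t)" and f' = "in1 C (T.ty (circ s)) (T.ty (circ t))"])
      (use M z1 in \<open>simp_all add: tyof_eq Let_def hom_iff sps_ty_def plus_arr_def\<close>)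
  show "sps_ok \<Gamma> (Inj2 t M) (TSum t s)"
    by (rule sps_ok_map[OF M, where f = "in2 C (S.ty t) (S.ty s)" and f' = "in2 C (T.ty (circ t)) (T.ty (circ s))"])
      (use M z2 in \<open>simp_all add: tyof_eq Let_def hom_iff sps_ty_def plus_arr_def\<close>)
qed

text \<open>Both sides reduce to nested bindings in \<open>T\<close>: the inner redex runs
  \<open>N\<close> in the state that \<open>M\<close> leaves behind, as binding in \<open>SM\<close>
  does.\<close>

lemma sps_ok_Tup:
  assumes M: "sps_ok \<Gamma> M s" "typing \<Sigma> \<Gamma> M s" and N: "sps_ok \<Gamma> N t" "typing \<Sigma> \<Gamma> N t"
  shows "sps_ok \<Gamma> (Tup M N) (TProd s t)"
proof (rule sps_okI)
  let ?G = "T.cx (map circ \<Gamma>)" and ?X = "T.ty (circ s)" and ?Z = "T.ty (circ t)"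
  let ?D = "sps_ctx \<Gamma>" and ?M = "sps \<Sigma> \<Gamma> M" and ?N = "sps \<Sigma> \<Gamma> N"
  note wf = sps_wf[OF M(2)] sps_wf[OF N(2)]
  note z = z_pure[OF wf(1,2) refl refl, folded sps_ty_def]
  note N' = app_lam_y[OF sps_ok_typing[OF N(1)] wf(2) refl refl, folded sps_ty_def]
  let ?B = "Tup (Prj1 (Var 0)) (App (Lam bY (ren sps_ren ?N)) (Prj2 (Var 0)))"
  have B_ty: "typing (sps_sig \<Sigma>) (sps_ty s # ?D) ?B (TProd (circ s) (sps_ty t))"
    using z(1) N'(1) by (auto simp: T.pure_def intro: typing.Tup)
  have z_ty: "typing (sps_sig \<Sigma>) (sps_ty s # ?D) (Prj1 (Var 0)) (circ s)"
    using z(1) by (simp add: T.pure_def)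
  have B: "T.sm (sps_ty s # ?D) ?B = T.bnd (?Z \<otimes> Y) (?X \<otimes> (?Z \<otimes> Y))
      (T.sm ?D ?N \<cdot> \<langle>pr1 C ?G Y \<cdot> pr1 C (?G \<otimes> Y) (?X \<otimes> Y), pr2 C ?X Y \<cdot> pr2 C (?G \<otimes> Y) (?X \<otimes> Y)\<rangle>)
      (ret T (?X \<otimes> (?Z \<otimes> Y)) \<cdot> \<langle>pr1 C ?X Y \<cdot> pr2 C (?G \<otimes> Y) (?X \<otimes> Y) \<cdot> pr1 C ((?G \<otimes> Y) \<otimes> (?X \<otimes> Y)) (?Z \<otimes> Y),
        pr2 C ((?G \<otimes> Y) \<otimes> (?X \<otimes> Y)) (?Z \<otimes> Y)\<rangle>)"
    using T.sm_Tup[OF z_ty N'(1)] z(1) N'(2) sps_ok_arr[OF N(1)] by (simp add: T.pure_def hom_iff del: sem.simps)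
  \<comment> \<open>The outer function only regroups: its argument nests the second value with the
    final state, whereas the result pairs the two values.\<close>
  let ?E = "Tup (Tup (Prj1 (Var 0)) (Prj1 (Prj2 (Var 0)))) (Prj2 (Prj2 (Var 0)))"
  have wfE: "wf_ctx (sps_sig \<Sigma>) (TProd (circ s) (TProd (circ t) bY) # ?D)"
    using wf bY_wf by (simp add: sps_ty_def)
  have z0: "T.pure (TProd (circ s) (TProd (circ t) bY) # ?D) (Var 0) (TProd (circ s) (TProd (circ t) bY))
      (pr2 C (?G \<otimes> Y) (?X \<otimes> (?Z \<otimes> Y)))"
    using T.pure_Var[OF wfE, of 0] by simp
  note E = T.pure_Tup[OF T.pure_Tup[OF T.pure_Prj1[OF z0] T.pure_Prj1[OF T.pure_Prj2[OF z0]]]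
      T.pure_Prj2[OF T.pure_Prj2[OF z0]], folded sps_ty_def]
  have E_ty: "typing (sps_sig \<Sigma>) (TProd (circ s) (sps_ty t) # ?D) ?E (sps_ty (TProd s t))"
    using E by (simp add: T.pure_def sps_ty_def)
  have in_ty: "typing (sps_sig \<Sigma>) ?D (App (Lam (sps_ty s) ?B) ?M) (TProd (circ s) (sps_ty t))"
    using B_ty sps_ok_typing[OF M(1)] by (blast intro: typing.App typing.Lam)
  have eq: "sps \<Sigma> \<Gamma> (Tup M N) = App (Lam (TProd (circ s) (sps_ty t)) ?E) (App (Lam (sps_ty s) ?B) ?M)"
    using M(2) N(2) by (simp add: tyof_eq Let_def)
  show "typing (sps_sig \<Sigma>) ?D (sps \<Sigma> \<Gamma> (Tup M N)) (sps_ty (TProd s t))"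
    unfolding eq using E_ty in_ty by (blast intro: typing.App typing.Lam)
  fix \<gamma> y
  assume g: "\<gamma> \<in> arrs C" "y \<in> arrs C" "tgt C \<gamma> = S.cx \<Gamma>" "tgt C y = Y" "src C \<gamma> = src C y"
  show "T.sm ?D (sps \<Sigma> \<Gamma> (Tup M N)) \<cdot> \<langle>rhc \<Gamma> \<cdot> \<gamma>, y\<rangle>
     = run (TProd s t) (S.sm \<Gamma> (Tup M N) \<cdot> \<gamma>) y"
    unfolding eq T.sm_App_Lam[OF E_ty in_ty] T.sm_App_Lam[OF B_ty sps_ok_typing[OF M(1)]] B S.sm_Tup[OF M(2) N(2)]
    using E g sps_ok_arr[OF M(1)] sps_ok_arr[OF N(1)] S.sm_hom[OF M(2)] S.sm_hom[OF N(2)]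
    by (simp add: T.pure_def hom_iff sps_ok_sem[OF M(1)] sps_ok_sem[OF N(1)] del: sem.simps)
qed

text \<open>Besides the bindings this rests on \<open>ev_rho_fun\<close>: evaluating the translated
  function at a value and a state is running the original function from that state.\<close>

lemma sps_ok_App:
  assumes M: "sps_ok \<Gamma> M (TFun s t)" "typing \<Sigma> \<Gamma> M (TFun s t)" and N: "sps_ok \<Gamma> N s" "typing \<Sigma> \<Gamma> N s"
  shows "sps_ok \<Gamma> (App M N) t"
proof (rule sps_okI)
  let ?G = "T.cx (map circ \<Gamma>)" and ?X = "T.ty (circ s)" and ?Z = "T.ty (circ t)"
  let ?F = "(?X \<otimes> Y) \<leadsto> fob T (?Z \<otimes> Y)"
  let ?D = "sps_ctx \<Gamma>" and ?M = "sps \<Sigma> \<Gamma> M" and ?N = "sps \<Sigma> \<Gamma> N"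
  note wf = sps_wf[OF M(2)] sps_wf[OF N(2)]
  note z = z_pure[OF wf(1,2) refl refl, folded sps_ty_def]
  note N' = app_lam_y[OF sps_ok_typing[OF N(1)] wf(2) refl refl, folded sps_ty_def]
  let ?B = "App (Prj1 (Var 0)) (App (Lam bY (ren sps_ren ?N)) (Prj2 (Var 0)))"
  have F: "circ (TFun s t) = TFun (sps_ty s) (sps_ty t)"
    by (simp add: sps_ty_def)
  have z_ty: "typing (sps_sig \<Sigma>) (sps_ty (TFun s t) # ?D) (Prj1 (Var 0)) (TFun (sps_ty s) (sps_ty t))"
    using z(1) F by (simp add: T.pure_def)
  have B_ty: "typing (sps_sig \<Sigma>) (sps_ty (TFun s t) # ?D) ?B (sps_ty t)"
    using z_ty N'(1) by (blast intro: typing.App)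
  have B: "T.sm (sps_ty (TFun s t) # ?D) ?B = T.bnd (?X \<otimes> Y) (?Z \<otimes> Y)
      (T.sm ?D ?N \<cdot> \<langle>pr1 C ?G Y \<cdot> pr1 C (?G \<otimes> Y) (?F \<otimes> Y), pr2 C ?F Y \<cdot> pr2 C (?G \<otimes> Y) (?F \<otimes> Y)\<rangle>)
      (ev C (?X \<otimes> Y) (fob T (?Z \<otimes> Y)) \<cdot> \<langle>pr1 C ?F Y \<cdot> pr2 C (?G \<otimes> Y) (?F \<otimes> Y) \<cdot> pr1 C ((?G \<otimes> Y) \<otimes> (?F \<otimes> Y)) (?X \<otimes> Y),
        pr2 C ((?G \<otimes> Y) \<otimes> (?F \<otimes> Y)) (?X \<otimes> Y)\<rangle>)"
    using T.sm_App[OF z_ty N'(1) refl] z(1) N'(2) sps_ok_arr[OF N(1)] by (simp add: T.pure_def hom_iff del: sem.simps)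
  have eq: "sps \<Sigma> \<Gamma> (App M N) = App (Lam (sps_ty (TFun s t)) ?B) ?M"
    using M(2) by (simp add: tyof_eq Let_def)
  show "typing (sps_sig \<Sigma>) ?D (sps \<Sigma> \<Gamma> (App M N)) (sps_ty t)"
    unfolding eq using B_ty sps_ok_typing[OF M(1)] by (blast intro: typing.App typing.Lam)
  fix \<gamma> y
  assume g: "\<gamma> \<in> arrs C" "y \<in> arrs C" "tgt C \<gamma> = S.cx \<Gamma>" "tgt C y = Y" "src C \<gamma> = src C y"
  show "T.sm ?D (sps \<Sigma> \<Gamma> (App M N)) \<cdot> \<langle>rhc \<Gamma> \<cdot> \<gamma>, y\<rangle>
     = run t (S.sm \<Gamma> (App M N) \<cdot> \<gamma>) y"
    unfolding eq T.sm_App_Lam[OF B_ty sps_ok_typing[OF M(1)]] B S.sm_App[OF M(2) N(2) refl]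
    using g sps_ok_arr[OF M(1)] sps_ok_arr[OF N(1)] S.sm_hom[OF M(2)] S.sm_hom[OF N(2)]
    by (simp add: hom_iff sps_ok_sem[OF M(1)] sps_ok_sem[OF N(1)] del: sem.simps)
qed

text \<open>Under a binder the translation receives value and state as one pair \<open>p\<close>.
  The value is carried back along \<open>ri s\<close> to serve the original term, and the outer
  state \<open>y\<close> disappears from the result.\<close>

lemma sps_body:
  assumes N: "sps_ok (s # \<Gamma>) N t" "typing \<Sigma> (s # \<Gamma>) N t" and D: "D = T.cx (map circ \<Gamma>) \<otimes> Y" and X: "X = T.ty (circ s)"
  shows "typing (sps_sig \<Sigma>) (sps_ty s # sps_ctx \<Gamma>) (sub sps_sub (sps \<Sigma> (s # \<Gamma>) N)) (sps_ty t)"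
    and "T.sm (sps_ty s # sps_ctx \<Gamma>) (sub sps_sub (sps \<Sigma> (s # \<Gamma>) N)) \<in> hom C (D \<otimes> (X \<otimes> Y)) (fob T (T.ty (circ t) \<otimes> Y))"
    and "\<And>\<gamma> y p. \<lbrakk>\<gamma> \<in> arrs C; y \<in> arrs C; p \<in> arrs C; tgt C \<gamma> = S.cx \<Gamma>; tgt C y = Y; tgt C p = X \<otimes> Y;
        src C \<gamma> = src C y; src C p = src C y\<rbrakk> \<Longrightarrow>
      T.sm (sps_ty s # sps_ctx \<Gamma>) (sub sps_sub (sps \<Sigma> (s # \<Gamma>) N)) \<cdot> \<langle>\<langle>rhc \<Gamma> \<cdot> \<gamma>, y\<rangle>, p\<rangle>
      = run t (S.sm (s # \<Gamma>) N \<cdot> \<langle>\<gamma>, ri s \<cdot> (pr1 C X Y \<cdot> p)\<rangle>) (pr2 C X Y \<cdot> p)"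
proof -
  have "wf_ctx \<Sigma> \<Gamma>" "set_ty s \<subseteq> bases \<Sigma>"
    using typing_wf_ctx[OF N(2)] by auto
  from sps_sub_ok[OF wf_sps_ctx[OF this(1)] set_ty_sps_ty[OF this(2)] refl refl]
  have sub: "typing (sps_sig \<Sigma>) (sps_ty s # sps_ctx \<Gamma>) (sub sps_sub (sps \<Sigma> (s # \<Gamma>) N)) (sps_ty t) \<and>
    T.sm (sps_ty s # sps_ctx \<Gamma>) (sub sps_sub (sps \<Sigma> (s # \<Gamma>) N)) = T.sm (sps_ctx (s # \<Gamma>)) (sps \<Sigma> (s # \<Gamma>) N) \<cdot>
      \<langle>\<langle>pr1 C (T.cx (map circ \<Gamma>)) Y \<cdot> pr1 C (T.cx (map circ \<Gamma>) \<otimes> Y) (X \<otimes> Y),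
        pr1 C X Y \<cdot> pr2 C (T.cx (map circ \<Gamma>) \<otimes> Y) (X \<otimes> Y)\<rangle>, pr2 C X Y \<cdot> pr2 C (T.cx (map circ \<Gamma>) \<otimes> Y) (X \<otimes> Y)\<rangle>"
    unfolding X by (rule T.sub_sem[OF sps_ok_typing[OF N(1)]])
  then show "typing (sps_sig \<Sigma>) (sps_ty s # sps_ctx \<Gamma>) (sub sps_sub (sps \<Sigma> (s # \<Gamma>) N)) (sps_ty t)"
    by blast
  show "T.sm (sps_ty s # sps_ctx \<Gamma>) (sub sps_sub (sps \<Sigma> (s # \<Gamma>) N)) \<in> hom C (D \<otimes> (X \<otimes> Y)) (fob T (T.ty (circ t) \<otimes> Y))"
    using T.sm_hom[OF conjunct1[OF sub]] D X by simp
  fix \<gamma> y p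
  assume g: "\<gamma> \<in> arrs C" "y \<in> arrs C" "p \<in> arrs C" "tgt C \<gamma> = S.cx \<Gamma>" "tgt C y = Y" "tgt C p = X \<otimes> Y"
    "src C \<gamma> = src C y" "src C p = src C y"
  have "T.sm (sps_ty s # sps_ctx \<Gamma>) (sub sps_sub (sps \<Sigma> (s # \<Gamma>) N)) \<cdot> \<langle>\<langle>rhc \<Gamma> \<cdot> \<gamma>, y\<rangle>, p\<rangle>
    = T.sm (sps_ctx (s # \<Gamma>)) (sps \<Sigma> (s # \<Gamma>) N) \<cdot> \<langle>rhc (s # \<Gamma>) \<cdot> \<langle>\<gamma>, ri s \<cdot> (pr1 C X Y \<cdot> p)\<rangle>, pr2 C X Y \<cdot> p\<rangle>"
    using conjunct2[OF sub] g X sps_ok_arr[OF N(1)] by simp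
  also have "\<dots> = run t (S.sm (s # \<Gamma>) N \<cdot> \<langle>\<gamma>, ri s \<cdot> (pr1 C X Y \<cdot> p)\<rangle>) (pr2 C X Y \<cdot> p)"
    by (rule sps_ok_sem[OF N(1)]) (use g X in simp_all)
  finally show "T.sm (sps_ty s # sps_ctx \<Gamma>) (sub sps_sub (sps \<Sigma> (s # \<Gamma>) N)) \<cdot> \<langle>\<langle>rhc \<Gamma> \<cdot> \<gamma>, y\<rangle>, p\<rangle>
      = run t (S.sm (s # \<Gamma>) N \<cdot> \<langle>\<gamma>, ri s \<cdot> (pr1 C X Y \<cdot> p)\<rangle>) (pr2 C X Y \<cdot> p)" .
qed

text \<open>The two closures are equal because they agree when evaluated at a generic pair of
  argument and state.\<close>

lemma sps_ok_Lam:
  assumes N: "sps_ok (s # \<Gamma>) N t" "typing \<Sigma> (s # \<Gamma>) N t"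
  shows "sps_ok \<Gamma> (Lam s N) (TFun s t)"
proof (rule sps_okI)
  let ?G = "T.cx (map circ \<Gamma>)" and ?X = "T.ty (circ s)" and ?Z = "T.ty (circ t)"
  let ?D = "sps_ctx \<Gamma>" and ?N = "sub sps_sub (sps \<Sigma> (s # \<Gamma>) N)"
  note B = sps_body[OF N refl refl]
  have wf: "wf_ctx (sps_sig \<Sigma>) ?D"
    using typing_wf_ctx[OF B(1)] by simp
  have p: "T.pure ?D (Tup (Lam (sps_ty s) ?N) (Var 0)) (sps_ty (TFun s t))
     \<langle>curry C (?G \<otimes> Y) (?X \<otimes> Y) (T.sm (sps_ty s # ?D) ?N), pr2 C ?G Y\<rangle>"
    using T.pure_Tup[OF T.pure_Lam[OF B(1)] T.pure_Var[OF wf, of 0]] by (simp add: sps_ctx_def sps_ty_def)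
  then show "typing (sps_sig \<Sigma>) ?D (sps \<Sigma> \<Gamma> (Lam s N)) (sps_ty (TFun s t))"
    by (simp add: T.pure_def)
  fix \<gamma> y
  assume g: "\<gamma> \<in> arrs C" "y \<in> arrs C" "tgt C \<gamma> = S.cx \<Gamma>" "tgt C y = Y" "src C \<gamma> = src C y"
  let ?c = "curry C (S.cx \<Gamma>) (S.ty s) (S.sm (s # \<Gamma>) N)"
  have "curry C (?G \<otimes> Y) (?X \<otimes> Y) (T.sm (sps_ty s # ?D) ?N) \<cdot> \<langle>rhc \<Gamma> \<cdot> \<gamma>, y\<rangle> = rh (TFun s t) \<cdot> (?c \<cdot> \<gamma>)"
    by (rule S.expo_eqI[of _ "src C y" "?X \<otimes> Y" "fob T (?Z \<otimes> Y)"])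
      (use g B(2) S.sm_hom[OF N(2)] in \<open>simp_all add: hom_iff B(3) del: sem.simps\<close>)
  then show "T.sm ?D (sps \<Sigma> \<Gamma> (Lam s N)) \<cdot> \<langle>rhc \<Gamma> \<cdot> \<gamma>, y\<rangle>
     = run (TFun s t) (S.sm \<Gamma> (Lam s N) \<cdot> \<gamma>) y"
    unfolding S.sm_Lam[OF N(2)]
    using p g B(2) S.sm_hom[OF N(2)] by (simp add: T.pure_def hom_iff del: sem.simps S.curry_cmp)
qed

text \<open>The translation tags the pair of value and state before it branches, which makes two
  case distinctions out of one. The sides are compared as continuations after the run of
  \<open>M\<close>, on each injection separately, where all case distinctions reduce.\<close>

lemma sps_ok_Case:
  assumes M: "sps_ok \<Gamma> M (TSum s1 s2)" "typing \<Sigma> \<Gamma> M (TSum s1 s2)"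
    and N1: "sps_ok (s1 # \<Gamma>) N1 t" "typing \<Sigma> (s1 # \<Gamma>) N1 t"
    and N2: "sps_ok (s2 # \<Gamma>) N2 t" "typing \<Sigma> (s2 # \<Gamma>) N2 t"
  shows "sps_ok \<Gamma> (Case M s1 N1 s2 N2) t"
proof (rule sps_okI)
  let ?G = "T.cx (map circ \<Gamma>)" and ?X1 = "T.ty (circ s1)" and ?X2 = "T.ty (circ s2)" and ?Z = "T.ty (circ t)"
  let ?D = "sps_ctx \<Gamma>" and ?M = "sps \<Sigma> \<Gamma> M"
  let ?N1 = "sub sps_sub (sps \<Sigma> (s1 # \<Gamma>) N1)" and ?N2 = "sub sps_sub (sps \<Sigma> (s2 # \<Gamma>) N2)"
  let ?S = "?X1 \<oplus> ?X2"
  note B1 = sps_body[OF N1 refl refl] and B2 = sps_body[OF N2 refl refl]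
  have wf: "wf_ctx (sps_sig \<Sigma>) ?D" "set_ty (sps_ty s1) \<subseteq> bases (sps_sig \<Sigma>)" "set_ty (sps_ty s2) \<subseteq> bases (sps_sig \<Sigma>)"
    using typing_wf_ctx[OF B1(1)] typing_wf_ctx[OF B2(1)] by simp_all
  let ?zt = "TProd (TSum (circ s1) (circ s2)) bY"
  note z = z_pure[OF sps_wf(1,2)[OF M(2)] refl refl, unfolded circ.simps]
  have branch: "T.pure (circ s # ?zt # ?D) (Tup (Var 0) (Prj2 (Var 1))) (sps_ty s)
      \<langle>pr2 C ((?G \<otimes> Y) \<otimes> (?S \<otimes> Y)) (T.ty (circ s)),
       pr2 C ?S Y \<cdot> pr2 C (?G \<otimes> Y) (?S \<otimes> Y) \<cdot> pr1 C ((?G \<otimes> Y) \<otimes> (?S \<otimes> Y)) (T.ty (circ s))\<rangle>"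
    if "set_ty (sps_ty s) \<subseteq> bases (sps_sig \<Sigma>)" for s
  proof -
    have w: "wf_ctx (sps_sig \<Sigma>) (circ s # ?zt # ?D)"
      using that wf bY_wf by (simp add: sps_ty_def)
    have "T.pure (circ s # ?zt # ?D) (Var 1) ?zt
        (pr2 C (?G \<otimes> Y) (?S \<otimes> Y) \<cdot> pr1 C ((?G \<otimes> Y) \<otimes> (?S \<otimes> Y)) (T.ty (circ s)))"
      using T.pure_Var[OF w, of 1] by simp
    from T.pure_Tup[OF T.pure_Var[OF w, of 0] T.pure_Prj2[OF this]] show ?thesis
      by (simp add: sps_ty_def)
  qed
  note I1 = T.pure_Inj1[OF branch[OF wf(2)] wf(3)] and I2 = T.pure_Inj2[OF branch[OF wf(3)] wf(2)]
  let ?I1 = "Inj1 (sps_ty s2) (Tup (Var 0) (Prj2 (Var 1)))" and ?I2 = "Inj2 (sps_ty s1) (Tup (Var 0) (Prj2 (Var 1)))"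
  let ?R = "Case (Prj1 (Var 0)) (circ s1) ?I1 (circ s2) ?I2"
  have z_ty: "typing (sps_sig \<Sigma>) (?zt # ?D) (Prj1 (Var 0)) (TSum (circ s1) (circ s2))"
    using z(1) by (simp add: T.pure_def)
  have I_ty: "typing (sps_sig \<Sigma>) (circ s1 # ?zt # ?D) ?I1 (TSum (sps_ty s1) (sps_ty s2))"
    "typing (sps_sig \<Sigma>) (circ s2 # ?zt # ?D) ?I2 (TSum (sps_ty s1) (sps_ty s2))"
    using I1 I2 by (simp_all add: T.pure_def)
  have R_ty: "typing (sps_sig \<Sigma>) (?zt # ?D) ?R (TSum (sps_ty s1) (sps_ty s2))"
    by (rule typing.Case[OF z_ty I_ty])
  let ?W = "(?G \<otimes> Y) \<otimes> (?S \<otimes> Y)"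
  let ?U = "(?X1 \<otimes> Y) \<oplus> (?X2 \<otimes> Y)"
  have R: "T.sm (?zt # ?D) ?R = S.cse ?W ?X1 ?X2
      (ret T ?U \<cdot> in1 C (?X1 \<otimes> Y) (?X2 \<otimes> Y) \<cdot> \<langle>pr2 C ?W ?X1, pr2 C ?S Y \<cdot> pr2 C (?G \<otimes> Y) (?S \<otimes> Y) \<cdot> pr1 C ?W ?X1\<rangle>)
      (ret T ?U \<cdot> in2 C (?X1 \<otimes> Y) (?X2 \<otimes> Y) \<cdot> \<langle>pr2 C ?W ?X2, pr2 C ?S Y \<cdot> pr2 C (?G \<otimes> Y) (?S \<otimes> Y) \<cdot> pr1 C ?W ?X2\<rangle>)
      \<cdot> \<langle>idn C ?W, pr1 C ?S Y \<cdot> pr2 C (?G \<otimes> Y) (?S \<otimes> Y)\<rangle>"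
    using T.sm_Case[OF z_ty I_ty(1)] z(1) I1 I2 by (simp add: T.pure_def hom_iff del: sem.simps)
  have eq: "sps \<Sigma> \<Gamma> (Case M s1 N1 s2 N2) = Case (App (Lam ?zt ?R) ?M) (sps_ty s1) ?N1 (sps_ty s2) ?N2"
    by (simp add: Let_def sps_ty_def)
  have M_ty: "typing (sps_sig \<Sigma>) ?D ?M ?zt"
    using sps_ok_typing[OF M(1)] by (simp add: sps_ty_def)
  have RM_ty: "typing (sps_sig \<Sigma>) ?D (App (Lam ?zt ?R) ?M) (TSum (sps_ty s1) (sps_ty s2))"
    using R_ty M_ty by (blast intro: typing.App typing.Lam)
  show "typing (sps_sig \<Sigma>) ?D (sps \<Sigma> \<Gamma> (Case M s1 N1 s2 N2)) (sps_ty t)"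
    unfolding eq by (rule typing.Case[OF RM_ty B1(1) B2(1)])
  fix \<gamma> y
  assume g: "\<gamma> \<in> arrs C" "y \<in> arrs C" "tgt C \<gamma> = S.cx \<Gamma>" "tgt C y = Y" "src C \<gamma> = src C y"
  let ?V = "src C y"
  let ?X1' = "S.ty s1" and ?X2' = "S.ty s2" and ?Z' = "S.ty t"
  let ?S' = "?X1' \<oplus> ?X2'"
  \<comment> \<open>Both sides bind this run of \<open>M\<close>; under a name it stays opaque to
    the simplifier.\<close>
  define e where "e = ev C Y (fob T (?S' \<otimes> Y)) \<cdot> \<langle>S.sm \<Gamma> M \<cdot> \<gamma>, y\<rangle>"
  have e: "e \<in> arrs C" "src C e = ?V" "tgt C e = fob T (?S' \<otimes> Y)"
    using g S.sm_hom[OF M(2)] by (simp_all add: e_def hom_iff)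
  define n1 where "n1 = T.sm (sps_ty s1 # ?D) ?N1"
  define n2 where "n2 = T.sm (sps_ty s2 # ?D) ?N2"
  define m1 where "m1 = S.sm (s1 # \<Gamma>) N1"
  define m2 where "m2 = S.sm (s2 # \<Gamma>) N2"
  note n1 = B1(2,3)[folded n1_def m1_def] and n2 = B2(2,3)[folded n2_def m2_def]
  have m1: "m1 \<in> hom C (S.cx \<Gamma> \<otimes> ?X1') (fob SM ?Z')" and m2: "m2 \<in> hom C (S.cx \<Gamma> \<otimes> ?X2') (fob SM ?Z')"
    using S.sm_hom[OF N1(2)] S.sm_hom[OF N2(2)] by (simp_all add: m1_def m2_def)
  define p where "p = pr1 C ?V (?S' \<otimes> Y)"
  define q where "q = pr2 C ?V (?S' \<otimes> Y)"
  have pq: "p \<in> hom C (?V \<otimes> (?S' \<otimes> Y)) ?V" "q \<in> hom C (?V \<otimes> (?S' \<otimes> Y)) (?S' \<otimes> Y)"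
    by (auto simp: p_def q_def hom_iff)
  let ?rS = "rh (TSum s1 s2)"
  define f1 where "f1 = ret T ?U \<cdot> in1 C (?X1 \<otimes> Y) (?X2 \<otimes> Y) \<cdot>
    \<langle>pr2 C ?W ?X1, pr2 C ?S Y \<cdot> pr2 C (?G \<otimes> Y) (?S \<otimes> Y) \<cdot> pr1 C ?W ?X1\<rangle>"
  define f2 where "f2 = ret T ?U \<cdot> in2 C (?X1 \<otimes> Y) (?X2 \<otimes> Y) \<cdot>
    \<langle>pr2 C ?W ?X2, pr2 C ?S Y \<cdot> pr2 C (?G \<otimes> Y) (?S \<otimes> Y) \<cdot> pr1 C ?W ?X2\<rangle>"
  have f: "f1 \<in> hom C (?W \<otimes> ?X1) (fob T ?U)" "f2 \<in> hom C (?W \<otimes> ?X2) (fob T ?U)"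
    by (auto simp: f1_def f2_def hom_iff)
  let ?W' = "?V \<otimes> (?S' \<otimes> Y)"
  \<comment> \<open>\<open>KL\<close> is the continuation of the translated term, with the transport
    of the result of \<open>M\<close> along \<open>?rS\<close> already absorbed; \<open>KR\<close>
    is that of the original term.\<close>
  define KL where "KL = T.bnd ?U (?Z \<otimes> Y)
    (S.cse ?W ?X1 ?X2 f1 f2 \<cdot> \<langle>\<langle>\<langle>rhc \<Gamma> \<cdot> \<gamma> \<cdot> p, y \<cdot> p\<rangle>, \<langle>?rS \<cdot> pr1 C ?S' Y \<cdot> q, pr2 C ?S' Y \<cdot> q\<rangle>\<rangle>, ?rS \<cdot> pr1 C ?S' Y \<cdot> q\<rangle>)
    (S.cse (?G \<otimes> Y) (?X1 \<otimes> Y) (?X2 \<otimes> Y) n1 n2 \<cdot> \<langle>\<langle>rhc \<Gamma> \<cdot> \<gamma> \<cdot> p \<cdot> pr1 C ?W' ?U, y \<cdot> p \<cdot> pr1 C ?W' ?U\<rangle>, pr2 C ?W' ?U\<rangle>)"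
  define KR where "KR = run t (S.cse (S.cx \<Gamma>) ?X1' ?X2' m1 m2 \<cdot> \<langle>\<gamma> \<cdot> p, pr1 C ?S' Y \<cdot> q\<rangle>) (pr2 C ?S' Y \<cdot> q)"
  have "?rS \<in> hom C ?S' ?S"
    using rho_iso[of "TSum s1 s2"] by simp
  note homs = this f n1(1) n2(1) m1 m2 g pq
  have K: "KL = KR"
  proof (rule S.distrib_middle_eqI)
    show "KL \<in> hom C ?W' (fob T (?Z \<otimes> Y))" "KR \<in> hom C ?W' (fob T (?Z \<otimes> Y))"
      using homs by (simp_all add: KL_def KR_def hom_iff del: rho.simps)
    show "KL \<cdot> \<langle>pr1 C ?V Y \<cdot> pr1 C (?V \<otimes> Y) ?X1', \<langle>in1 C ?X1' ?X2' \<cdot> pr2 C (?V \<otimes> Y) ?X1', pr2 C ?V Y \<cdot> pr1 C (?V \<otimes> Y) ?X1'\<rangle>\<rangle>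
      = KR \<cdot> \<langle>pr1 C ?V Y \<cdot> pr1 C (?V \<otimes> Y) ?X1', \<langle>in1 C ?X1' ?X2' \<cdot> pr2 C (?V \<otimes> Y) ?X1', pr2 C ?V Y \<cdot> pr1 C (?V \<otimes> Y) ?X1'\<rangle>\<rangle>"
      using homs n1(2) by (simp add: KL_def KR_def p_def q_def f1_def hom_iff plus_arr_def)
    show "KL \<cdot> \<langle>pr1 C ?V Y \<cdot> pr1 C (?V \<otimes> Y) ?X2', \<langle>in2 C ?X1' ?X2' \<cdot> pr2 C (?V \<otimes> Y) ?X2', pr2 C ?V Y \<cdot> pr1 C (?V \<otimes> Y) ?X2'\<rangle>\<rangle>
      = KR \<cdot> \<langle>pr1 C ?V Y \<cdot> pr1 C (?V \<otimes> Y) ?X2', \<langle>in2 C ?X1' ?X2' \<cdot> pr2 C (?V \<otimes> Y) ?X2', pr2 C ?V Y \<cdot> pr1 C (?V \<otimes> Y) ?X2'\<rangle>\<rangle>"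
      using homs n2(2) by (simp add: KL_def KR_def p_def q_def f2_def hom_iff plus_arr_def)
  qed
  have L: "T.sm ?D (sps \<Sigma> \<Gamma> (Case M s1 N1 s2 N2)) \<cdot> \<langle>rhc \<Gamma> \<cdot> \<gamma>, y\<rangle> = T.bnd (?S' \<otimes> Y) (?Z \<otimes> Y) e KL"
    unfolding eq T.sm_Case[OF RM_ty B1(1)] n1_def[symmetric] n2_def[symmetric] T.sm_App_Lam[OF R_ty M_ty] R[folded f1_def f2_def]
    using homs sps_ok_arr[OF M(1)] sps_ok_sem[OF M(1) g] e
    by (simp add: KL_def p_def q_def hom_iff del: rho.simps sem.simps flip: e_def)
  have R: "T.bnd (?S' \<otimes> Y) (?Z \<otimes> Y) e KR = run t (S.sm \<Gamma> (Case M s1 N1 s2 N2) \<cdot> \<gamma>) y"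
    unfolding S.sm_Case[OF M(2) N1(2)] m1_def[symmetric] m2_def[symmetric]
    using e m1 m2 g S.sm_hom[OF M(2)] by (simp add: KR_def p_def q_def hom_iff e_def)
  show "T.sm ?D (sps \<Sigma> \<Gamma> (Case M s1 N1 s2 N2)) \<cdot> \<langle>rhc \<Gamma> \<cdot> \<gamma>, y\<rangle>
     = run t (S.sm \<Gamma> (Case M s1 N1 s2 N2) \<cdot> \<gamma>) y"
    unfolding L K R ..
qed

lemma sps_ok_Mu:
  assumes N: "sps_ok (s # TFun s t # \<Gamma>) N t" "typing \<Sigma> (s # TFun s t # \<Gamma>) N t"
  shows "sps_ok \<Gamma> (Mu s t N) (TFun s t)"
proof (rule sps_okI)
  let ?G = "T.cx (map circ \<Gamma>)" and ?X = "T.ty (circ s)" and ?Z = "T.ty (circ t)"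
  let ?X' = "S.ty s" and ?Z' = "S.ty t" and ?F' = "S.ty (TFun s t)"
  let ?D = "sps_ctx \<Gamma>" and ?F = "(?X \<otimes> Y) \<leadsto> fob T (?Z \<otimes> Y)"
  let ?N = "sub sps_sub_mu (sps \<Sigma> (s # TFun s t # \<Gamma>) N)"
  let ?body = "T.sm (sps_ctx (s # TFun s t # \<Gamma>)) (sps \<Sigma> (s # TFun s t # \<Gamma>) N)"
  have wf: "wf_ctx (sps_sig \<Sigma>) ?D" "set_ty (sps_ty s) \<subseteq> bases (sps_sig \<Sigma>)"
    "set_ty (circ (TFun s t)) \<subseteq> bases (sps_sig \<Sigma>)"
    using typing_wf_ctx[OF N(2)] wf_sps_ctx[of \<Sigma> \<Gamma>] set_ty_sps_ty[of s \<Sigma>] set_ty_circ[of "TFun s t" \<Sigma>]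
    by (simp_all del: circ.simps)
  note sub = T.sub_sem[OF sps_ok_typing[OF N(1)] sps_sub_mu_ok[OF wf refl refl refl]]
  note N_ty = conjunct1[OF sub]
  define \<phi> where "\<phi> = T.sm (sps_ty s # TFun (sps_ty s) (sps_ty t) # ?D) ?N"
  have \<phi>: "\<phi> \<in> hom C (((?G \<otimes> Y) \<otimes> ?F) \<otimes> (?X \<otimes> Y)) (fob T (?Z \<otimes> Y))"
    using T.sm_hom[OF N_ty] by (simp add: \<phi>_def)
  define \<psi> where "\<psi> = S.sm (s # TFun s t # \<Gamma>) N"
  have \<psi>: "\<psi> \<in> hom C ((S.cx \<Gamma> \<otimes> (?X' \<leadsto> fob SM ?Z')) \<otimes> ?X') (fob SM ?Z')"
    using S.sm_hom[OF N(2)] by (simp add: \<psi>_def)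
  \<comment> \<open>The state \<open>y\<close> of the environment drops out, because the body of the
    recursive function takes its state from the argument pair \<open>p\<close>.\<close>
  have \<phi>_tup: "\<phi> \<cdot> \<langle>\<langle>\<langle>rhc \<Gamma> \<cdot> \<gamma>, y\<rangle>, rh (TFun s t) \<cdot> u\<rangle>, p\<rangle>
      = run t (\<psi> \<cdot> \<langle>\<langle>\<gamma>, u\<rangle>, ri s \<cdot> (pr1 C ?X Y \<cdot> p)\<rangle>) (pr2 C ?X Y \<cdot> p)"
    if g: "\<gamma> \<in> arrs C" "y \<in> arrs C" "u \<in> arrs C" "p \<in> arrs C" "tgt C \<gamma> = S.cx \<Gamma>" "tgt C y = Y"
      "tgt C u = ?F'" "tgt C p = ?X \<otimes> Y" "src C \<gamma> = src C p" "src C y = src C p" "src C u = src C p" for \<gamma> y u p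
  proof -
    have "\<phi> \<cdot> \<langle>\<langle>\<langle>rhc \<Gamma> \<cdot> \<gamma>, y\<rangle>, rh (TFun s t) \<cdot> u\<rangle>, p\<rangle>
      = ?body \<cdot> \<langle>rhc (s # TFun s t # \<Gamma>) \<cdot> \<langle>\<langle>\<gamma>, u\<rangle>, ri s \<cdot> (pr1 C ?X Y \<cdot> p)\<rangle>, pr2 C ?X Y \<cdot> p\<rangle>"
      unfolding \<phi>_def conjunct2[OF sub] using g sps_ok_arr[OF N(1)] by simp
    also have "\<dots> = run t (\<psi> \<cdot> \<langle>\<langle>\<gamma>, u\<rangle>, ri s \<cdot> (pr1 C ?X Y \<cdot> p)\<rangle>) (pr2 C ?X Y \<cdot> p)"
      unfolding \<psi>_def by (rule sps_ok_sem[OF N(1)]) (use g in simp_all)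
    finally show ?thesis .
  qed
  have p: "T.pure ?D (Tup (Mu (sps_ty s) (sps_ty t) ?N) (Var 0)) (sps_ty (TFun s t))
     \<langle>T.mu_fix (?G \<otimes> Y) (?X \<otimes> Y) (?Z \<otimes> Y) \<phi>, pr2 C ?G Y\<rangle>"
    using T.pure_Tup[OF T.pure_Mu[OF N_ty] T.pure_Var[OF wf(1), of 0]]
    by (simp add: sps_ctx_def sps_ty_def \<phi>_def del: sem.simps)
  then show "typing (sps_sig \<Sigma>) ?D (sps \<Sigma> \<Gamma> (Mu s t N)) (sps_ty (TFun s t))"
    by (simp add: T.pure_def)
  fix \<gamma> y
  assume g: "\<gamma> \<in> arrs C" "y \<in> arrs C" "tgt C \<gamma> = S.cx \<Gamma>" "tgt C y = Y" "src C \<gamma> = src C y"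
  let ?V = "src C y"
  let ?u = "S.mu_seq (S.cx \<Gamma>) ?X' ?Z' \<psi>" and ?v = "T.mu_seq (?G \<otimes> Y) (?X \<otimes> Y) (?Z \<otimes> Y) \<phi>"
  have u: "?u n \<in> arrs C" "src C (?u n) = S.cx \<Gamma>" "tgt C (?u n) = (?X' \<leadsto> Y \<leadsto> fob T (?Z' \<otimes> Y))" for n
    using S.mu_seq_hom[OF \<psi>, of n] by (simp_all add: hom_iff)
  have v: "?v n \<in> arrs C" "src C (?v n) = ?G \<otimes> Y" "tgt C (?v n) = ?F" for n
    using T.mu_seq_hom[OF \<phi>, of n] by (simp_all add: hom_iff)
  have gy: "\<langle>rhc \<Gamma> \<cdot> \<gamma>, y\<rangle> \<in> hom C ?V (?G \<otimes> Y)" "\<gamma> \<in> hom C ?V (S.cx \<Gamma>)"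
    using g by (simp_all add: hom_iff)
  \<comment> \<open>For \<open>n = 0\<close> the rewriting by \<open>bottom_S\<close> makes both
    sides constantly bottom after evaluation; the step is \<open>\<phi>_tup\<close> at a generic
    argument.\<close>
  have seq: "?v n \<cdot> \<langle>rhc \<Gamma> \<cdot> \<gamma>, y\<rangle> = rh (TFun s t) \<cdot> (?u n \<cdot> \<gamma>)" for n
  proof (induction n)
    case 0
    show ?case
      by (rule S.expo_eqI[of _ ?V "?X \<otimes> Y" "fob T (?Z \<otimes> Y)"])
        (use g in \<open>simp_all add: hom_iff bottom_S\<close>)
  next
    case (Suc n)
    have "?v (Suc n) \<cdot> \<langle>rhc \<Gamma> \<cdot> \<gamma>, y\<rangle>
      = curry C ((?G \<otimes> Y) \<otimes> ?F) (?X \<otimes> Y) \<phi> \<cdot> \<langle>\<langle>rhc \<Gamma> \<cdot> \<gamma>, y\<rangle>, ?v n \<cdot> \<langle>rhc \<Gamma> \<cdot> \<gamma>, y\<rangle>\<rangle>"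
      using v[of n] \<phi> g by (simp add: hom_iff del: S.curry_cmp)
    also have "\<dots> = rh (TFun s t) \<cdot> (?u (Suc n) \<cdot> \<gamma>)"
      unfolding Suc
      by (rule S.expo_eqI[of _ ?V "?X \<otimes> Y" "fob T (?Z \<otimes> Y)"])
        (use u[of n] \<phi> \<psi> g in \<open>simp_all add: hom_iff \<phi>_tup\<close>)
    finally show ?case .
  qed
  have rF: "rh (TFun s t) \<in> hom C (?X' \<leadsto> fob SM ?Z') ?F"
    by (simp add: hom_iff)
  \<comment> \<open>Postcomposition with the isomorphism preserves suprema, so both sides are
    suprema of one chain.\<close>
  have mu: "T.mu_fix (?G \<otimes> Y) (?X \<otimes> Y) (?Z \<otimes> Y) \<phi> \<cdot> \<langle>rhc \<Gamma> \<cdot> \<gamma>, y\<rangle>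
    = rh (TFun s t) \<cdot> (S.mu_fix (S.cx \<Gamma>) ?X' ?Z' \<psi> \<cdot> \<gamma>)"
    using S.mu_fix_eqI[OF \<psi> _ rF gy(2)] S.precmp_lub[OF T.mu_seq_chain[OF \<phi>] T.mu_fix_lub[OF \<phi>] gy(1)]
    by (simp add: seq)
  show "T.sm ?D (sps \<Sigma> \<Gamma> (Mu s t N)) \<cdot> \<langle>rhc \<Gamma> \<cdot> \<gamma>, y\<rangle>
     = run (TFun s t) (S.sm \<Gamma> (Mu s t N) \<cdot> \<gamma>) y"
    unfolding S.sm_Mu[OF \<psi>[unfolded \<psi>_def]] \<psi>_def[symmetric]
    using p g mu S.mu_fix_hom[OF \<psi>] T.mu_fix_hom[OF \<phi>] by (simp add: T.pure_def hom_iff del: sem.simps)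
qed

lemma sps_ok: "typing \<Sigma> \<Gamma> M t \<Longrightarrow> sps_ok \<Gamma> M t"
proof (induction rule: typing.induct)
  case (Prj1 \<Gamma> M s t)
  then show ?case by (rule sps_ok_Prj(1)[rotated])
next
  case (Prj2 \<Gamma> M s t)
  then show ?case by (rule sps_ok_Prj(2)[rotated])
qed (blast intro: sps_ok_Var sps_ok_Cst sps_ok_Eff sps_ok_Star sps_ok_Tup sps_ok_Abort sps_ok_Inj sps_ok_Case
    sps_ok_Lam sps_ok_App sps_ok_Mu)+

text \<open>The correctness equation is used at the generic environment \<open>\<gamma>\<close> and
  state, for which \<open>rhc \<Gamma> \<cdot> \<gamma>\<close> and the state are the two
  projections. Then \<open>ri t\<close> in the post-condition cancels \<open>rh t\<close> in
  \<open>run\<close>.\<close>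

theorem wp_sps:
  assumes M: "typing \<Sigma> \<Gamma> M t" and \<tau>: "\<tau> \<in> hom C (fob T \<Omega>) \<Omega>" and Q: "Q \<in> hom C (S.ty t) (Y \<leadsto> \<Omega>)"
  shows "uncurry C Y \<Omega> (wp \<Sigma> C SM botS A a (state_algebra C T Y \<Omega> \<tau>) \<Gamma> M Q \<cdot> inv_arr C (rhc \<Gamma>))
    = wp (sps_sig \<Sigma>) C T botT (sps_base Y A) (sps_op \<Sigma> C T Y A a) \<tau> (sps_ctx \<Gamma>) (sps \<Sigma> \<Gamma> M)
        (uncurry C Y \<Omega> (Q \<cdot> ri t))"
proof -
  let ?G = "T.cx (map circ \<Gamma>)"
  define \<gamma> where "\<gamma> = inv_arr C (rhc \<Gamma>) \<cdot> pr1 C ?G Y"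
  have inv: "inv_arr C (rhc \<Gamma>) \<in> hom C ?G (S.cx \<Gamma>)" "rhc \<Gamma> \<cdot> inv_arr C (rhc \<Gamma>) = idn C ?G"
    using rho_iso[of "ctx_ty \<Gamma>"] by (simp_all add: rho_ctx_def sem_ctx_def ctx_ty_map_circ)
  have "(rhc \<Gamma> \<cdot> inv_arr C (rhc \<Gamma>)) \<cdot> pr1 C ?G Y = pr1 C ?G Y"
    unfolding inv(2) by simp
  then have \<gamma>: "\<gamma> \<in> hom C (?G \<otimes> Y) (S.cx \<Gamma>)" "rhc \<Gamma> \<cdot> \<gamma> = pr1 C ?G Y"
    using inv(1) by (simp_all add: \<gamma>_def hom_iff)
  note ok = sps_ok[OF M]
  have sm: "T.sm (sps_ctx \<Gamma>) (sps \<Sigma> \<Gamma> M) = run t (S.sm \<Gamma> M \<cdot> \<gamma>) (pr2 C ?G Y)"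
    using sps_ok_sem[OF ok, of \<gamma> "pr2 C ?G Y"] sps_ok_arr[OF ok] \<gamma> by (simp add: hom_iff)
  have "far T (uncurry C Y \<Omega> (Q \<cdot> ri t)) \<cdot> far T (under C (rh t) (S.ty t) Y)
    = far T (uncurry C Y \<Omega> (Q \<cdot> ri t) \<cdot> under C (rh t) (S.ty t) Y)"
    by (subst T.far_cmp_eq[of "under C (rh t) (S.ty t) Y"])
      (use Q in \<open>simp_all add: uncurry_def hom_iff\<close>)
  also have "uncurry C Y \<Omega> (Q \<cdot> ri t) \<cdot> under C (rh t) (S.ty t) Y
    = ev C Y \<Omega> \<cdot> under C Q (S.ty t) Y"
    using Q by (simp add: uncurry_def hom_iff)
  finally have far: "far T (uncurry C Y \<Omega> (Q \<cdot> ri t)) \<cdot> (far T (under C (rh t) (S.ty t) Y) \<cdot> e)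
      = far T (ev C Y \<Omega>) \<cdot> (far T (under C Q (S.ty t) Y) \<cdot> e)"
    if "e \<in> arrs C" "tgt C e = fob T (S.ty t \<otimes> Y)" for e
    using that Q by (subst S.cmp_cmp[symmetric]) (simp_all add: hom_iff uncurry_def)
  have "expo_arr C (idn C Y) (far T (ev C Y \<Omega>)) \<in> hom C (fob SM (Y \<leadsto> \<Omega>)) (Y \<leadsto> fob T \<Omega>)"
    "expo_arr C (idn C Y) \<tau> \<in> hom C (Y \<leadsto> fob T \<Omega>) (Y \<leadsto> \<Omega>)"
    using \<tau> by (simp_all add: expo_arr_def Let_def hom_iff)
  then have "uncurry C Y \<Omega> (wp \<Sigma> C SM botS A a (state_algebra C T Y \<Omega> \<tau>) \<Gamma> M Q \<cdot> inv_arr C (rhc \<Gamma>))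
    = \<tau> \<cdot> (far T (ev C Y \<Omega>) \<cdot> (far T (under C Q (S.ty t) Y) \<cdot>
        (ev C Y (fob T (S.ty t \<otimes> Y)) \<cdot> \<langle>S.sm \<Gamma> M \<cdot> \<gamma>, pr2 C ?G Y\<rangle>)))"
    using inv(1) \<tau> Q S.sm_hom[OF M]
    by (simp add: uncurry_def wp_def state_algebra_def ev_expo_idn hom_iff \<gamma>_def)
  also have "\<dots> = wp (sps_sig \<Sigma>) C T botT (sps_base Y A) (sps_op \<Sigma> C T Y A a) \<tau> (sps_ctx \<Gamma>) (sps \<Sigma> \<Gamma> M)
        (uncurry C Y \<Omega> (Q \<cdot> ri t))"
    unfolding wp_def sm using far \<gamma>(1) S.sm_hom[OF M] by (simp add: hom_iff)
  finally show ?thesis .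
qed

lemma rhc_ground: "\<forall>s \<in> set \<Gamma>. ground s \<Longrightarrow> rhc \<Gamma> = idn C (S.cx \<Gamma>)"
  using rh_ground[of "ctx_ty \<Gamma>"] by (simp add: rho_ctx_def sem_ctx_def ground_ctx_ty)

text \<open>All isomorphisms involved are identities at ground types.\<close>

lemma wp_sps_ground:
  assumes M: "typing \<Sigma> \<Gamma> M t" and \<tau>: "\<tau> \<in> hom C (fob T \<Omega>) \<Omega>" and Q: "Q \<in> hom C (S.ty t) (Y \<leadsto> \<Omega>)"
    and ground: "\<forall>s \<in> set \<Gamma>. ground s" "ground t"
  shows "uncurry C Y \<Omega> (wp \<Sigma> C SM botS A a (state_algebra C T Y \<Omega> \<tau>) \<Gamma> M Q)
    = wp (sps_sig \<Sigma>) C T botT (sps_base Y A) (sps_op \<Sigma> C T Y A a) \<tau> (sps_ctx \<Gamma>) (sps \<Sigma> \<Gamma> M)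
        (uncurry C Y \<Omega> Q)"
proof -
  have "wp \<Sigma> C SM botS A a (state_algebra C T Y \<Omega> \<tau>) \<Gamma> M Q \<in> hom C (S.cx \<Gamma>) (Y \<leadsto> \<Omega>)"
    using S.sm_hom[OF M] Q \<tau> by (simp add: wp_def state_algebra_def expo_arr_def Let_def hom_iff)
  then show ?thesis
    using wp_sps[OF M \<tau> Q] Q by (simp add: rhc_ground[OF ground(1)] rh_ground[OF ground(2)] hom_iff)
qed

end

theorem theorem6p7:
  fixes C :: "('o, 'm) bicc" and \<Sigma> :: "('b, 'k, 'e) signature"
  assumes "stable_omega_cpo_bicc C" and "wf_signature \<Sigma>"
  shows
    "(\<forall>T bot0 A a U \<alpha> \<Omega>T \<Omega>U \<tau>T \<tau>U q \<Gamma> M t Q.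
        lcfix_structure \<Sigma> C T bot0 A a \<longrightarrow>
        strong_monad C U \<longrightarrow>
        strong_monad_morphism C T U \<alpha> \<longrightarrow>
        em_algebra C T \<Omega>T \<tau>T \<longrightarrow>
        em_algebra C U \<Omega>U \<tau>U \<longrightarrow>
        inference_query C U \<alpha> \<Omega>T \<tau>T \<Omega>U \<tau>U q \<longrightarrow>
        typing \<Sigma> \<Gamma> M t \<longrightarrow>
        (\<forall>s \<in> set \<Gamma>. ground s) \<longrightarrow>
        ground t \<longrightarrow>
        Q \<in> hom C (sem_ty C T A t) \<Omega>T \<longrightarrow>
        q \<cdot>\<^bsub>C\<^esub> wp \<Sigma> C T bot0 A a \<tau>T \<Gamma> M Q
          = wp \<Sigma> C U (\<alpha> \<zero>\<^bsub>C\<^esub> \<cdot>\<^bsub>C\<^esub> bot0) A (mor_op \<Sigma> C T \<alpha> A a) \<tau>U \<Gamma> M (q \<cdot>\<^bsub>C\<^esub> Q))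
     \<and>
     (\<forall>T Y botS botT A a \<Omega> \<tau>T \<Gamma> M t Q.
        let S = state_monad C T Y; A' = sps_base Y A; a' = sps_op \<Sigma> C T Y A a;
            \<tau>S = state_algebra C T Y \<Omega> \<tau>T
        in
          strong_monad C T \<longrightarrow>
          lcfix_structure \<Sigma> C S botS A a \<longrightarrow>
          lcfix_structure (sps_sig \<Sigma>) C T botT A' a' \<longrightarrow>
          em_algebra C T \<Omega> \<tau>T \<longrightarrow>
          typing \<Sigma> \<Gamma> M t \<longrightarrow>
          Q \<in> hom C (sem_ty C S A t) (Y \<leadsto>\<^bsub>C\<^esub> \<Omega>) \<longrightarrow>
          uncurry C Y \<Omega> (wp \<Sigma> C S botS A a \<tau>S \<Gamma> M Q \<cdot>\<^bsub>C\<^esub> inv_arr C (rho_ctx C T Y A \<Gamma>))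
            = wp (sps_sig \<Sigma>) C T botT A' a' \<tau>T (sps_ctx \<Gamma>) (sps \<Sigma> \<Gamma> M)
                (uncurry C Y \<Omega> (Q \<cdot>\<^bsub>C\<^esub> inv_arr C (rho C T Y A t)))
          \<and>
          ((\<forall>s \<in> set \<Gamma>. ground s) \<and> ground t \<longrightarrow>
             uncurry C Y \<Omega> (wp \<Sigma> C S botS A a \<tau>S \<Gamma> M Q)
               = wp (sps_sig \<Sigma>) C T botT A' a' \<tau>T (sps_ctx \<Gamma>) (sps \<Sigma> \<Gamma> M) (uncurry C Y \<Omega> Q)))"
  unfolding Let_def
proof (intro conjI allI impI)
  fix T U :: "('o, 'm) smonad" and bot0 A and a :: "'k + 'e \<Rightarrow> 'm" and \<alpha> \<Omega>T \<Omega>U \<tau>T \<tau>U q \<Gamma> M t Q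
  assume "lcfix_structure \<Sigma> C T bot0 A a" "strong_monad_morphism C T U \<alpha>"
  then interpret lcfix_morphism \<Sigma> C T bot0 A a U \<alpha>
    using assms(2) by (simp add: lcfix_structure_model lcfix_morphism_def lcfix_morphism_axioms_def)
  assume "em_algebra C T \<Omega>T \<tau>T" "em_algebra C U \<Omega>U \<tau>U" "inference_query C U \<alpha> \<Omega>T \<tau>T \<Omega>U \<tau>U q"
    "typing \<Sigma> \<Gamma> M t" "\<forall>s \<in> set \<Gamma>. ground s" "ground t" "Q \<in> hom C (sem_ty C T A t) \<Omega>T"
  then show "q \<cdot>\<^bsub>C\<^esub> wp \<Sigma> C T bot0 A a \<tau>T \<Gamma> M Q
      = wp \<Sigma> C U (\<alpha> \<zero>\<^bsub>C\<^esub> \<cdot>\<^bsub>C\<^esub> bot0) A (mor_op \<Sigma> C T \<alpha> A a) \<tau>U \<Gamma> M (q \<cdot>\<^bsub>C\<^esub> Q)"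
    by (intro wp_inference_query) (auto simp: em_algebra_def)
next
  fix T :: "('o, 'm) smonad" and Y botS botT A and a :: "'k + 'e \<Rightarrow> 'm" and \<Omega> \<tau>T \<Gamma> M t Q
  assume "lcfix_structure \<Sigma> C (state_monad C T Y) botS A a"
    "lcfix_structure (sps_sig \<Sigma>) C T botT (sps_base Y A) (sps_op \<Sigma> C T Y A a)"
  then interpret sps_model \<Sigma> C T Y botS botT A a
    using assms(2) by (simp add: lcfix_structure_model sps_model_def sps_model_axioms_def)
  assume "em_algebra C T \<Omega> \<tau>T" and M: "typing \<Sigma> \<Gamma> M t"
    and Q: "Q \<in> hom C (sem_ty C (state_monad C T Y) A t) (Y \<leadsto>\<^bsub>C\<^esub> \<Omega>)"
  then have \<tau>: "\<tau>T \<in> hom C (fob T \<Omega>) \<Omega>"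
    by (simp add: em_algebra_def)
  show "uncurry C Y \<Omega> (wp \<Sigma> C (state_monad C T Y) botS A a (state_algebra C T Y \<Omega> \<tau>T) \<Gamma> M Q
        \<cdot>\<^bsub>C\<^esub> inv_arr C (rho_ctx C T Y A \<Gamma>))
      = wp (sps_sig \<Sigma>) C T botT (sps_base Y A) (sps_op \<Sigma> C T Y A a) \<tau>T (sps_ctx \<Gamma>) (sps \<Sigma> \<Gamma> M)
          (uncurry C Y \<Omega> (Q \<cdot>\<^bsub>C\<^esub> inv_arr C (rho C T Y A t)))"
    by (rule wp_sps[OF M \<tau> Q])
  assume "(\<forall>s \<in> set \<Gamma>. ground s) \<and> ground t"
  then show "uncurry C Y \<Omega> (wp \<Sigma> C (state_monad C T Y) botS A a (state_algebra C T Y \<Omega> \<tau>T) \<Gamma> M Q)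
      = wp (sps_sig \<Sigma>) C T botT (sps_base Y A) (sps_op \<Sigma> C T Y A a) \<tau>T (sps_ctx \<Gamma>) (sps \<Sigma> \<Gamma> M)
          (uncurry C Y \<Omega> Q)"
    using wp_sps_ground[OF M \<tau> Q] by blast
qed

end
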